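(* Let $\Phi(\tau)=\int_0^\tau e^{-x^2/2}\,dx$ and $\Psi(\tau)=\tau\Phi(\tau)+e^{-\tau^2/2}$ for $\tau\ge0$. The functions $\mathbb M$ and $\mathbb L$ satisfy $$\mathbb M\big(f,\mathbb L(f,p,\lambda),\lambda\big)=p$$ for all $\lambda>0$, $f\in\mathbb R$, $p\in[0,1]$ with $0\le|f|\le\sqrt\lambda$ and $p\ge\dfrac{\Phi(|f|/\sqrt\lambda)}{\Phi(1)}$. Similarly, $$\mathbb L\big(f,\mathbb M(f,F,\lambda),\lambda\big)=F$$ for all $\lambda>0$, $f\in\mathbb R$, $F\in\mathbb R$ with $0\le|f|\le\sqrt\lambda$ and $|f|\le F\le\dfrac{\sqrt\lambda\,\Psi(|f|/\sqrt\lambda)}{\Psi(1)}$.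
   Context: $\mathcal D$ denotes the standard collection of dyadic intervals of $\mathbb R$. For $I\in\mathcal D$, $I_-$ and $I_+$ are its left and right halves, $\mathbf 1_I$ its indicator function, and $|E|$ denotes Lebesgue measure. For integrable $\varphi$, $\langle\varphi\rangle_I=\frac1{|I|}\int_I\varphi\,dx$. Functions are real-valued. For $J\in\mathcal D$ the (localized) dyadic square function is given by $$S_J^2\varphi(x)=\sum_{I\in\mathcal D,\ I\subseteq J}|\Delta_I\varphi|^2\,\mathbf 1_I(x),\qquad \Delta_I\varphi=\tfrac12\big(\langle\varphi\rangle_{I_+}-\langle\varphi\rangle_{I_-}\big)\big(\mathbf 1_{I_+}-\mathbf 1_{I_-}\big).$$ For $f\in\mathbb R$, $F\ge|f|$, $\lambda>0$, $$\mathbb M(f,F,\lambda)=\sup\frac1{|J|}|\{x\in J:S_J^2\varphi(x)\ge\lambda\}|,$$ the supremum being over all integrable $\varphi$ supported in $J\in\mathcal D$ with $\langle\varphi\rangle_J=f$ and $\langle|\varphi|\rangle_J=F$. For $f\in\mathbb R$, $0\le p\le1$, $\lambda>0$, $$\mathbb L(f,p,\lambda)=\inf\langle|\varphi|\rangle_J,$$ the infimum being over all integrable $\varphi$ supported in $J\in\mathcal D$ with $\langle\varphi\rangle_J=f$ and $\frac1{|J|}|\{x\in J:S_J^2\varphi(x)\ge\lambda\}|=p$. Neither quantity depends on the choice of $J$. *)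

theory Defs
  imports "HOL-Analysis.Analysis"
begin

definition dyadic :: "real set set" where
  "dyadic = {{of_int k * 2 powi n ..< (of_int k + 1) * 2 powi n} | (k :: int) (n :: int). True}"

definition left_half :: "real set \<Rightarrow> real set" where
  "left_half I = {Inf I ..< (Inf I + Sup I) / 2}"

definition right_half :: "real set \<Rightarrow> real set" where
  "right_half I = {(Inf I + Sup I) / 2 ..< Sup I}"

definition avg :: "real set \<Rightarrow> (real \<Rightarrow> real) \<Rightarrow> real" where
  "avg I \<phi> = (LINT x:I|lebesgue. \<phi> x) / measure lebesgue I"

definition Delta :: "real set \<Rightarrow> (real \<Rightarrow> real) \<Rightarrow> real \<Rightarrow> real" where
  "Delta I \<phi> x = 1/2 * (avg (right_half I) \<phi> - avg (left_half I) \<phi>)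
     * (indicator (right_half I) x - indicator (left_half I) x)"

text \<open>The square of the localized dyadic square function. It takes values in the extended
  nonnegative reals, because the series may diverge at some points.\<close>
definition sq_fun2 :: "real set \<Rightarrow> (real \<Rightarrow> real) \<Rightarrow> real \<Rightarrow> ennreal" where
  "sq_fun2 J \<phi> x = (\<Sum>\<^sub>\<infinity>I\<in>{I \<in> dyadic. I \<subseteq> J}. ennreal (\<bar>Delta I \<phi> x\<bar>\<^sup>2 * indicator I x))"

definition level_frac :: "real set \<Rightarrow> (real \<Rightarrow> real) \<Rightarrow> real \<Rightarrow> real" where
  "level_frac J \<phi> lam =
     measure lebesgue {x \<in> J. ennreal lam \<le> sq_fun2 J \<phi> x} / measure lebesgue J"

definition admissible :: "real set \<Rightarrow> (real \<Rightarrow> real) \<Rightarrow> bool" where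
  "admissible J \<phi> \<longleftrightarrow> integrable lebesgue \<phi> \<and> (\<forall>x. x \<notin> J \<longrightarrow> \<phi> x = 0)"

text \<open>The supremum and infimum below are real-valued. For a dyadic interval \<open>J\<close> and \<open>lam > 0\<close> the
  first set is contained in \<open>{0..1}\<close> and is nonempty when \<open>\<bar>f\<bar> \<le> F\<close> (take the values \<open>f + F\<close> and
  \<open>f - F\<close> on the two halves of \<open>J\<close>). The second set is bounded below by \<open>0\<close> and is nonempty when
  \<open>p \<in> {0..1}\<close> (perturb the constant \<open>f\<close> by plus and minus \<open>sqrt lam\<close> on the halves of each of
  countably many disjoint dyadic subintervals of total measure \<open>p * \<bar>J\<bar>\<close>).\<close>
definition Bell_M :: "real set \<Rightarrow> real \<Rightarrow> real \<Rightarrow> real \<Rightarrow> real" where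
  "Bell_M J f F lam = Sup {level_frac J \<phi> lam | \<phi>.
     admissible J \<phi> \<and> avg J \<phi> = f \<and> avg J (\<lambda>x. \<bar>\<phi> x\<bar>) = F}"

definition Bell_L :: "real set \<Rightarrow> real \<Rightarrow> real \<Rightarrow> real \<Rightarrow> real" where
  "Bell_L J f p lam = Inf {avg J (\<lambda>x. \<bar>\<phi> x\<bar>) | \<phi>.
     admissible J \<phi> \<and> avg J \<phi> = f \<and> level_frac J \<phi> lam = p}"

definition Phi :: "real \<Rightarrow> real" where
  "Phi \<tau> = integral {0..\<tau>} (\<lambda>x. exp (- x\<^sup>2 / 2))"

definition Psi :: "real \<Rightarrow> real" where
  "Psi \<tau> = \<tau> * Phi \<tau> + exp (- \<tau>\<^sup>2 / 2)"

end

(*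
  Normalise lam = 1. S^2 is the quadratic variation of the dyadic martingale of averages. For a fixed mean f, the set of attainable pairs (level fraction p, mean F of |phi|) is convex, because one may glue copies of two
  functions with the same mean along a dyadic partition. Hence M(f, .) is concave and L(f, .) is convex, and
  they are inverse to each other wherever neither has a plateau; no extremal functions are needed. The
  plateaus are located by two inequalities: L(f, 1) >= Psi(|f|) / Psi(1), and M(f, |f|) <= Phi(|f|) / Phi(1).
  Both follow by induction along the dyadic tree from a midpoint inequality for a self-similar solution of
  the heat equation. Two regularity facts remain: L(f, .) is Lipschitz (perturb phi on the small set where S
  is small) and M(f, .) is right-continuous at |f| (by the weak-type inequality).
*)
theory Submission
  imports Defs
begin

section \<open>The Gaussian functions and the two midpoint inequalities\<close>

text \<open>A jump of the martingale moves \<open>(x, lam)\<close> to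
  \<open>(x + a, lam - a^2)\<close> or \<open>(x - a, lam - a^2)\<close>. For small \<open>a\<close>
  the midpoint inequality compares the second derivative in \<open>x\<close> with twice the
  derivative in \<open>lam\<close>; equality is the heat equation with time
  \<open>lam = s^2\<close>. Scaling fixes the homogeneity in \<open>(x, s)\<close>: degree one for a
  mean of the modulus, degree zero for a fraction of measure, whence \<open>s * Psi (x / s)\<close>
  and \<open>Phi (x / s)\<close>. The values \<open>\<bar>x\<bar>\<close> and 1 on the boundary of
  the cone \<open>\<bar>x\<bar> < s\<close> produce the constants \<open>Psi 1\<close> and
  \<open>Phi 1\<close>. The obstacle is that dyadic jumps are not small: the inequality is needed
  for every \<open>a\<close>, also when landing points leave the cone, where the boundary values
  replace the heat solution. A second obstacle is that \<open>S^2 \<ge> lam\<close> may be reached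
  only after infinitely many generations, whereas an induction sees finitely many; the bounds are
  therefore proved for levels below \<open>lam\<close> and transferred by continuity.\<close>

definition gauss_int :: "real \<Rightarrow> real" where
  "gauss_int t = Phi t - Phi (- t)"

definition gauss :: "real \<Rightarrow> real" where
  "gauss t = exp (- t\<^sup>2 / 2)"

lemma gauss_pos [simp]: "0 < gauss t"
  by (simp add: gauss_def)

lemma gauss_minus [simp]: "gauss (- t) = gauss t"
  by (simp add: gauss_def)

lemma gauss_0 [simp]: "gauss 0 = 1"
  by (simp add: gauss_def)

lemma gauss_int_minus [simp]: "gauss_int (- t) = - gauss_int t"
  by (simp add: gauss_int_def)

lemma gauss_int_0 [simp]: "gauss_int 0 = 0"
  by (simp add: gauss_int_def)

lemma DERIV_gauss [derivative_intros]:
  assumes "(h has_real_derivative d) (at t within A)"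
  shows "((\<lambda>t. gauss (h t)) has_real_derivative - h t * gauss (h t) * d) (at t within A)"
  unfolding gauss_def using assms
  by (auto intro!: derivative_eq_intros simp: power2_eq_square)

text \<open>\<open>Phi\<close> vanishes at negative arguments, where it integrates over an empty
  interval, so \<open>gauss_int\<close> is its odd extension. It agrees with a global antiderivative
  of \<open>gauss\<close> normalised at 0.\<close>

lemma DERIV_gauss_int_at: "(gauss_int has_real_derivative gauss t) (at t)"
proof -
  have "\<exists>F. \<forall>x::real. (-\<infinity>::ereal) < ereal x \<longrightarrow> ereal x < \<infinity> \<longrightarrow> (F has_vector_derivative gauss x) (at x)"
    by (rule einterval_antiderivative) (auto simp: gauss_def intro!: continuous_intros)
  then obtain F where F: "\<And>x. (F has_real_derivative gauss x) (at x)"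
    by (auto simp: has_real_derivative_iff_has_vector_derivative)
  have Phi_F: "Phi t = F t - F 0" if "0 \<le> t" for t
  proof -
    have "(gauss has_integral F t - F 0) {0..t}"
      using F that by (intro fundamental_theorem_of_calculus)
        (auto simp flip: has_real_derivative_iff_has_vector_derivative intro: DERIV_subset)
    then show ?thesis
      by (simp add: Phi_def gauss_def[abs_def] integral_unique)
  qed
  have odd: "F t + F (- t) = 2 * F 0" for t
  proof -
    have "((\<lambda>t. F t + F (- t)) has_real_derivative 0) (at x)" for x
      by (rule derivative_eq_intros F DERIV_chain2[OF F] refl)+ (simp add: gauss_def)
    then have "F t + F (- t) = F 0 + F (- 0)"
      using DERIV_isconst_all[of "\<lambda>t. F t + F (- t)" t 0] by blast
    then show ?thesis by simp
  qed
  have neg: "Phi t = 0" if "t \<le> 0" for t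
    using that by (cases "t = 0") (auto simp: Phi_def)
  have "gauss_int t = F t - F 0" for t
  proof (cases "0 \<le> t")
    case True
    then show ?thesis using Phi_F[of t] neg[of "- t"] by (simp add: gauss_int_def)
  next
    case False
    then show ?thesis using Phi_F[of "- t"] neg[of t] odd[of t] by (simp add: gauss_int_def)
  qed
  then have "gauss_int = (\<lambda>t. F t - F 0)" by auto
  then show ?thesis
    using DERIV_diff[OF F DERIV_const, of "F 0" t] by simp
qed

lemma DERIV_gauss_int [derivative_intros]:
  assumes "(h has_real_derivative d) (at t within A)"
  shows "((\<lambda>t. gauss_int (h t)) has_real_derivative gauss (h t) * d) (at t within A)"
  using DERIV_chain2[OF DERIV_gauss_int_at assms] by simp

lemma Phi_eq_gauss_int: "0 \<le> t \<Longrightarrow> Phi t = gauss_int t"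
  by (cases "t = 0") (auto simp: gauss_int_def Phi_def)

lemma gauss_int_mono: "s \<le> t \<Longrightarrow> gauss_int s \<le> gauss_int t"
  by (rule DERIV_nonneg_imp_nondecreasing[of s t gauss_int])
    (auto intro!: exI DERIV_gauss_int_at less_imp_le)

lemma gauss_int_strict_mono: "s < t \<Longrightarrow> gauss_int s < gauss_int t"
  by (rule DERIV_pos_imp_increasing[of s t gauss_int]) (auto intro!: exI DERIV_gauss_int_at)

lemma gauss_int_1_pos: "0 < gauss_int 1"
  using gauss_int_strict_mono[of 0 1] by simp

lemma gauss_int_nonneg: "0 \<le> t \<Longrightarrow> 0 \<le> gauss_int t"
  using gauss_int_mono[of 0 t] by simp

text \<open>For \<open>s\<^sup>2\<close> as time, this is the solution \<open>s * Psi (y / s)\<close> of \<open>u\<^sub>t = u\<^sub>y\<^sub>y / 2\<close>, extended evenly to \<open>y < 0\<close>.\<close>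
definition heat :: "real \<Rightarrow> real \<Rightarrow> real" where
  "heat s y = y * gauss_int (y / s) + s * gauss (y / s)"

lemma heat_minus [simp]: "heat s (- y) = heat s y"
  by (simp add: heat_def)

lemma heat_abs [simp]: "heat s \<bar>y\<bar> = heat s y"
  by (simp add: abs_if)

lemma heat_eq_Psi: "0 < s \<Longrightarrow> 0 \<le> y \<Longrightarrow> heat s y = s * Psi (y / s)"
  by (simp add: heat_def Psi_def Phi_eq_gauss_int gauss_def field_simps)

lemma heat_diag: "0 < s \<Longrightarrow> heat s s = s * Psi 1"
  by (simp add: heat_eq_Psi)

lemma Psi_1: "Psi 1 = gauss_int 1 + gauss 1"
  by (simp add: Psi_def Phi_eq_gauss_int gauss_def)

lemma Psi_1_pos: "0 < Psi 1"
  using gauss_int_1_pos by (simp add: Psi_1 add_pos_pos)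

text \<open>The contributions of the derivative of \<open>y t / s t\<close> cancel, since
  \<open>gauss\<close> has derivative \<open>- z * gauss z\<close>. What remains are the partial
  derivatives \<open>gauss (y / s)\<close> in \<open>s\<close> and \<open>gauss_int (y / s)\<close>
  in \<open>y\<close>.\<close>

lemma DERIV_heat [derivative_intros]:
  assumes "(s has_real_derivative s') (at t)" "(y has_real_derivative y') (at t)" "s t > 0"
  shows "((\<lambda>t. heat (s t) (y t)) has_real_derivative
           s' * gauss (y t / s t) + y' * gauss_int (y t / s t)) (at t)"
proof -
  have q: "((\<lambda>t. y t / s t) has_real_derivative (y' * s t - y t * s') / (s t * s t)) (at t)"
    using assms by (intro DERIV_divide) auto
  show ?thesis
    unfolding heat_def
    using DERIV_add[OF DERIV_mult[OF assms(2) DERIV_gauss_int[OF q]] DERIV_mult[OF assms(1) DERIV_gauss[OF q]]]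
    by (rule DERIV_cong) (use assms(3) in \<open>simp add: field_simps\<close>)
qed

section \<open>Trapezoid inequalities, and midpoint inequalities inside the cone\<close>

lemma gauss_id_mono:
  assumes "- 1 \<le> z" "z \<le> w" "w \<le> 1"
  shows "z * gauss z \<le> w * gauss w"
proof (rule DERIV_nonneg_imp_nondecreasing[OF assms(2)])
  fix x assume x: "z \<le> x" "x \<le> w"
  have "((\<lambda>t. t * gauss t) has_real_derivative (1 - x\<^sup>2) * gauss x) (at x)"
    by (auto intro!: derivative_eq_intros simp: power2_eq_square algebra_simps)
  moreover have "x\<^sup>2 \<le> 1"
    using x assms by (simp add: abs_square_le_1)
  ultimately show "\<exists>y. ((\<lambda>t. t * gauss t) has_real_derivative y) (at x) \<and> 0 \<le> y"
    by (auto intro!: exI mult_nonneg_nonneg less_imp_le[OF gauss_pos])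
qed

lemma gauss_snd_deriv_antimono:
  assumes "0 \<le> z" "z \<le> w" "w \<le> 1"
  shows "(1 - w\<^sup>2) * gauss w \<le> (1 - z\<^sup>2) * gauss z"
proof (rule DERIV_nonpos_imp_nonincreasing[OF assms(2)])
  fix x assume x: "z \<le> x" "x \<le> w"
  have "((\<lambda>t. (1 - t\<^sup>2) * gauss t) has_real_derivative - (x * (3 - x\<^sup>2) * gauss x)) (at x)"
    by (auto intro!: derivative_eq_intros simp: power2_eq_square algebra_simps)
  moreover have "x\<^sup>2 \<le> 1" "0 \<le> x"
    using x assms by (simp_all add: abs_square_le_1)
  ultimately show "\<exists>y. ((\<lambda>t. (1 - t\<^sup>2) * gauss t) has_real_derivative y) (at x) \<and> y \<le> 0"
    by (intro exI[of _ "- (x * (3 - x\<^sup>2) * gauss x)"]) (auto intro!: mult_nonneg_nonneg less_imp_le[OF gauss_pos])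
qed

text \<open>The trapezoid rule underestimates the integral of \<open>gauss\<close>, which is concave
  on [-1, 1]; the hypotheses place both nodes there.\<close>

lemma trapezoid_gauss_int:
  assumes "0 \<le> \<alpha>" "0 \<le> \<beta>" "\<alpha> + \<beta> \<le> 1"
  shows "\<beta> * (gauss (\<alpha> + \<beta>) + gauss (\<alpha> - \<beta>)) \<le> gauss_int (\<alpha> + \<beta>) - gauss_int (\<alpha> - \<beta>)"
proof -
  let ?Q = "\<lambda>\<beta>. gauss_int (\<alpha> + \<beta>) - gauss_int (\<alpha> - \<beta>) - \<beta> * (gauss (\<alpha> + \<beta>) + gauss (\<alpha> - \<beta>))"
  have "?Q 0 \<le> ?Q \<beta>"
  proof (rule DERIV_nonneg_imp_nondecreasing[OF assms(2)])
    fix x assume x: "0 \<le> x" "x \<le> \<beta>"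
    let ?d = "x * ((\<alpha> + x) * gauss (\<alpha> + x) - (\<alpha> - x) * gauss (\<alpha> - x))"
    have "(?Q has_real_derivative ?d) (at x)"
      by (auto intro!: derivative_eq_intros simp: algebra_simps)
    moreover have "0 \<le> ?d"
      using gauss_id_mono[of "\<alpha> - x" "\<alpha> + x"] x assms by (intro mult_nonneg_nonneg) auto
    ultimately show "\<exists>y. (?Q has_real_derivative y) (at x) \<and> 0 \<le> y" by blast
  qed
  then show ?thesis by simp
qed

text \<open>This is the trapezoid rule for \<open>- z * gauss z\<close>, the derivative of
  \<open>gauss\<close>. That function is convex on [0, 1], so the rule overestimates its integral;
  \<open>\<beta> \<le> \<alpha>\<close> keeps the left node nonnegative.\<close>

lemma trapezoid_gauss:
  assumes "0 \<le> \<beta>" "\<beta> \<le> \<alpha>" "\<alpha> + \<beta> \<le> 1"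
  shows "gauss (\<alpha> + \<beta>) * (1 + \<beta> * (\<alpha> + \<beta>)) \<le> gauss (\<alpha> - \<beta>) * (1 - \<beta> * (\<alpha> - \<beta>))"
proof -
  let ?Q = "\<lambda>\<beta>. gauss (\<alpha> + \<beta>) * (1 + \<beta> * (\<alpha> + \<beta>)) - gauss (\<alpha> - \<beta>) * (1 - \<beta> * (\<alpha> - \<beta>))"
  have "?Q \<beta> \<le> ?Q 0"
  proof (rule DERIV_nonpos_imp_nonincreasing[OF assms(1)])
    fix x assume x: "0 \<le> x" "x \<le> \<beta>"
    let ?d = "- (x * ((1 - (\<alpha> - x)\<^sup>2) * gauss (\<alpha> - x) - (1 - (\<alpha> + x)\<^sup>2) * gauss (\<alpha> + x)))"
    have "(?Q has_real_derivative ?d) (at x)"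
      by (auto intro!: derivative_eq_intros simp: algebra_simps power2_eq_square)
    moreover have "?d \<le> 0"
      using gauss_snd_deriv_antimono[of "\<alpha> - x" "\<alpha> + x"] x assms by (auto intro!: mult_nonneg_nonneg)
    ultimately show "\<exists>y. (?Q has_real_derivative y) (at x) \<and> y \<le> 0" by blast
  qed
  then show ?thesis by simp
qed

text \<open>If the far landing point of the jump \<open>a\<close> lies in the cone, so do those of
  all smaller jumps. This permits differentiation in the jump size.\<close>

lemma sqrt_cone_mono:
  assumes "0 \<le> t" "t \<le> a" "x + a \<le> sqrt (lam - a\<^sup>2)"
  shows "x + t \<le> sqrt (lam - t\<^sup>2)"
proof -
  have "sqrt (lam - a\<^sup>2) \<le> sqrt (lam - t\<^sup>2)"
    using assms by (auto intro!: power_mono)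
  then show ?thesis using assms by linarith
qed

lemma DERIV_sqrt_diff:
  assumes "t\<^sup>2 < lam"
  shows "((\<lambda>t. sqrt (lam - t\<^sup>2)) has_real_derivative - t / sqrt (lam - t\<^sup>2)) (at t)"
  using assms by (auto intro!: derivative_eq_intros simp: field_simps)

lemma DERIV_sqrt_sum:
  assumes "0 < c"
  shows "((\<lambda>t. sqrt (c + t\<^sup>2)) has_real_derivative t / sqrt (c + t\<^sup>2)) (at t)"
proof -
  have c: "0 < c + t\<^sup>2" using assms by (simp add: add_pos_nonneg)
  have "((\<lambda>t. c + t\<^sup>2) has_real_derivative 2 * t) (at t)"
    by (auto intro!: derivative_eq_intros)
  from DERIV_chain2[OF DERIV_real_sqrt[OF c] this] show ?thesis
    by (rule DERIV_cong) (simp add: field_simps)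
qed

text \<open>Both sides agree for jump 0. As the jump grows, the derivative of the right side is
  nonnegative by \<open>trapezoid_gauss_int\<close> with nodes centred at \<open>x / s\<close> and
  half-width \<open>t / s\<close>.\<close>

lemma heat_cone:
  assumes "0 \<le> x" "0 \<le> a" "a\<^sup>2 < lam" "x + a \<le> sqrt (lam - a\<^sup>2)"
  shows "2 * heat (sqrt lam) x \<le> heat (sqrt (lam - a\<^sup>2)) (x + a) + heat (sqrt (lam - a\<^sup>2)) (x - a)"
proof -
  let ?g = "\<lambda>a. heat (sqrt (lam - a\<^sup>2)) (x + a) + heat (sqrt (lam - a\<^sup>2)) (x - a)"
  have "?g 0 \<le> ?g a"
  proof (rule DERIV_nonneg_imp_nondecreasing[OF assms(2)])
    fix t assume t: "0 \<le> t" "t \<le> a"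
    define s where "s = sqrt (lam - t\<^sup>2)"
    have "t\<^sup>2 \<le> a\<^sup>2" using t by (auto intro!: power_mono)
    then have l: "t\<^sup>2 < lam" using assms by linarith
    then have s: "0 < s" by (simp add: s_def)
    have le: "x / s + t / s \<le> 1"
      using sqrt_cone_mono[OF t assms(4)] s by (simp add: s_def field_simps)
    let ?d = "(- t / s) * gauss ((x + t) / s) + 1 * gauss_int ((x + t) / s)
      + ((- t / s) * gauss ((x - t) / s) + (-1) * gauss_int ((x - t) / s))"
    have "(?g has_real_derivative ?d) (at t)"
      unfolding s_def
      by (intro DERIV_add DERIV_heat DERIV_sqrt_diff l)
        (use l in \<open>auto intro!: derivative_eq_intros\<close>)
    moreover have "0 \<le> ?d"
      using trapezoid_gauss_int[of "x / s" "t / s"] assms(1) t s le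
      by (simp add: add_divide_distrib diff_divide_distrib algebra_simps)
    ultimately show "\<exists>y. (?g has_real_derivative y) (at t) \<and> 0 \<le> y" by blast
  qed
  then show ?thesis by simp
qed

text \<open>Differentiation in the jump size again. The sign now comes from
  \<open>trapezoid_gauss\<close>, whose condition \<open>\<beta> \<le> \<alpha>\<close> is supplied
  by \<open>a \<le> x\<close>.\<close>

lemma gauss_int_cone:
  assumes "0 \<le> a" "a \<le> x" "a\<^sup>2 < lam" "x + a \<le> sqrt (lam - a\<^sup>2)"
  shows "gauss_int ((x + a) / sqrt (lam - a\<^sup>2)) + gauss_int ((x - a) / sqrt (lam - a\<^sup>2))
    \<le> 2 * gauss_int (x / sqrt lam)"
proof -
  let ?g = "\<lambda>a. gauss_int ((x + a) / sqrt (lam - a\<^sup>2)) + gauss_int ((x - a) / sqrt (lam - a\<^sup>2))"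
  have "?g a \<le> ?g 0"
  proof (rule DERIV_nonpos_imp_nonincreasing[OF assms(1)])
    fix t assume t: "0 \<le> t" "t \<le> a"
    define s where "s = sqrt (lam - t\<^sup>2)"
    have "t\<^sup>2 \<le> a\<^sup>2" using t by (auto intro!: power_mono)
    then have l: "t\<^sup>2 < lam" using assms by linarith
    then have s: "0 < s" by (simp add: s_def)
    have le: "x / s + t / s \<le> 1"
      using sqrt_cone_mono[OF t assms(4)] s by (simp add: s_def field_simps)
    let ?d = "gauss ((x + t) / s) * ((1 * s - (x + t) * (- t / s)) / (s * s))
      + gauss ((x - t) / s) * ((-1 * s - (x - t) * (- t / s)) / (s * s))"
    have "(?g has_real_derivative ?d) (at t)"
      unfolding s_def
      by (intro DERIV_add DERIV_gauss_int DERIV_divide DERIV_sqrt_diff l)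
        (use l in \<open>auto intro!: derivative_eq_intros\<close>)
    moreover have "?d = (gauss (x / s + t / s) * (1 + t / s * (x / s + t / s))
       - gauss (x / s - t / s) * (1 - t / s * (x / s - t / s))) / s"
    proof -
      have "(1 * s - (x + t) * (- t / s)) / (s * s) = (1 + t / s * (x / s + t / s)) / s"
        "(-1 * s - (x - t) * (- t / s)) / (s * s) = - (1 - t / s * (x / s - t / s)) / s"
        using s by (simp_all add: field_simps)
      moreover have "(x + t) / s = x / s + t / s" "(x - t) / s = x / s - t / s"
        by (simp_all add: add_divide_distrib diff_divide_distrib)
      moreover have "e1 * (A / s) + e2 * (- B / s) = (e1 * A - e2 * B) / s" for e1 e2 A B
        by (simp add: diff_divide_distrib)
      ultimately show ?thesis by (simp only:)
    qed
    moreover have "\<dots> \<le> 0"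
      using trapezoid_gauss[of "t / s" "x / s"] divide_right_mono[of t x s] assms t s le
      by (auto intro!: divide_nonpos_pos)
    ultimately show "\<exists>y. (?g has_real_derivative y) (at t) \<and> y \<le> 0" by auto
  qed
  then show ?thesis by simp
qed

section \<open>Jumps that leave the cone\<close>

lemma gauss_int_plus_gauss_le: "gauss_int \<sigma> + gauss \<sigma> \<le> Psi 1"
proof -
  let ?k = "\<lambda>t. gauss_int t + gauss t"
  have d: "(?k has_real_derivative (1 - t) * gauss t) (at t)" for t
    by (auto intro!: derivative_eq_intros simp: algebra_simps)
  have "?k \<sigma> \<le> ?k 1"
  proof (cases "\<sigma> \<le> 1")
    case True
    then show ?thesis
      by (rule DERIV_nonneg_imp_nondecreasing) (auto intro!: exI d mult_nonneg_nonneg less_imp_le[OF gauss_pos])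
  next
    case False
    then have "1 \<le> \<sigma>" by simp
    then show ?thesis
      by (rule DERIV_nonpos_imp_nonincreasing) (auto intro!: exI d mult_nonpos_nonneg less_imp_le[OF gauss_pos])
  qed
  then show ?thesis by (simp add: Psi_1)
qed

text \<open>The landing point \<open>(y, s)\<close> of the jump is held fixed while the jump size \<open>a\<close> varies. At the smallest
  admissible \<open>a\<close> the other landing point lies on the boundary of the cone, so \<open>heat_cone\<close> applies there;
  from then on the difference of the two sides grows, because \<open>gauss_int + gauss\<close> is maximal at \<open>1\<close>.\<close>
lemma heat_outer:
  assumes "0 < s" "\<bar>y\<bar> \<le> s" "s \<le> y + 2 * a"
  shows "2 * heat (sqrt (s\<^sup>2 + a\<^sup>2)) (y + a) \<le> Psi 1 * (y + 2 * a) + heat s y"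
proof -
  define a0 where "a0 = (s - y) / 2"
  have a0: "0 \<le> a0" "a0 \<le> a" using assms by (auto simp: a0_def)
  have ya0: "y + 2 * a0 = s" by (simp add: a0_def field_simps)
  let ?k = "\<lambda>t. Psi 1 * (y + 2 * t) + heat s y - 2 * heat (sqrt (s\<^sup>2 + t\<^sup>2)) (y + t)"
  have "?k a0 \<le> ?k a"
  proof (rule DERIV_nonneg_imp_nondecreasing[OF a0(2)])
    fix t assume t: "a0 \<le> t" "t \<le> a"
    define r where "r = sqrt (s\<^sup>2 + t\<^sup>2)"
    let ?d = "2 * Psi 1 - 2 * (t / r * gauss ((y + t) / r) + 1 * gauss_int ((y + t) / r))"
    have r: "0 < r" using assms(1) by (simp add: r_def add_pos_nonneg)
    have "((\<lambda>t. heat (sqrt (s\<^sup>2 + t\<^sup>2)) (y + t)) has_real_derivative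
      (t / r * gauss ((y + t) / r) + 1 * gauss_int ((y + t) / r))) (at t)"
      unfolding r_def by (intro DERIV_heat DERIV_sqrt_sum)
        (use assms(1) in \<open>auto intro!: derivative_eq_intros add_pos_nonneg\<close>)
    then have "(?k has_real_derivative Psi 1 * (0 + 2 * 1) + 0 - 2 * (t / r * gauss ((y + t) / r) + 1 * gauss_int ((y + t) / r))) (at t)"
      by (intro DERIV_diff DERIV_add DERIV_cmult DERIV_const DERIV_ident)
    then have "(?k has_real_derivative ?d) (at t)" by (simp only: add_0 mult_1_right add_0_right mult.commute[of "Psi 1"])
    moreover have "t / r \<le> 1"
      using r by (simp add: r_def real_le_rsqrt)
    then have "t / r * gauss ((y + t) / r) \<le> gauss ((y + t) / r)"
      using mult_right_mono[of "t / r" 1 "gauss ((y + t) / r)"] less_imp_le[OF gauss_pos] by auto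
    then have "0 \<le> ?d"
      using gauss_int_plus_gauss_le[of "(y + t) / r"] by simp
    ultimately show "\<exists>y. (?k has_real_derivative y) (at t) \<and> 0 \<le> y" by blast
  qed
  moreover have "0 \<le> ?k a0"
  proof -
    have "0 \<le> y + a0" using assms(2) by (simp add: a0_def field_simps)
    then have "2 * heat (sqrt (s\<^sup>2 + a0\<^sup>2)) (y + a0) \<le>
      heat (sqrt (s\<^sup>2 + a0\<^sup>2 - a0\<^sup>2)) (y + a0 + a0) + heat (sqrt (s\<^sup>2 + a0\<^sup>2 - a0\<^sup>2)) (y + a0 - a0)"
      using assms a0 by (intro heat_cone) (auto simp: a0_def)
    also have "\<dots> = heat s s + heat s y"
      using assms by (simp add: a0_def)
    finally show ?thesis
      using heat_diag[OF assms(1)] by (simp only: ya0) (simp add: mult.commute)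
  qed
  ultimately show ?thesis by simp
qed

text \<open>As in \<open>heat_outer\<close>, the landing point \<open>(y, s)\<close> stays fixed.
  The last hypothesis says that the starting point \<open>x = y + a\<close>,
  \<open>lam = s^2 + a^2\<close> satisfies \<open>x^2 \<le> lam\<close>; it makes
  \<open>(y + t) / sqrt (s^2 + t^2)\<close> nondecreasing up to \<open>t = a\<close>.\<close>

lemma gauss_int_outer:
  assumes "0 < s" "0 \<le> y" "y \<le> s" "s \<le> y + 2 * a" "y\<^sup>2 + 2 * y * a \<le> s\<^sup>2"
  shows "gauss_int 1 + gauss_int (y / s) \<le> 2 * gauss_int ((y + a) / sqrt (s\<^sup>2 + a\<^sup>2))"
proof -
  define a0 where "a0 = (s - y) / 2"
  have a0: "0 \<le> a0" "a0 \<le> a" using assms by (auto simp: a0_def)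
  let ?k = "\<lambda>t. gauss_int ((y + t) / sqrt (s\<^sup>2 + t\<^sup>2))"
  have "?k a0 \<le> ?k a"
  proof (rule DERIV_nonneg_imp_nondecreasing[OF a0(2)])
    fix t assume t: "a0 \<le> t" "t \<le> a"
    define r where "r = sqrt (s\<^sup>2 + t\<^sup>2)"
    have r: "0 < r" using assms(1) by (simp add: r_def add_pos_nonneg)
    have rr: "r\<^sup>2 = s\<^sup>2 + t\<^sup>2" by (simp add: r_def)
    let ?d = "gauss ((y + t) / r) * ((1 * r - (y + t) * (t / r)) / (r * r))"
    have "(?k has_real_derivative ?d) (at t)"
      unfolding r_def by (intro DERIV_gauss_int DERIV_divide DERIV_sqrt_sum)
        (use assms(1) r r_def in \<open>auto intro!: derivative_eq_intros\<close>)
    moreover have "y * t \<le> y * a" using t assms by (intro mult_left_mono) auto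
    then have "(y + t) * t \<le> r\<^sup>2"
      using assms(5) rr mult_nonneg_nonneg[OF assms(2), of t] zero_le_power2[of y] a0 t
      unfolding power2_eq_square distrib_right by linarith
    then have "0 \<le> ?d"
      using r by (intro mult_nonneg_nonneg divide_nonneg_nonneg less_imp_le[OF gauss_pos])
        (auto simp: field_simps power2_eq_square)
    ultimately show "\<exists>y. (?k has_real_derivative y) (at t) \<and> 0 \<le> y" by blast
  qed
  moreover have "gauss_int 1 + gauss_int (y / s) \<le> 2 * ?k a0"
  proof -
    have "gauss_int ((y + a0 + a0) / sqrt (s\<^sup>2 + a0\<^sup>2 - a0\<^sup>2)) + gauss_int ((y + a0 - a0) / sqrt (s\<^sup>2 + a0\<^sup>2 - a0\<^sup>2))
      \<le> 2 * gauss_int ((y + a0) / sqrt (s\<^sup>2 + a0\<^sup>2))"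
    proof (cases "a0 \<le> y + a0")
      case True
      then show ?thesis using assms a0 by (intro gauss_int_cone) (auto simp: a0_def)
    qed (use assms in auto)
    then show ?thesis using assms by (simp add: a0_def)
  qed
  ultimately show ?thesis by linarith
qed


text \<open>Candidate lower bound for the mean of the modulus when the mean is \<open>x\<close> and
  the level \<open>lam\<close> is reached everywhere. For \<open>lam \<le> 0\<close> the first
  branch applies, so the formula stays meaningful after jumps have exhausted the level.\<close>

definition lower_bell :: "real \<Rightarrow> real \<Rightarrow> real" where
  "lower_bell x lam = (if sqrt lam \<le> \<bar>x\<bar> then \<bar>x\<bar> else heat (sqrt lam) x / Psi 1)"

lemma lower_bell_abs [simp]: "lower_bell \<bar>x\<bar> lam = lower_bell x lam"
  by (simp add: lower_bell_def)

lemma lower_bell_inside: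
  assumes "\<bar>x\<bar> \<le> sqrt lam" "0 < lam"
  shows "lower_bell x lam = heat (sqrt lam) x / Psi 1"
proof (cases "\<bar>x\<bar> = sqrt lam")
  case True
  then have "heat (sqrt lam) x = heat (sqrt lam) (sqrt lam)"
    by (metis heat_abs)
  then show ?thesis
    using True assms Psi_1_pos by (simp add: lower_bell_def heat_diag)
qed (use assms in \<open>auto simp: lower_bell_def\<close>)

text \<open>The difference of the two sides vanishes at \<open>y = s\<close> and decreases up to
  there, because \<open>gauss_int \<le> Psi 1\<close>.\<close>

lemma heat_ge_diag:
  assumes "0 < s" "0 \<le> y" "y \<le> s"
  shows "y * Psi 1 \<le> heat s y"
proof -
  have "heat s s - s * Psi 1 \<le> heat s y - y * Psi 1"
  proof (rule DERIV_nonpos_imp_nonincreasing[OF assms(3)])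
    fix x
    have "((\<lambda>y. heat s y) has_real_derivative 0 * gauss (x / s) + 1 * gauss_int (x / s)) (at x)"
      by (intro DERIV_heat DERIV_const DERIV_ident assms(1))
    from DERIV_diff[OF this DERIV_cmult_right[OF DERIV_ident, of "Psi 1"]]
    have "((\<lambda>y. heat s y - y * Psi 1) has_real_derivative gauss_int (x / s) - Psi 1) (at x)"
      by simp
    moreover have "gauss_int (x / s) - Psi 1 \<le> 0"
      using gauss_int_plus_gauss_le[of "x / s"] gauss_pos[of "x / s"] by linarith
    ultimately show "\<exists>d. ((\<lambda>y. heat s y - y * Psi 1) has_real_derivative d) (at x) \<and> d \<le> 0"
      by blast
  qed
  then show ?thesis using heat_diag[OF assms(1)] by simp
qed

lemma lower_bell_ge: "\<bar>x\<bar> \<le> lower_bell x lam"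
proof (cases "sqrt lam \<le> \<bar>x\<bar>")
  case False
  then have "\<bar>x\<bar> * Psi 1 \<le> heat (sqrt lam) \<bar>x\<bar>"
    by (intro heat_ge_diag) (use abs_ge_zero[of x] in linarith)+
  then show ?thesis
    using False Psi_1_pos by (simp add: lower_bell_def field_simps)
qed (simp add: lower_bell_def)

text \<open>The excess over \<open>\<bar>x\<bar>\<close> is the price of a point that has not
  reached the level; in \<open>lower_bell_bound\<close> it is the factor of
  \<open>bad\<close>.\<close>

lemma lower_bell_le:
  assumes "0 < lam"
  shows "lower_bell x lam \<le> \<bar>x\<bar> + sqrt lam / Psi 1"
proof (cases "sqrt lam \<le> \<bar>x\<bar>")
  case False
  define s where "s = sqrt lam"
  have s: "0 < s" using assms by (simp add: s_def)
  have "heat s \<bar>x\<bar> = \<bar>x\<bar> * gauss_int (\<bar>x\<bar> / s) + s * gauss (\<bar>x\<bar> / s)"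
    by (simp only: heat_def)
  also have "\<dots> \<le> \<bar>x\<bar> * Psi 1 + s * 1"
  proof (intro add_mono mult_left_mono)
    show "gauss_int (\<bar>x\<bar> / s) \<le> Psi 1"
      using gauss_int_plus_gauss_le[of "\<bar>x\<bar> / s"] gauss_pos[of "\<bar>x\<bar> / s"] by linarith
    show "gauss (\<bar>x\<bar> / s) \<le> 1" by (simp add: gauss_def)
  qed (use s in auto)
  finally show ?thesis
    using False Psi_1_pos by (simp add: lower_bell_def s_def field_simps)
qed (use assms Psi_1_pos in \<open>auto simp: lower_bell_def\<close>)

text \<open>The minimum over \<open>x\<close> is taken at 0, where \<open>heat s 0 = s\<close>. A
  bound free of \<open>x\<close> is what the weak-type inequality requires.\<close>

lemma lower_bell_ge_sqrt:
  assumes "0 < lam"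
  shows "sqrt lam / Psi 1 \<le> lower_bell x lam"
proof -
  define s where "s = sqrt lam"
  have s: "0 < s" using assms by (simp add: s_def)
  have "heat s 0 \<le> heat s \<bar>x\<bar>"
  proof (rule DERIV_nonneg_imp_nondecreasing[OF abs_ge_zero])
    fix y :: real assume y: "0 \<le> y"
    have "(heat s has_real_derivative 0 * gauss (y / s) + 1 * gauss_int (y / s)) (at y)"
      by (intro DERIV_heat DERIV_const DERIV_ident s)
    then show "\<exists>d. (heat s has_real_derivative d) (at y) \<and> 0 \<le> d"
      using y s gauss_int_nonneg[of "y / s"] by auto
  qed
  then have *: "s \<le> heat s x" unfolding heat_abs by (simp add: heat_def)
  have "1 \<le> Psi 1"
    using gauss_int_plus_gauss_le[of 0] by simp
  then have "s / Psi 1 \<le> s" using s by (simp add: field_simps)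
  then show ?thesis
    using * Psi_1_pos by (auto simp: lower_bell_def s_def intro!: divide_right_mono)
qed

text \<open>By evenness \<open>x\<close> and \<open>a\<close> may be taken nonnegative. Start
  outside the cone: convexity of the modulus, which \<open>lower_bell\<close> majorises. Start
  inside: both landings inside (\<open>heat_cone\<close>), only the far one outside
  (\<open>heat_outer\<close>), or both outside, which is reduced to the previous case at a smaller
  jump.\<close>

lemma lower_bell_main:
  "2 * lower_bell x lam \<le> lower_bell (x + a) (lam - a\<^sup>2) + lower_bell (x - a) (lam - a\<^sup>2)"
proof -
  have nonneg: "2 * lower_bell x lam \<le> lower_bell (x + a) (lam - a\<^sup>2) + lower_bell (x - a) (lam - a\<^sup>2)"
    if x: "0 \<le> x" and a: "0 \<le> a" for x a
  proof (cases "sqrt lam \<le> x")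
    case True
    then show ?thesis
      using lower_bell_ge[of "x + a" "lam - a\<^sup>2"] lower_bell_ge[of "x - a" "lam - a\<^sup>2"] x
      by (simp add: lower_bell_def[of x])
  next
    case False
    then have x_lt: "x < sqrt lam" by simp
    then have lam: "0 < lam" using x by (meson le_less_trans real_sqrt_gt_0_iff)
    have x2: "x\<^sup>2 < lam" using x_lt x by (metis abs_of_nonneg real_sqrt_abs real_sqrt_less_iff)
    define s where "s = sqrt (lam - a\<^sup>2)"
    have B_x: "lower_bell x lam = heat (sqrt lam) x / Psi 1"
      using x_lt x lam by (intro lower_bell_inside) auto
    show ?thesis
    proof (cases "x + a < s")
      case True
      then have "0 < s" using x a by linarith
      then have la: "a\<^sup>2 < lam" by (simp add: s_def)
      have "\<bar>x - a\<bar> \<le> s" using True x a by linarith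
      then show ?thesis
        using heat_cone[OF x a la] True x a la Psi_1_pos
        by (simp add: B_x lower_bell_inside s_def field_simps)
    next
      case False
      have outer: "2 * heat (sqrt lam) x \<le> Psi 1 * (x + b) + heat (sqrt (lam - b\<^sup>2)) (x - b)"
        if "b\<^sup>2 < lam" "\<bar>x - b\<bar> \<le> sqrt (lam - b\<^sup>2)" "sqrt (lam - b\<^sup>2) \<le> x + b" for b
        using heat_outer[of "sqrt (lam - b\<^sup>2)" "x - b" b] that by (simp add: add.commute)
      have B_plus: "lower_bell (x + a) (lam - a\<^sup>2) = x + a"
        using False x a by (simp add: lower_bell_def s_def)
      show ?thesis
      proof (cases "\<bar>x - a\<bar> \<le> s")
        case True
        have "a\<^sup>2 < lam"
        proof (rule ccontr)
          assume "\<not> a\<^sup>2 < lam"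
          then have "s \<le> 0" by (simp add: s_def)
          then have "x = a" using True by linarith
          then show False using x2 \<open>\<not> a\<^sup>2 < lam\<close> by simp
        qed
        then show ?thesis
          using outer[of a] True False Psi_1_pos unfolding B_plus B_x
          by (simp add: lower_bell_inside s_def field_simps)
      next
        case outside: False
        have big: "lam < 2 * a * (a - x) + x\<^sup>2"
        proof (cases "0 \<le> lam - a\<^sup>2")
          case True
          have "s\<^sup>2 < \<bar>x - a\<bar>\<^sup>2"
            using outside True by (intro power_strict_mono) (auto simp: s_def)
          then show ?thesis using True by (simp add: s_def power2_eq_square algebra_simps)
        next
          case False
          then show ?thesis using zero_le_power2[of "x - a"]
            by (simp add: power2_eq_square algebra_simps)
        qed
        then have "0 < a * (a - x)" using x2 by simp
        then have ax: "x < a" using a by (simp add: zero_less_mult_iff)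
        \<comment> \<open>\<open>b\<close> is the jump whose near landing point lies exactly on the
          cone, \<open>b - x = sqrt (lam - b^2)\<close>. For it \<open>heat_outer\<close> bounds the
          left side by \<open>2 * b\<close>, while the actual right side is at least
          \<open>(x + a) + (a - x) = 2 * a\<close>.\<close>
        define b where "b = (x + sqrt (2 * lam - x\<^sup>2)) / 2"
        have "x\<^sup>2 < 2 * lam - x\<^sup>2" using x2 by simp
        then have "x < sqrt (2 * lam - x\<^sup>2)" using x by (metis real_less_rsqrt)
        then have xb: "x < b" by (simp add: b_def)
        have "(2 * b - x)\<^sup>2 = 2 * lam - x\<^sup>2"
        proof -
          have "2 * b - x = sqrt (2 * lam - x\<^sup>2)" by (simp add: b_def field_simps)
          moreover have "0 \<le> 2 * lam - x\<^sup>2" using x2 zero_le_power2[of x] by linarith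
          ultimately show ?thesis by simp
        qed
        then have root: "2 * b * (b - x) + x\<^sup>2 = lam"
          by (simp add: power2_eq_square algebra_simps)
        then have sb: "lam - b\<^sup>2 = (b - x)\<^sup>2"
          by (simp add: power2_eq_square algebra_simps)
        have "0 < (b - x)\<^sup>2" using xb by simp
        then have b2: "b\<^sup>2 < lam" using sb by linarith
        have "2 * heat (sqrt lam) x \<le> Psi 1 * (x + b) + heat (sqrt (lam - b\<^sup>2)) (x - b)"
          using xb x b2 by (intro outer) (auto simp: sb)
        also have "heat (sqrt (lam - b\<^sup>2)) (x - b) = (b - x) * Psi 1"
          using heat_diag[of "b - x"] heat_minus[of "b - x" "b - x"] xb by (simp add: sb)
        finally have "heat (sqrt lam) x / Psi 1 \<le> b"
          using Psi_1_pos by (simp add: field_simps)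
        moreover have "b \<le> a"
        proof (rule ccontr)
          assume "\<not> b \<le> a"
          then have "a * (a - x) \<le> b * (b - x)" using ax x by (intro mult_mono) auto
          then show False using big root by simp
        qed
        moreover have "\<bar>x - a\<bar> \<le> lower_bell (x - a) (lam - a\<^sup>2)"
          by (rule lower_bell_ge)
        ultimately show ?thesis using ax by (simp add: B_x B_plus)
      qed
    qed
  qed
  show ?thesis
  proof -
    have abs: "2 * lower_bell \<bar>x\<bar> lam \<le> lower_bell (\<bar>x\<bar> + \<bar>a\<bar>) (lam - \<bar>a\<bar>\<^sup>2) + lower_bell (\<bar>x\<bar> - \<bar>a\<bar>) (lam - \<bar>a\<bar>\<^sup>2)"
      by (rule nonneg) auto
    consider "\<bar>x\<bar> + \<bar>a\<bar> = \<bar>x + a\<bar> \<and> \<bar>\<bar>x\<bar> - \<bar>a\<bar>\<bar> = \<bar>x - a\<bar>" | "\<bar>x\<bar> + \<bar>a\<bar> = \<bar>x - a\<bar> \<and> \<bar>\<bar>x\<bar> - \<bar>a\<bar>\<bar> = \<bar>x + a\<bar>"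
      by linarith
    then show ?thesis
      by cases (use abs lower_bell_abs in \<open>metis power2_abs add.commute\<close>)+
  qed
qed

text \<open>Candidate upper bound for the level fraction of nonnegative functions with mean
  \<open>x\<close>. It is meant for \<open>0 \<le> x\<close>, where nonpositive \<open>lam\<close>
  falls into the first branch.\<close>

definition upper_bell :: "real \<Rightarrow> real \<Rightarrow> real" where
  "upper_bell x lam = (if sqrt lam \<le> x then 1 else gauss_int (x / sqrt lam) / gauss_int 1)"

lemma upper_bell_inside:
  "x \<le> sqrt lam \<Longrightarrow> 0 < lam \<Longrightarrow> upper_bell x lam = gauss_int (x / sqrt lam) / gauss_int 1"
  using gauss_int_1_pos by (cases "x = sqrt lam") (auto simp: upper_bell_def)

lemma upper_bell_nonneg:
  assumes "0 \<le> x"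
  shows "0 \<le> upper_bell x lam"
proof (cases "sqrt lam \<le> x")
  case False
  then have "0 \<le> sqrt lam" using assms by linarith
  then have "0 \<le> x / sqrt lam" using assms by (rule divide_nonneg_nonneg[rotated])
  then show ?thesis using gauss_int_nonneg gauss_int_1_pos by (simp add: upper_bell_def)
qed (simp add: upper_bell_def)

lemma upper_bell_le_1:
  assumes "0 \<le> x"
  shows "upper_bell x lam \<le> 1"
proof (cases "sqrt lam \<le> x")
  case False
  then have "0 < sqrt lam" "x < sqrt lam" using assms by linarith+
  then have "x / sqrt lam \<le> 1" by (simp add: divide_le_eq_1)
  then show ?thesis using gauss_int_mono[of "x / sqrt lam" 1] gauss_int_1_pos by (simp add: upper_bell_def)
qed (simp add: upper_bell_def)

text \<open>The hypothesis reflects that both halves of a nonnegative function have nonnegative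
  mean. From a start inside the cone it keeps the near landing point inside, so that only the far
  one can leave; that case is \<open>gauss_int_outer\<close>.\<close>

lemma upper_bell_main:
  assumes "\<bar>a\<bar> \<le> x"
  shows "upper_bell (x + a) (lam - a\<^sup>2) + upper_bell (x - a) (lam - a\<^sup>2) \<le> 2 * upper_bell x lam"
proof -
  have nonneg: "upper_bell (x + a) (lam - a\<^sup>2) + upper_bell (x - a) (lam - a\<^sup>2) \<le> 2 * upper_bell x lam"
    if a: "0 \<le> a" "a \<le> x" for a
  proof (cases "sqrt lam \<le> x")
    case True
    then show ?thesis
      using upper_bell_le_1[of "x + a" "lam - a\<^sup>2"] upper_bell_le_1[of "x - a" "lam - a\<^sup>2"] a
      by (simp add: upper_bell_def[of x])
  next
    case False
    then have x_lt: "x < sqrt lam" by simp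
    have x: "0 \<le> x" using a by simp
    then have lam: "0 < lam" using x_lt by (meson le_less_trans real_sqrt_gt_0_iff)
    have x2: "x\<^sup>2 < lam" using x_lt x by (metis abs_of_nonneg real_sqrt_abs real_sqrt_less_iff)
    have "a\<^sup>2 \<le> x\<^sup>2" using a by (intro power_mono)
    then have la: "a\<^sup>2 < lam" using x2 by simp
    define s where "s = sqrt (lam - a\<^sup>2)"
    have s: "0 < s" using la by (simp add: s_def)
    have s2: "s\<^sup>2 = lam - a\<^sup>2" using la by (simp add: s_def)
    have G_x: "upper_bell x lam = gauss_int (x / sqrt lam) / gauss_int 1"
      using x_lt lam by (intro upper_bell_inside) auto
    \<comment> \<open>Otherwise \<open>lam \<le> x^2 - 2 * a * (x - a)\<close>, against
      \<open>x^2 < lam\<close> and \<open>a \<le> x\<close>.\<close>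
    have x_a: "x - a < s"
    proof (rule ccontr)
      assume "\<not> x - a < s"
      then have "s\<^sup>2 \<le> (x - a)\<^sup>2" using s by (intro power_mono) auto
      moreover have "a * a \<le> x * a" using a by (intro mult_right_mono) auto
      ultimately show False using x2 s2 by (simp add: power2_eq_square algebra_simps)
    qed
    then have G_minus: "upper_bell (x - a) (lam - a\<^sup>2) = gauss_int ((x - a) / s) / gauss_int 1"
      using la by (simp add: upper_bell_inside s_def)
    show ?thesis
    proof (cases "x + a < s")
      case True
      then have "upper_bell (x + a) (lam - a\<^sup>2) = gauss_int ((x + a) / s) / gauss_int 1"
        using la by (simp add: upper_bell_inside s_def)
      then show ?thesis
        using gauss_int_cone[OF a la] True gauss_int_1_pos
        by (simp add: G_minus G_x s_def divide_right_mono flip: add_divide_distrib)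
    next
      case False
      then have G_plus: "upper_bell (x + a) (lam - a\<^sup>2) = 1"
        by (simp add: upper_bell_def s_def)
      have "(x - a)\<^sup>2 + 2 * (x - a) * a \<le> s\<^sup>2"
        using x2 unfolding s2 by (simp add: power2_eq_square algebra_simps)
      then have "gauss_int 1 + gauss_int ((x - a) / s) \<le> 2 * gauss_int ((x - a + a) / sqrt (s\<^sup>2 + a\<^sup>2))"
        using s a x_a False by (intro gauss_int_outer) auto
      then have "(gauss_int 1 + gauss_int ((x - a) / s)) / gauss_int 1 \<le> 2 * gauss_int (x / sqrt lam) / gauss_int 1"
        using gauss_int_1_pos by (intro divide_right_mono) (auto simp: s2)
      then show ?thesis
        using gauss_int_1_pos unfolding G_minus G_x G_plus by (simp add: add_divide_distrib)
    qed
  qed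
  show ?thesis
    using nonneg[of a] nonneg[of "- a"] assms by (cases "0 \<le> a") auto
qed

section \<open>The truncated square function\<close>

abbreviation intg :: "real \<Rightarrow> real \<Rightarrow> (real \<Rightarrow> real) \<Rightarrow> bool" where
  "intg a b \<phi> \<equiv> set_integrable lebesgue {a..<b} \<phi>"

definition iint :: "real \<Rightarrow> real \<Rightarrow> (real \<Rightarrow> real) \<Rightarrow> real" where
  "iint a b \<phi> = (LINT x:{a..<b}|lebesgue. \<phi> x)"

definition mean :: "real \<Rightarrow> real \<Rightarrow> (real \<Rightarrow> real) \<Rightarrow> real" where
  "mean a b \<phi> = iint a b \<phi> / (b - a)"

text \<open>The signed jump of the martingale: it leads from the mean on the interval to the mean on
  the right half. Its modulus is that of \<open>Delta\<close> on the interval.\<close>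

definition osc :: "real \<Rightarrow> real \<Rightarrow> (real \<Rightarrow> real) \<Rightarrow> real" where
  "osc a b \<phi> = (mean ((a + b) / 2) b \<phi> - mean a ((a + b) / 2) \<phi>) / 2"

lemma iint_cong:
  "(\<And>x. a \<le> x \<Longrightarrow> x < b \<Longrightarrow> \<phi> x = \<psi> x) \<Longrightarrow> iint a b \<phi> = iint a b \<psi>"
  unfolding iint_def by (intro set_lebesgue_integral_cong) auto

lemma intg_cong:
  "(\<And>x. a \<le> x \<Longrightarrow> x < b \<Longrightarrow> \<phi> x = \<psi> x) \<Longrightarrow> intg a b \<phi> \<longleftrightarrow> intg a b \<psi>"
  by (intro set_integrable_cong) auto

lemma lmeasurable_ico [simp]: "{a..<b::real} \<in> lmeasurable"
  by (rule bounded_set_imp_lmeasurable[OF bounded_subset[OF bounded_closed_interval[of a b]]]) auto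

lemma intg_const [simp]: "intg a b (\<lambda>x. c)"
  unfolding set_integrable_def
  by (intro integrable_scaleR_left integrable_real_indicator) (use fmeasurableD2[OF lmeasurable_ico[of a b]] in \<open>auto simp: less_top\<close>)

lemma iint_const [simp]: "a \<le> b \<Longrightarrow> iint a b (\<lambda>x. c) = c * (b - a)"
  unfolding iint_def by (simp add: set_lebesgue_integral_def)

lemma mean_const [simp]: "a < b \<Longrightarrow> mean a b (\<lambda>x. c) = c"
  by (simp add: mean_def)

lemma intg_sub: "intg a b \<phi> \<Longrightarrow> a \<le> c \<Longrightarrow> d \<le> b \<Longrightarrow> intg c d \<phi>"
  by (rule set_integrable_subset) auto

lemma intg_join: "intg a m \<phi> \<Longrightarrow> intg m b \<phi> \<Longrightarrow> a \<le> m \<Longrightarrow> m \<le> b \<Longrightarrow> intg a b \<phi>"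
  using set_integrable_Un[of lebesgue "{a..<m}" \<phi> "{m..<b}"] by (simp add: ivl_disj_un_two)

lemma iint_split:
  assumes "intg a b \<phi>" "a \<le> m" "m \<le> b"
  shows "iint a b \<phi> = iint a m \<phi> + iint m b \<phi>"
proof -
  have "{a..<b} = {a..<m} \<union> {m..<b}" using assms by auto
  then show ?thesis
    unfolding iint_def
    using set_integral_Un[of "{a..<m}" "{m..<b}" lebesgue \<phi>] intg_sub[OF assms(1)] assms by auto
qed

lemma intg_abs: "intg a b \<phi> \<Longrightarrow> intg a b (\<lambda>x. \<bar>\<phi> x\<bar>)"
  by (rule set_integrable_abs)

lemma iint_add: "intg a b \<phi> \<Longrightarrow> intg a b \<psi> \<Longrightarrow> iint a b (\<lambda>x. \<phi> x + \<psi> x) = iint a b \<phi> + iint a b \<psi>"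
  unfolding iint_def by (rule set_integral_add(2))

lemma iint_cmult [simp]: "iint a b (\<lambda>x. c * \<phi> x) = c * iint a b \<phi>"
  unfolding iint_def by simp

lemma iint_mono: "intg a b \<phi> \<Longrightarrow> intg a b \<psi> \<Longrightarrow> (\<And>x. a \<le> x \<Longrightarrow> x < b \<Longrightarrow> \<phi> x \<le> \<psi> x) \<Longrightarrow> iint a b \<phi> \<le> iint a b \<psi>"
  unfolding iint_def by (intro set_integral_mono) auto

lemma iint_abs_ge: "intg a b \<phi> \<Longrightarrow> \<bar>iint a b \<phi>\<bar> \<le> iint a b (\<lambda>x. \<bar>\<phi> x\<bar>)"
proof -
  assume \<phi>: "intg a b \<phi>"
  have "iint a b \<phi> \<le> iint a b (\<lambda>x. \<bar>\<phi> x\<bar>)"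
    by (intro iint_mono \<phi> intg_abs abs_ge_self)
  moreover have "iint a b (\<lambda>x. (-1) * \<phi> x) \<le> iint a b (\<lambda>x. \<bar>\<phi> x\<bar>)"
    by (intro iint_mono \<phi> intg_abs set_integrable_mult_right) auto
  ultimately show ?thesis unfolding iint_cmult by (simp add: abs_le_iff)
qed

context
  fixes a b m :: real and \<phi> :: "real \<Rightarrow> real"
  assumes ab: "a < b" and m: "m = (a + b) / 2" and \<phi>: "intg a b \<phi>"
begin

lemma mean_halves: "mean a b \<phi> = (mean a m \<phi> + mean m b \<phi>) / 2"
proof -
  have "m - a = (b - a) / 2" "b - m = (b - a) / 2" by (simp_all add: m field_simps)
  then have "mean a m \<phi> = 2 * (iint a m \<phi> / (b - a))" "mean m b \<phi> = 2 * (iint m b \<phi> / (b - a))"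
    by (simp_all only: mean_def) simp_all
  moreover have "mean a b \<phi> = iint a m \<phi> / (b - a) + iint m b \<phi> / (b - a)"
    using iint_split[OF \<phi>, of m] ab by (simp add: mean_def m add_divide_distrib)
  ultimately show ?thesis by (simp add: mult.commute)
qed

lemma mean_left: "mean a m \<phi> = mean a b \<phi> - osc a b \<phi>"
  unfolding mean_halves osc_def m[symmetric] by (simp add: field_simps)

lemma mean_right: "mean m b \<phi> = mean a b \<phi> + osc a b \<phi>"
  unfolding mean_halves osc_def m[symmetric] by (simp add: field_simps)

end

lemma osc_affine:
  assumes "a < b" "intg a b \<phi>"
  shows "osc a b (\<lambda>x. c + d * \<phi> x) = d * osc a b \<phi>"
proof -
  have "mean u v (\<lambda>x. c + d * \<phi> x) = c + d * mean u v \<phi>" if "a \<le> u" "u < v" "v \<le> b" for u v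
  proof -
    have "intg u v \<phi>" using assms that by (auto intro: intg_sub)
    then have "iint u v (\<lambda>x. c + d * \<phi> x) = c * (v - u) + d * iint u v \<phi>"
      using that by (subst iint_add) (auto intro!: set_integrable_mult_right)
    then show ?thesis using that by (simp add: mean_def field_simps)
  qed
  then show ?thesis using assms by (simp add: osc_def algebra_simps)
qed

text \<open>Meaningful for \<open>a \<le> x < b\<close> only: there is no cut-off outside the interval.\<close>
primrec tsq :: "nat \<Rightarrow> real \<Rightarrow> real \<Rightarrow> (real \<Rightarrow> real) \<Rightarrow> real \<Rightarrow> real" where
  "tsq 0 a b \<phi> x = 0"
| "tsq (Suc N) a b \<phi> x = (osc a b \<phi>)\<^sup>2 +
     (if x < (a + b) / 2 then tsq N a ((a + b) / 2) \<phi> x else tsq N ((a + b) / 2) b \<phi> x)"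

definition sq :: "real \<Rightarrow> real \<Rightarrow> (real \<Rightarrow> real) \<Rightarrow> real \<Rightarrow> ennreal" where
  "sq a b \<phi> x = (SUP N. ennreal (tsq N a b \<phi> x))"

definition lev :: "real \<Rightarrow> real \<Rightarrow> (real \<Rightarrow> real) \<Rightarrow> real \<Rightarrow> real" where
  "lev a b \<phi> lam = measure lebesgue {x\<in>{a..<b}. ennreal lam \<le> sq a b \<phi> x}"

definition bad :: "real \<Rightarrow> real \<Rightarrow> (real \<Rightarrow> real) \<Rightarrow> real \<Rightarrow> nat \<Rightarrow> real" where
  "bad a b \<phi> lam N = measure lebesgue {x\<in>{a..<b}. tsq N a b \<phi> x < lam}"

lemma tsq_nonneg [simp]: "0 \<le> tsq N a b \<phi> x"
  by (induction N arbitrary: a b) auto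

lemma tsq_Suc_le: "tsq N a b \<phi> x \<le> tsq (Suc N) a b \<phi> x"
proof (induction N arbitrary: a b)
  case (Suc N)
  then show ?case by (subst (1 2) tsq.simps(2)) (simp del: tsq.simps)
qed simp

text \<open>In the variable \<open>x\<close> this is a step function; \<open>\<phi>\<close> enters
  only through finitely many means.\<close>

lemma borel_measurable_tsq [measurable]: "tsq N a b \<phi> \<in> borel_measurable borel"
proof (induction N arbitrary: a b)
  case (Suc N)
  note [measurable] = this
  show ?case unfolding tsq.simps(2)[abs_def] by measurable
qed (simp add: tsq.simps(1)[abs_def])

lemma borel_measurable_sq [measurable]: "sq a b \<phi> \<in> borel_measurable borel"
  unfolding sq_def[abs_def] by measurable

lemma lmeasurable_ico_Collect:
  assumes "Measurable.pred borel P"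
  shows "{x\<in>{a..<b::real}. P x} \<in> lmeasurable"
proof (rule bounded_set_imp_lmeasurable)
  show "bounded {x\<in>{a..<b}. P x}"
    by (rule bounded_subset[OF bounded_closed_interval[of a b]]) auto
  have [measurable]: "Measurable.pred borel P" by fact
  have "{x\<in>space borel. x \<in> {a..<b} \<and> P x} \<in> sets borel" by measurable
  then show "{x\<in>{a..<b}. P x} \<in> sets lebesgue"
    by (auto intro: sets_completionI_sets simp: lborel_def) 
qed

lemma lmeasurable_tsq_less: "{x\<in>{a..<b}. tsq N c d \<phi> x < lam} \<in> lmeasurable"
  by (rule lmeasurable_ico_Collect) measurable

lemma lmeasurable_sq_ge: "{x\<in>{a..<b}. lam \<le> sq c d \<phi> x} \<in> lmeasurable"
  by (rule lmeasurable_ico_Collect) measurable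

lemma measure_ico_le:
  assumes "{x\<in>{a..<b::real}. P x} \<in> lmeasurable" "a \<le> b"
  shows "measure lebesgue {x\<in>{a..<b}. P x} \<le> b - a"
proof -
  have "measure lebesgue {x\<in>{a..<b}. P x} \<le> measure lebesgue {a..<b}"
    using assms(1) by (intro measure_mono_fmeasurable) (auto dest: fmeasurableD)
  then show ?thesis using assms(2) by simp
qed

lemma lev_nonneg [simp]: "0 \<le> lev a b \<phi> lam"
  by (simp add: lev_def)

lemma lev_le: "a \<le> b \<Longrightarrow> lev a b \<phi> lam \<le> b - a"
  unfolding lev_def by (intro measure_ico_le lmeasurable_sq_ge)

lemma bad_nonneg [simp]: "0 \<le> bad a b \<phi> lam N"
  by (simp add: bad_def)

lemma bad_0: "a \<le> b \<Longrightarrow> bad a b \<phi> lam 0 = (if 0 < lam then b - a else 0)"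
proof -
  have "{x\<in>{a..<b}. tsq 0 a b \<phi> x < lam} = (if 0 < lam then {a..<b} else {})" by auto
  then show "a \<le> b \<Longrightarrow> ?thesis" by (simp add: bad_def)
qed

text \<open>After one generation the level still to be reached is \<open>lam\<close> minus the
  squared jump, the same shift as in the midpoint inequalities. It may become negative, and then
  nothing is bad.\<close>

lemma bad_Suc:
  assumes "a < b" "m = (a + b) / 2"
  shows "bad a b \<phi> lam (Suc N) = bad a m \<phi> (lam - (osc a b \<phi>)\<^sup>2) N + bad m b \<phi> (lam - (osc a b \<phi>)\<^sup>2) N"
proof -
  let ?l = "lam - (osc a b \<phi>)\<^sup>2"
  have "{x\<in>{a..<b}. tsq (Suc N) a b \<phi> x < lam} = {x\<in>{a..<m}. tsq N a m \<phi> x < ?l} \<union> {x\<in>{m..<b}. tsq N m b \<phi> x < ?l}"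
    using assms(1) unfolding tsq.simps(2) assms(2)[symmetric] less_diff_eq add.commute[of "(osc a b \<phi>)\<^sup>2"]
    by (auto simp: assms(2))
  moreover have "measure lebesgue ({x\<in>{a..<m}. tsq N a m \<phi> x < ?l} \<union> {x\<in>{m..<b}. tsq N m b \<phi> x < ?l})
    = measure lebesgue {x\<in>{a..<m}. tsq N a m \<phi> x < ?l} + measure lebesgue {x\<in>{m..<b}. tsq N m b \<phi> x < ?l}"
    by (intro measure_Un_AE lmeasurable_tsq_less) auto
  ultimately show ?thesis by (simp add: bad_def)
qed

lemma sq_rec:
  "sq a b \<phi> x = ennreal ((osc a b \<phi>)\<^sup>2) +
     (if x < (a + b) / 2 then sq a ((a + b) / 2) \<phi> x else sq ((a + b) / 2) b \<phi> x)"
proof -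
  have "sq a b \<phi> x = (SUP N. ennreal (tsq (Suc N) a b \<phi> x))"
    unfolding sq_def
  proof (rule antisym)
    show "(SUP N. ennreal (tsq N a b \<phi> x)) \<le> (SUP N. ennreal (tsq (Suc N) a b \<phi> x))"
      by (intro SUP_mono) (blast intro: ennreal_leI tsq_Suc_le)
    show "(SUP N. ennreal (tsq (Suc N) a b \<phi> x)) \<le> (SUP N. ennreal (tsq N a b \<phi> x))"
      by (intro SUP_mono) blast
  qed
  also have "\<dots> = (SUP N. ennreal ((osc a b \<phi>)\<^sup>2) + ennreal (if x < (a + b) / 2 then tsq N a ((a + b) / 2) \<phi> x else tsq N ((a + b) / 2) b \<phi> x))"
    by (simp add: ennreal_plus)
  also have "\<dots> = ennreal ((osc a b \<phi>)\<^sup>2) + (SUP N. ennreal (if x < (a + b) / 2 then tsq N a ((a + b) / 2) \<phi> x else tsq N ((a + b) / 2) b \<phi> x))"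
    by (simp add: ennreal_SUP_add_right)
  finally show ?thesis by (simp add: sq_def)
qed

text \<open>A point whose partial sums all stay below \<open>lam'\<close> has
  \<open>sq \<le> lam' < lam\<close>, so the decreasing bad sets shrink into the complement of the
  level set. The gap matters: the level \<open>lam\<close> itself may be attained only by the full
  series.\<close>

lemma bad_le_lev:
  assumes "lam' < lam" "0 < lam" "0 < \<epsilon>" "a \<le> b"
  shows "\<exists>N. bad a b \<phi> lam' N \<le> b - a - lev a b \<phi> lam + \<epsilon>"
proof -
  let ?A = "\<lambda>N. {x\<in>{a..<b}. tsq N a b \<phi> x < lam'}"
  let ?L = "{x\<in>{a..<b}. ennreal lam \<le> sq a b \<phi> x}"
  have A: "?A N \<in> lmeasurable" for N by (rule lmeasurable_tsq_less)
  have "(\<lambda>N. measure lebesgue (?A N)) \<longlonglongrightarrow> measure lebesgue (\<Inter>N. ?A N)"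
  proof (rule Lim_measure_decseq)
    show "decseq ?A"
      by (rule decseq_SucI) (auto simp del: tsq.simps intro: le_less_trans[OF tsq_Suc_le])
    show "range ?A \<subseteq> sets lebesgue" using fmeasurableD[OF A] by blast
    show "emeasure lebesgue (?A i) \<noteq> \<infinity>" for i using fmeasurableD2[OF A] by simp
  qed
  moreover have "measure lebesgue (\<Inter>N. ?A N) \<le> b - a - lev a b \<phi> lam"
  proof -
    have sub: "(\<Inter>N. ?A N) \<subseteq> {a..<b} - ?L"
    proof
      fix x assume x: "x \<in> (\<Inter>N. ?A N)"
      then have "sq a b \<phi> x \<le> ennreal lam'"
        unfolding sq_def by (intro SUP_least ennreal_leI) (auto intro: less_imp_le)
      also have "\<dots> < ennreal lam" using assms by (intro ennreal_lessI)
      finally show "x \<in> {a..<b} - ?L" using x by auto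
    qed
    have "measure lebesgue (\<Inter>N. ?A N) \<le> measure lebesgue ({a..<b} - ?L)"
      using sub fmeasurableD[OF A]
      by (intro measure_mono_fmeasurable fmeasurable_Diff lmeasurable_ico fmeasurableD[OF lmeasurable_sq_ge] sets.countable_INT) blast+
    also have "\<dots> = measure lebesgue {a..<b} - measure lebesgue ?L"
      by (intro measurable_measure_Diff lmeasurable_sq_ge fmeasurableD) auto
    finally show ?thesis using assms by (simp add: lev_def)
  qed
  then have "measure lebesgue (\<Inter>N. ?A N) < b - a - lev a b \<phi> lam + \<epsilon>" using assms by simp
  ultimately have "eventually (\<lambda>N. measure lebesgue (?A N) < b - a - lev a b \<phi> lam + \<epsilon>) sequentially"
    by (rule order_tendstoD)
  then show ?thesis
    unfolding bad_def by (auto simp: eventually_sequentially intro: less_imp_le)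
qed

section \<open>Induction along the dyadic tree and passage to the limit\<close>

lemma lower_bell_bound:
  assumes "a < b" "intg a b \<phi>" "sqrt lam \<le> c" "0 \<le> c"
  shows "(b - a) * lower_bell (mean a b \<phi>) lam \<le> iint a b (\<lambda>x. \<bar>\<phi> x\<bar>) + c / Psi 1 * bad a b \<phi> lam N"
  using assms
proof (induction N arbitrary: a b lam)
  case 0
  have abs: "(b - a) * \<bar>mean a b \<phi>\<bar> \<le> iint a b (\<lambda>x. \<bar>\<phi> x\<bar>)"
    using iint_abs_ge[OF 0(2)] 0(1) by (simp add: mean_def abs_divide)
  show ?case
  proof (cases "0 < lam")
    case True
    have "lower_bell (mean a b \<phi>) lam \<le> \<bar>mean a b \<phi>\<bar> + c / Psi 1"
      using lower_bell_le[OF True, of "mean a b \<phi>"] divide_right_mono[OF 0(3), of "Psi 1"] Psi_1_pos by simp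
    then have "(b - a) * lower_bell (mean a b \<phi>) lam \<le> (b - a) * \<bar>mean a b \<phi>\<bar> + (b - a) * (c / Psi 1)"
      using 0(1) by (subst distrib_left[symmetric]) (intro mult_left_mono, auto)
    then show ?thesis using abs True 0(1) by (simp add: bad_0 mult.commute)
  next
    case False
    then have "sqrt lam \<le> \<bar>mean a b \<phi>\<bar>" using abs_ge_zero[of "mean a b \<phi>"] by (meson linorder_not_less order_trans real_sqrt_le_0_iff)
    then show ?thesis using abs 0 False by (simp add: lower_bell_def bad_0)
  qed
next
  case (Suc N)
  define m where "m = (a + b) / 2"
  define d where "d = osc a b \<phi>"
  have m: "a < m" "m < b" "m - a = (b - a) / 2" "b - m = (b - a) / 2"
    using Suc.prems(1) by (auto simp: m_def field_simps)
  have \<phi>: "intg a m \<phi>" "intg m b \<phi>"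
    using Suc.prems(2) m by (auto intro: intg_sub)
  \<comment> \<open>\<open>c\<close> stays fixed while the level decreases, so that the same factor
    multiplies \<open>bad\<close> on both halves.\<close>
  have "sqrt (lam - d\<^sup>2) \<le> c" by (rule order_trans[OF _ Suc.prems(3)]) simp
  note IH = Suc.IH[OF m(1) \<phi>(1) this Suc.prems(4)] Suc.IH[OF m(2) \<phi>(2) this Suc.prems(4)]
  have "(b - a) * lower_bell (mean a b \<phi>) lam = (b - a) / 2 * (2 * lower_bell (mean a b \<phi>) lam)"
    by simp
  also have "\<dots> \<le> (b - a) / 2 * (lower_bell (mean a b \<phi> + d) (lam - d\<^sup>2) + lower_bell (mean a b \<phi> - d) (lam - d\<^sup>2))"
    using Suc.prems(1) by (intro mult_left_mono lower_bell_main) auto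
  also have "\<dots> = (m - a) * lower_bell (mean a m \<phi>) (lam - d\<^sup>2) + (b - m) * lower_bell (mean m b \<phi>) (lam - d\<^sup>2)"
    unfolding m d_def mean_left[OF Suc.prems(1) m_def Suc.prems(2)] mean_right[OF Suc.prems(1) m_def Suc.prems(2)]
    by (simp add: algebra_simps)
  also have "\<dots> \<le> iint a m (\<lambda>x. \<bar>\<phi> x\<bar>) + c / Psi 1 * bad a m \<phi> (lam - d\<^sup>2) N
     + (iint m b (\<lambda>x. \<bar>\<phi> x\<bar>) + c / Psi 1 * bad m b \<phi> (lam - d\<^sup>2) N)"
    by (intro add_mono IH)
  also have "\<dots> = iint a b (\<lambda>x. \<bar>\<phi> x\<bar>) + c / Psi 1 * bad a b \<phi> lam (Suc N)"
    using iint_split[OF intg_abs[OF Suc.prems(2)], of m] m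
    by (simp add: bad_Suc[OF Suc.prems(1) m_def] d_def distrib_left)
  finally show ?case .
qed

lemma upper_bell_bound:
  assumes "a < b" "intg a b \<phi>" "iint a b (\<lambda>x. \<bar>\<phi> x\<bar>) = iint a b \<phi>"
  shows "b - a \<le> (b - a) * upper_bell (mean a b \<phi>) lam + bad a b \<phi> lam N"
  using assms
proof (induction N arbitrary: a b lam)
  case 0
  then have "0 \<le> mean a b \<phi>"
    using iint_abs_ge[OF 0(2)] by (simp add: mean_def)
  then show ?case
  proof (cases "0 < lam")
    case True
    then show ?thesis using \<open>0 \<le> mean a b \<phi>\<close> 0(1) upper_bell_nonneg[of "mean a b \<phi>" lam] by (simp add: bad_0)
  next
    case False
    then have "sqrt lam \<le> mean a b \<phi>"
      using \<open>0 \<le> mean a b \<phi>\<close> by (meson linorder_not_less order_trans real_sqrt_le_0_iff)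
    then show ?thesis by (simp add: upper_bell_def)
  qed
next
  case (Suc N)
  define m where "m = (a + b) / 2"
  define d where "d = osc a b \<phi>"
  have m: "a < m" "m < b" "m - a = (b - a) / 2" "b - m = (b - a) / 2"
    using Suc.prems(1) by (auto simp: m_def field_simps)
  have \<phi>: "intg a m \<phi>" "intg m b \<phi>"
    using Suc.prems(2) m by (auto intro: intg_sub)
  \<comment> \<open>The hypothesis expresses nonnegativity almost everywhere. On each half the
    modulus has the larger integral, so equality on the whole interval forces equality on both
    halves.\<close>
  have eq: "iint a m (\<lambda>x. \<bar>\<phi> x\<bar>) = iint a m \<phi>" "iint m b (\<lambda>x. \<bar>\<phi> x\<bar>) = iint m b \<phi>"
    using iint_abs_ge[OF \<phi>(1)] iint_abs_ge[OF \<phi>(2)] Suc.prems(3) m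
      iint_split[OF Suc.prems(2), of m] iint_split[OF intg_abs[OF Suc.prems(2)], of m] by auto
  note means = mean_left[OF Suc.prems(1) m_def Suc.prems(2)] mean_right[OF Suc.prems(1) m_def Suc.prems(2)]
  have "0 \<le> mean a m \<phi>" "0 \<le> mean m b \<phi>"
    using iint_abs_ge[OF \<phi>(1)] iint_abs_ge[OF \<phi>(2)] eq m(1,2) by (auto simp: mean_def)
  then have d: "\<bar>d\<bar> \<le> mean a b \<phi>" by (simp add: means d_def)
  note IH = Suc.IH[OF m(1) \<phi>(1) eq(1), of "lam - d\<^sup>2"] Suc.IH[OF m(2) \<phi>(2) eq(2), of "lam - d\<^sup>2"]
  have "b - a = (m - a) + (b - m)" by simp
  also have "\<dots> \<le> (m - a) * upper_bell (mean a m \<phi>) (lam - d\<^sup>2) + bad a m \<phi> (lam - d\<^sup>2) N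
    + ((b - m) * upper_bell (mean m b \<phi>) (lam - d\<^sup>2) + bad m b \<phi> (lam - d\<^sup>2) N)"
    by (intro add_mono IH)
  also have "\<dots> = (b - a) / 2 * (upper_bell (mean a b \<phi> + d) (lam - d\<^sup>2) + upper_bell (mean a b \<phi> - d) (lam - d\<^sup>2)) + bad a b \<phi> lam (Suc N)"
    unfolding m means bad_Suc[OF Suc.prems(1) m_def] d_def by (simp add: algebra_simps)
  also have "\<dots> \<le> (b - a) / 2 * (2 * upper_bell (mean a b \<phi>) lam) + bad a b \<phi> lam (Suc N)"
    using Suc.prems(1) d by (intro add_right_mono mult_left_mono upper_bell_main) auto
  finally show ?case by simp
qed

lemma lower_bell_lev:
  assumes "a < b" "intg a b \<phi>" "0 < lam'" "lam' < lam"
  shows "(b - a) * lower_bell (mean a b \<phi>) lam' \<le>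
    iint a b (\<lambda>x. \<bar>\<phi> x\<bar>) + sqrt lam / Psi 1 * (b - a - lev a b \<phi> lam)"
proof (rule field_le_epsilon)
  fix e :: real assume e: "0 < e"
  define k where "k = sqrt lam / Psi 1"
  have k: "0 < k" using assms Psi_1_pos by (simp add: k_def)
  obtain N where N: "bad a b \<phi> lam' N \<le> b - a - lev a b \<phi> lam + e / k"
    using bad_le_lev[of lam' lam "e / k" a b \<phi>] assms e k by auto
  have "(b - a) * lower_bell (mean a b \<phi>) lam' \<le> iint a b (\<lambda>x. \<bar>\<phi> x\<bar>) + k * bad a b \<phi> lam' N"
    unfolding k_def using assms by (intro lower_bell_bound) auto
  also have "\<dots> \<le> iint a b (\<lambda>x. \<bar>\<phi> x\<bar>) + k * (b - a - lev a b \<phi> lam + e / k)"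
    using k N by (intro add_left_mono mult_left_mono) auto
  also have "\<dots> = iint a b (\<lambda>x. \<bar>\<phi> x\<bar>) + k * (b - a - lev a b \<phi> lam) + e"
    using k by (simp add: distrib_left)
  finally show "(b - a) * lower_bell (mean a b \<phi>) lam' \<le>
    iint a b (\<lambda>x. \<bar>\<phi> x\<bar>) + sqrt lam / Psi 1 * (b - a - lev a b \<phi> lam) + e"
    by (simp add: k_def)
qed

text \<open>Lets the auxiliary level tend to \<open>lam\<close> from below, and later the parameter
  \<open>r\<close> of \<open>att_near_abs\<close> tend to 1.\<close>

lemma at_left_le:
  fixes g :: "real \<Rightarrow> real"
  assumes "isCont g lam" "c < lam" "\<And>l. c < l \<Longrightarrow> l < lam \<Longrightarrow> g l \<le> u"
  shows "g lam \<le> u"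
proof (rule tendsto_upperbound)
  show "(g \<longlongrightarrow> g lam) (at_left lam)"
    using assms(1) by (simp add: isCont_def filterlim_at_split)
  show "\<forall>\<^sub>F l in at_left lam. g l \<le> u"
    using assms by (intro eventually_at_leftI[of c]) auto
qed simp

text \<open>The same constant \<open>sqrt lam / Psi 1\<close> bounds \<open>lower_bell\<close> from
  below and prices the complement of the level set; subtracting leaves the level set alone.\<close>

lemma weak_type:
  assumes "a < b" "intg a b \<phi>" "0 < lam"
  shows "sqrt lam * lev a b \<phi> lam \<le> Psi 1 * iint a b (\<lambda>x. \<bar>\<phi> x\<bar>)"
proof -
  let ?u = "iint a b (\<lambda>x. \<bar>\<phi> x\<bar>) + sqrt lam / Psi 1 * (b - a - lev a b \<phi> lam)"
  have "(b - a) * (sqrt lam / Psi 1) \<le> ?u"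
  proof (rule at_left_le[where c = 0 and g = "\<lambda>l. (b - a) * (sqrt l / Psi 1)"])
    show "isCont (\<lambda>l. (b - a) * (sqrt l / Psi 1)) lam"
      using Psi_1_pos by (intro continuous_intros) auto
    fix l assume l: "0 < l" "l < lam"
    have "(b - a) * (sqrt l / Psi 1) \<le> (b - a) * lower_bell (mean a b \<phi>) l"
      using l assms by (intro mult_left_mono lower_bell_ge_sqrt) auto
    also have "\<dots> \<le> ?u" using assms l by (intro lower_bell_lev) auto
    finally show "(b - a) * (sqrt l / Psi 1) \<le> ?u" .
  qed (fact assms)
  then show ?thesis using Psi_1_pos by (simp add: field_simps)
qed

lemma lev_full_bound:
  assumes "a < b" "intg a b \<phi>" "0 < lam" "\<bar>mean a b \<phi>\<bar> \<le> sqrt lam" "lev a b \<phi> lam = b - a"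
  shows "(b - a) * heat (sqrt lam) (mean a b \<phi>) \<le> Psi 1 * iint a b (\<lambda>x. \<bar>\<phi> x\<bar>)"
\<comment> \<open>On the boundary of the cone no smaller level keeps the mean inside, so there is no
  limit from below; the claim is then the triangle inequality for the integral.\<close>
proof (cases "\<bar>mean a b \<phi>\<bar> = sqrt lam")
  case True
  then have "heat (sqrt lam) (mean a b \<phi>) = heat (sqrt lam) (sqrt lam)"
    by (metis heat_abs)
  also have "(b - a) * \<dots> = Psi 1 * \<bar>iint a b \<phi>\<bar>"
  proof -
    have "\<bar>iint a b \<phi>\<bar> = (b - a) * sqrt lam"
      using assms(1) True by (simp add: mean_def abs_divide field_simps)
    then show ?thesis using assms(3) by (simp add: heat_diag)
  qed
  finally show ?thesis
    using iint_abs_ge[OF assms(2)] Psi_1_pos by simp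
next
  case False
  define f where "f = mean a b \<phi>"
  have f: "f\<^sup>2 < lam"
    using False assms(4) by (metis f_def less_le real_less_rsqrt real_sqrt_abs real_sqrt_less_iff)
  have "(b - a) * heat (sqrt lam) f \<le> Psi 1 * iint a b (\<lambda>x. \<bar>\<phi> x\<bar>)"
  proof (rule at_left_le[where c = "f\<^sup>2" and g = "\<lambda>l. (b - a) * heat (sqrt l) f"])
    show "isCont (\<lambda>l. (b - a) * heat (sqrt l) f) lam"
      using assms(3) by (intro continuous_mult continuous_const
        DERIV_isCont[OF DERIV_heat[OF DERIV_real_sqrt DERIV_const]]) auto
    fix l assume l: "f\<^sup>2 < l" "l < lam"
    have "0 < l" using l zero_le_power2[of f] by linarith
    moreover have "\<bar>f\<bar> \<le> sqrt l" using l by (simp add: real_le_rsqrt)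
    ultimately have "lower_bell f l = heat (sqrt l) f / Psi 1"
      by (intro lower_bell_inside)
    then have "(b - a) * (heat (sqrt l) f / Psi 1) \<le> iint a b (\<lambda>x. \<bar>\<phi> x\<bar>)"
      using lower_bell_lev[of a b \<phi> l lam] assms l \<open>0 < l\<close> by (simp add: f_def)
    then show "(b - a) * heat (sqrt l) f \<le> Psi 1 * iint a b (\<lambda>x. \<bar>\<phi> x\<bar>)"
      using Psi_1_pos by (simp add: field_simps)
  qed (fact f)
  then show ?thesis by (simp add: f_def)
qed

lemma lev_nonneg_bound:
  assumes "a < b" "intg a b \<phi>" "iint a b (\<lambda>x. \<bar>\<phi> x\<bar>) = iint a b \<phi>" "0 < lam" "mean a b \<phi> \<le> sqrt lam"
  shows "lev a b \<phi> lam \<le> (b - a) * (gauss_int (mean a b \<phi> / sqrt lam) / gauss_int 1)"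
proof (cases "mean a b \<phi> = sqrt lam")
  case True
  then show ?thesis using assms gauss_int_1_pos by (simp add: lev_le)
next
  case False
  define f where "f = mean a b \<phi>"
  have f0: "0 \<le> f" using iint_abs_ge[OF assms(2)] assms by (simp add: f_def mean_def)
  have f: "f\<^sup>2 < lam"
    using False assms(5) f0 by (metis f_def abs_of_nonneg less_le real_sqrt_abs real_sqrt_less_iff)
  have "- ((b - a) * (gauss_int (f / sqrt lam) / gauss_int 1)) \<le> - lev a b \<phi> lam"
  proof (rule at_left_le[where c = "f\<^sup>2" and g = "\<lambda>l. - ((b - a) * (gauss_int (f / sqrt l) / gauss_int 1))"])
    have "isCont (\<lambda>l. gauss_int (f / sqrt l)) lam"
      using assms(4) by (intro isCont_o2[OF _ DERIV_isCont[OF DERIV_gauss_int_at]] continuous_intros) auto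
    then show "isCont (\<lambda>l. - ((b - a) * (gauss_int (f / sqrt l) / gauss_int 1))) lam"
      using gauss_int_1_pos by (intro continuous_intros) auto
    fix l assume l: "f\<^sup>2 < l" "l < lam"
    have l0: "0 < l" using l zero_le_power2[of f] by linarith
    have "f \<le> sqrt l" using l by (simp add: real_le_rsqrt)
    then have u: "upper_bell f l = gauss_int (f / sqrt l) / gauss_int 1"
      using l0 by (intro upper_bell_inside)
    have "lev a b \<phi> lam \<le> (b - a) * upper_bell f l"
    proof (rule field_le_epsilon)
      fix e :: real assume "0 < e"
      then obtain N where "bad a b \<phi> l N \<le> b - a - lev a b \<phi> lam + e"
        using bad_le_lev[of l lam e a b \<phi>] assms l by auto
      then show "lev a b \<phi> lam \<le> (b - a) * upper_bell f l + e"
        using upper_bell_bound[OF assms(1-3), of l N] by (simp add: f_def)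
    qed
    then show "- ((b - a) * (gauss_int (f / sqrt l) / gauss_int 1)) \<le> - lev a b \<phi> lam"
      by (simp add: u)
  qed (fact f)
  then show ?thesis by (simp add: f_def)
qed

section \<open>Affine images, differences, and filling up the level set\<close>

lemma tsq_affine:
  assumes "a < b" "intg a b \<phi>"
  shows "tsq N a b (\<lambda>x. c + d * \<phi> x) x = d\<^sup>2 * tsq N a b \<phi> x"
  using assms
proof (induction N arbitrary: a b)
  case (Suc N)
  have "a < (a + b) / 2" "(a + b) / 2 < b" using Suc.prems by auto
  then show ?case
    using Suc.IH[of a "(a + b) / 2"] Suc.IH[of "(a + b) / 2" b] intg_sub[OF Suc.prems(2)]
    by (simp add: osc_affine[OF Suc.prems] power_mult_distrib distrib_left)
qed simp

text \<open>The two sides differ by a square over \<open>r * (1 - r)\<close>. Summed over the tree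
  it replaces the triangle inequality for \<open>S\<close>: levels \<open>r^2 * lam\<close> and
  \<open>(1 - r)^2 * lam\<close> of the two parts combine to
  \<open>r * lam + (1 - r) * lam = lam\<close>.\<close>

lemma power2_diff_le:
  fixes u v r :: real
  assumes "0 < r" "r < 1"
  shows "(u - v)\<^sup>2 \<le> u\<^sup>2 / r + v\<^sup>2 / (1 - r)"
proof -
  have "u\<^sup>2 / r + v\<^sup>2 / (1 - r) - (u - v)\<^sup>2 = ((1 - r) * u + r * v)\<^sup>2 / (r * (1 - r))"
    using assms by (simp add: field_simps power2_eq_square)
  also have "\<dots> \<ge> 0" using assms by simp
  finally show ?thesis by simp
qed

lemma osc_diff:
  assumes "a < b" "intg a b \<phi>" "intg a b \<psi>"
  shows "osc a b (\<lambda>x. \<phi> x - \<psi> x) = osc a b \<phi> - osc a b \<psi>"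
proof -
  have "mean u v (\<lambda>x. \<phi> x - \<psi> x) = mean u v \<phi> - mean u v \<psi>" if "a \<le> u" "u < v" "v \<le> b" for u v
  proof -
    have "intg u v \<phi>" "intg u v \<psi>" using assms that by (auto intro: intg_sub)
    then show ?thesis
      using set_integral_diff(2)[of lebesgue "{u..<v}" \<phi> \<psi>] by (simp add: mean_def iint_def diff_divide_distrib)
  qed
  then show ?thesis using assms(1) by (simp add: osc_def diff_divide_distrib)
qed

lemma tsq_diff_le:
  assumes "a < b" "intg a b \<phi>" "intg a b \<psi>" "0 < r" "r < 1"
  shows "tsq N a b (\<lambda>x. \<phi> x - \<psi> x) x \<le> tsq N a b \<phi> x / r + tsq N a b \<psi> x / (1 - r)"
  using assms
proof (induction N arbitrary: a b)
  case (Suc N)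
  define m where "m = (a + b) / 2"
  have m: "a < m" "m < b" using Suc.prems by (auto simp: m_def)
  have i: "intg a m \<phi>" "intg a m \<psi>" "intg m b \<phi>" "intg m b \<psi>"
    using Suc.prems m by (auto intro: intg_sub)
  have o: "(osc a b (\<lambda>x. \<phi> x - \<psi> x))\<^sup>2 \<le> (osc a b \<phi>)\<^sup>2 / r + (osc a b \<psi>)\<^sup>2 / (1 - r)"
    using Suc.prems by (simp add: osc_diff power2_diff_le)
  show ?case
    using o Suc.IH[OF m(1) i(1,2) Suc.prems(4,5)] Suc.IH[OF m(2) i(3,4) Suc.prems(4,5)]
    unfolding tsq.simps m_def[symmetric] by (auto simp: add_divide_distrib)
qed simp

lemma mean_cong: "(\<And>x. a \<le> x \<Longrightarrow> x < b \<Longrightarrow> \<phi> x = \<psi> x) \<Longrightarrow> mean a b \<phi> = mean a b \<psi>"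
  unfolding mean_def by (subst iint_cong) auto

lemma osc_cong: "(\<And>x. a \<le> x \<Longrightarrow> x < b \<Longrightarrow> \<phi> x = \<psi> x) \<Longrightarrow> a < b \<Longrightarrow> osc a b \<phi> = osc a b \<psi>"
  unfolding osc_def by (subst (1 2) mean_cong[of _ _ \<phi> \<psi>]) auto

lemma tsq_cong: "(\<And>x. a \<le> x \<Longrightarrow> x < b \<Longrightarrow> \<phi> x = \<psi> x) \<Longrightarrow> a < b \<Longrightarrow> tsq N a b \<phi> x = tsq N a b \<psi> x"
proof (induction N arbitrary: a b)
  case (Suc N)
  have "a < (a + b) / 2" "(a + b) / 2 < b" using Suc.prems by auto
  then show ?case
    using Suc.IH[of a "(a + b) / 2"] Suc.IH[of "(a + b) / 2" b] osc_cong[OF Suc.prems(1,2)] Suc.prems(1)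
    by simp
qed simp

lemma sq_cong: "(\<And>x. a \<le> x \<Longrightarrow> x < b \<Longrightarrow> \<phi> x = \<psi> x) \<Longrightarrow> a < b \<Longrightarrow> sq a b \<phi> x = sq a b \<psi> x"
  unfolding sq_def using tsq_cong[of a b \<phi> \<psi>] by simp

text \<open>Each interval of generation \<open>N\<close> on which the level is still missing
  receives its mean minus \<open>c\<close> and plus \<open>c\<close> on its halves. This jump
  suffices and costs at most \<open>c\<close> per unit of length. Elsewhere \<open>\<phi>\<close> is
  kept, and earlier jumps are unchanged because means are preserved.\<close>

lemma fill_step:
  assumes "a < b" "intg a b \<phi>" "0 \<le> c" "lam \<le> c\<^sup>2"
  shows "\<exists>\<psi>. intg a b \<psi> \<and> mean a b \<psi> = mean a b \<phi> \<and> (\<forall>x. ennreal lam \<le> sq a b \<psi> x) \<and>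
    iint a b (\<lambda>x. \<bar>\<psi> x\<bar>) \<le> iint a b (\<lambda>x. \<bar>\<phi> x\<bar>) + c * bad a b \<phi> lam N"
  using assms
proof (induction N arbitrary: a b lam)
  case 0
  show ?case
  proof (cases "0 < lam")
    case False
    then show ?thesis using 0 by (intro exI[of _ \<phi>]) (auto simp: ennreal_neg bad_0)
  next
    case True
    define f where "f = mean a b \<phi>"
    define m where "m = (a + b) / 2"
    have m: "a < m" "m < b" "m - a = (b - a) / 2" "b - m = (b - a) / 2"
      using 0(1) by (auto simp: m_def field_simps)
    define \<psi> where "\<psi> x = (if x < m then f - c else f + c)" for x
    have l: "mean a m \<psi> = f - c" "intg a m \<psi>" "iint a m (\<lambda>x. \<bar>\<psi> x\<bar>) = \<bar>f - c\<bar> * ((b - a) / 2)"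
    proof -
      have eq: "\<psi> x = f - c" if "a \<le> x" "x < m" for x using that by (simp add: \<psi>_def)
      show "mean a m \<psi> = f - c" using mean_cong[of a m \<psi> "\<lambda>_. f - c"] eq m(1) by simp
      show "intg a m \<psi>" using intg_cong[of a m \<psi> "\<lambda>_. f - c", THEN iffD2] eq intg_const by blast
      show "iint a m (\<lambda>x. \<bar>\<psi> x\<bar>) = \<bar>f - c\<bar> * ((b - a) / 2)"
        using iint_cong[of a m "\<lambda>x. \<bar>\<psi> x\<bar>" "\<lambda>_. \<bar>f - c\<bar>"] eq m(1,3) by simp
    qed
    have r: "mean m b \<psi> = f + c" "intg m b \<psi>" "iint m b (\<lambda>x. \<bar>\<psi> x\<bar>) = \<bar>f + c\<bar> * ((b - a) / 2)"
    proof -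
      have eq: "\<psi> x = f + c" if "m \<le> x" "x < b" for x using that by (simp add: \<psi>_def)
      show "mean m b \<psi> = f + c" using mean_cong[of m b \<psi> "\<lambda>_. f + c"] eq m(2) by simp
      show "intg m b \<psi>" using intg_cong[of m b \<psi> "\<lambda>_. f + c", THEN iffD2] eq intg_const by blast
      show "iint m b (\<lambda>x. \<bar>\<psi> x\<bar>) = \<bar>f + c\<bar> * ((b - a) / 2)"
        using iint_cong[of m b "\<lambda>x. \<bar>\<psi> x\<bar>" "\<lambda>_. \<bar>f + c\<bar>"] eq m(2,4) by simp
    qed
    have \<psi>: "intg a b \<psi>" by (intro intg_join[OF l(2) r(2)] less_imp_le m)
    have "osc a b \<psi> = c" unfolding osc_def m_def[symmetric] l(1) r(1) by simp
    then have "ennreal lam \<le> sq a b \<psi> x" for x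
    proof -
      have "ennreal lam \<le> ennreal ((osc a b \<psi>)\<^sup>2)"
        using \<open>osc a b \<psi> = c\<close> 0(4) by (intro ennreal_leI) simp
      also have "\<dots> \<le> sq a b \<psi> x" unfolding sq_rec[of a b] by simp
      finally show ?thesis .
    qed
    moreover have "mean a b \<psi> = f"
      unfolding mean_halves[OF 0(1) m_def \<psi>] l(1) r(1) by simp
    moreover have "iint a b (\<lambda>x. \<bar>\<psi> x\<bar>) \<le> iint a b (\<lambda>x. \<bar>\<phi> x\<bar>) + c * bad a b \<phi> lam 0"
    proof -
      have "iint a b (\<lambda>x. \<bar>\<psi> x\<bar>) = (\<bar>f - c\<bar> + \<bar>f + c\<bar>) * ((b - a) / 2)"
        using iint_split[OF intg_abs[OF \<psi>] less_imp_le[OF m(1)] less_imp_le[OF m(2)]]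
        unfolding l(3) r(3) by (simp only: distrib_right)
      also have "\<dots> \<le> (2 * (\<bar>f\<bar> + c)) * ((b - a) / 2)"
        using 0 by (intro mult_right_mono) auto
      also have "\<dots> = \<bar>f\<bar> * (b - a) + c * (b - a)" by (simp add: field_simps)
      also have "\<bar>f\<bar> * (b - a) = \<bar>iint a b \<phi>\<bar>" using 0(1) by (simp add: f_def mean_def abs_divide)
      also have "\<dots> \<le> iint a b (\<lambda>x. \<bar>\<phi> x\<bar>)" by (rule iint_abs_ge[OF 0(2)])
      finally show ?thesis using True 0(1) by (simp add: bad_0)
    qed
    ultimately show ?thesis using \<psi> f_def by blast
  qed
next
  case (Suc N)
  define m where "m = (a + b) / 2"
  define l where "l = lam - (osc a b \<phi>)\<^sup>2"
  have m: "a < m" "m < b" using Suc.prems(1) by (auto simp: m_def)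
  have \<phi>: "intg a m \<phi>" "intg m b \<phi>" using Suc.prems(2) m by (auto intro: intg_sub)
  have "l \<le> c\<^sup>2" using Suc.prems(4) zero_le_power2[of "osc a b \<phi>"] unfolding l_def by linarith
  note IH = Suc.IH[OF m(1) \<phi>(1) Suc.prems(3) this] Suc.IH[OF m(2) \<phi>(2) Suc.prems(3) this]
  obtain \<psi>1 where \<psi>1: "intg a m \<psi>1" "mean a m \<psi>1 = mean a m \<phi>" "\<And>x. ennreal l \<le> sq a m \<psi>1 x"
    "iint a m (\<lambda>x. \<bar>\<psi>1 x\<bar>) \<le> iint a m (\<lambda>x. \<bar>\<phi> x\<bar>) + c * bad a m \<phi> l N"
    using IH(1) by blast
  obtain \<psi>2 where \<psi>2: "intg m b \<psi>2" "mean m b \<psi>2 = mean m b \<phi>" "\<And>x. ennreal l \<le> sq m b \<psi>2 x"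
    "iint m b (\<lambda>x. \<bar>\<psi>2 x\<bar>) \<le> iint m b (\<lambda>x. \<bar>\<phi> x\<bar>) + c * bad m b \<phi> l N"
    using IH(2) by blast
  define \<psi> where "\<psi> x = (if x < m then \<psi>1 x else \<psi>2 x)" for x
  have 1: "intg a m \<psi>" "mean a m \<psi> = mean a m \<phi>" "\<And>x. sq a m \<psi> x = sq a m \<psi>1 x"
    "iint a m (\<lambda>x. \<bar>\<psi> x\<bar>) = iint a m (\<lambda>x. \<bar>\<psi>1 x\<bar>)"
    using intg_cong[of a m \<psi> \<psi>1] mean_cong[of a m \<psi> \<psi>1] sq_cong[of a m \<psi> \<psi>1] \<psi>1(1,2) m
      iint_cong[of a m "\<lambda>x. \<bar>\<psi> x\<bar>" "\<lambda>x. \<bar>\<psi>1 x\<bar>"] by (auto simp: \<psi>_def)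
  have 2: "intg m b \<psi>" "mean m b \<psi> = mean m b \<phi>" "\<And>x. sq m b \<psi> x = sq m b \<psi>2 x"
    "iint m b (\<lambda>x. \<bar>\<psi> x\<bar>) = iint m b (\<lambda>x. \<bar>\<psi>2 x\<bar>)"
    using intg_cong[of m b \<psi> \<psi>2] mean_cong[of m b \<psi> \<psi>2] sq_cong[of m b \<psi> \<psi>2] \<psi>2(1,2) m
      iint_cong[of m b "\<lambda>x. \<bar>\<psi> x\<bar>" "\<lambda>x. \<bar>\<psi>2 x\<bar>"] by (auto simp: \<psi>_def)
  have \<psi>: "intg a b \<psi>" by (intro intg_join[OF 1(1) 2(1)] less_imp_le m)
  have "mean a b \<psi> = mean a b \<phi>"
    unfolding mean_halves[OF Suc.prems(1) m_def \<psi>] mean_halves[OF Suc.prems(1) m_def Suc.prems(2)] 1 2 ..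
  moreover have "ennreal lam \<le> sq a b \<psi> x" for x
  proof -
    have "osc a b \<psi> = osc a b \<phi>" unfolding osc_def m_def[symmetric] 1 2 ..
    \<comment> \<open>The remaining level \<open>l\<close> may be negative; \<open>max 0 l\<close>
      matches the truncation of \<open>ennreal l\<close> at 0.\<close>
    have "ennreal lam \<le> ennreal ((osc a b \<phi>)\<^sup>2 + max 0 l)"
      by (intro ennreal_leI) (simp add: l_def)
    also have "\<dots> = ennreal ((osc a b \<phi>)\<^sup>2) + ennreal l"
      by (subst ennreal_plus) (auto simp: ennreal_neg max_def)
    also have "\<dots> \<le> sq a b \<psi> x"
      unfolding sq_rec[of a b] m_def[symmetric] \<open>osc a b \<psi> = osc a b \<phi>\<close> 1 2
      using \<psi>1(3) \<psi>2(3) by (intro add_left_mono) auto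
    finally show ?thesis .
  qed
  moreover have "iint a b (\<lambda>x. \<bar>\<psi> x\<bar>) \<le> iint a b (\<lambda>x. \<bar>\<phi> x\<bar>) + c * bad a b \<phi> lam (Suc N)"
    unfolding bad_Suc[OF Suc.prems(1) m_def] l_def[symmetric]
    using iint_split[OF intg_abs[OF \<psi>], of m] iint_split[OF intg_abs[OF Suc.prems(2)], of m]
      \<psi>1(4) \<psi>2(4) m 1 2 by (simp add: distrib_left)
  ultimately show ?case using \<psi> by blast
qed

text \<open>Spreading \<open>\<phi>\<close> slightly away from its mean turns \<open>S\<^sup>2 \<ge> lam\<close> into a strict inequality, which
  is reached at a finite stage of the martingale.\<close>
lemma fill:
  assumes "a < b" "intg a b \<phi>" "0 < lam" "0 < \<epsilon>"
  shows "\<exists>\<psi>. intg a b \<psi> \<and> mean a b \<psi> = mean a b \<phi> \<and> lev a b \<psi> lam = b - a \<and>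
    iint a b (\<lambda>x. \<bar>\<psi> x\<bar>) \<le> iint a b (\<lambda>x. \<bar>\<phi> x\<bar>) + sqrt lam * (b - a - lev a b \<phi> lam) + \<epsilon>"
proof -
  define f where "f = mean a b \<phi>"
  define F where "F = iint a b (\<lambda>x. \<bar>\<phi> x\<bar>)"
  have F: "0 \<le> F" using iint_abs_ge[OF assms(2)] by (simp add: F_def)
  \<comment> \<open>The first three terms of the denominator collect the errors proportional to
    \<open>\<delta>\<close>: from stretching \<open>\<phi>\<close>, from shifting by
    \<open>\<delta> * f\<close>, and from stopping at a finite stage. The 1 makes it
    positive.\<close>
  define \<delta> where "\<delta> = \<epsilon> / (F + \<bar>f\<bar> * (b - a) + sqrt lam + 1)"
  have den: "0 < F + \<bar>f\<bar> * (b - a) + sqrt lam + 1"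
    using F assms by (intro add_nonneg_pos add_nonneg_nonneg) auto
  then have \<delta>: "0 < \<delta>" using assms(4) by (simp add: \<delta>_def)
  \<comment> \<open>This is \<open>f + (1 + \<delta>) * (\<phi> x - f)\<close>: the mean is kept and
    every jump is multiplied by \<open>1 + \<delta>\<close>, so level \<open>lam\<close> for
    \<open>\<eta>\<close> means level \<open>lam / (1 + \<delta>)^2\<close> for
    \<open>\<phi>\<close>.\<close>
  define \<eta> where "\<eta> x = - \<delta> * f + (1 + \<delta>) * \<phi> x" for x
  have \<eta>: "intg a b \<eta>"
    unfolding \<eta>_def using assms(2) by (intro set_integral_add set_integrable_mult_right) auto
  have mean_\<eta>: "mean a b \<eta> = f"
  proof -
    have "iint a b \<eta> = - \<delta> * f * (b - a) + (1 + \<delta>) * iint a b \<phi>"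
      unfolding \<eta>_def using assms(1,2)
      by (subst iint_add) (auto intro: set_integrable_mult_right simp del: mult_minus_left)
    also have "iint a b \<phi> = f * (b - a)" using assms(1) by (simp add: f_def mean_def)
    also have "- \<delta> * f * (b - a) + (1 + \<delta>) * (f * (b - a)) = f * (b - a)" by (simp add: algebra_simps)
    finally show ?thesis using assms(1) by (simp add: mean_def)
  qed
  have abs_\<eta>: "iint a b (\<lambda>x. \<bar>\<eta> x\<bar>) \<le> (1 + \<delta>) * F + \<delta> * \<bar>f\<bar> * (b - a)"
  proof -
    have "iint a b (\<lambda>x. \<bar>\<eta> x\<bar>) \<le> iint a b (\<lambda>x. (1 + \<delta>) * \<bar>\<phi> x\<bar> + \<delta> * \<bar>f\<bar>)"
      using \<eta> \<delta> assms(2)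
      by (intro iint_mono intg_abs set_integral_add set_integrable_mult_right)
        (auto simp: \<eta>_def abs_mult intro: order_trans[OF abs_triangle_ineq4])
    also have "\<dots> = (1 + \<delta>) * F + \<delta> * \<bar>f\<bar> * (b - a)"
      using assms by (subst iint_add) (auto simp: F_def intro!: set_integrable_mult_right intg_abs)
    finally show ?thesis .
  qed
  have sq: "lam / (1 + \<delta>)\<^sup>2 < lam"
  proof -
    have "1 < (1 + \<delta>)\<^sup>2" using \<delta> by (intro one_less_power) auto
    then show ?thesis using assms(3) by (simp add: divide_less_eq)
  qed
  obtain N where N: "bad a b \<phi> (lam / (1 + \<delta>)\<^sup>2) N \<le> b - a - lev a b \<phi> lam + \<delta>"
    using bad_le_lev[OF sq assms(3) \<delta>] assms(1) by fastforce
  have "tsq N a b \<eta> x < lam \<longleftrightarrow> tsq N a b \<phi> x < lam / (1 + \<delta>)\<^sup>2" for x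
    using \<delta> unfolding \<eta>_def tsq_affine[OF assms(1,2)] by (simp add: field_simps)
  then have bad_\<eta>: "bad a b \<eta> lam N = bad a b \<phi> (lam / (1 + \<delta>)\<^sup>2) N"
    by (simp add: bad_def)
  obtain \<psi> where \<psi>: "intg a b \<psi>" "mean a b \<psi> = mean a b \<eta>" "\<And>x. ennreal lam \<le> sq a b \<psi> x"
    "iint a b (\<lambda>x. \<bar>\<psi> x\<bar>) \<le> iint a b (\<lambda>x. \<bar>\<eta> x\<bar>) + sqrt lam * bad a b \<eta> lam N"
    using fill_step[OF assms(1) \<eta>, of "sqrt lam" lam N] assms(3) by auto
  note \<psi>(4)
  also have "iint a b (\<lambda>x. \<bar>\<eta> x\<bar>) + sqrt lam * bad a b \<eta> lam N \<le>
    ((1 + \<delta>) * F + \<delta> * \<bar>f\<bar> * (b - a)) + sqrt lam * (b - a - lev a b \<phi> lam + \<delta>)"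
    using abs_\<eta> N assms(3) unfolding bad_\<eta> by (intro add_mono mult_left_mono) auto
  also have "\<dots> = F + sqrt lam * (b - a - lev a b \<phi> lam) + \<delta> * (F + \<bar>f\<bar> * (b - a) + sqrt lam)"
    by (simp add: algebra_simps)
  also have "\<delta> * (F + \<bar>f\<bar> * (b - a) + sqrt lam) \<le> \<epsilon>"
    using den assms(4) by (simp add: \<delta>_def field_simps)
  finally have "iint a b (\<lambda>x. \<bar>\<psi> x\<bar>) \<le> F + sqrt lam * (b - a - lev a b \<phi> lam) + \<epsilon>" by simp
  moreover have "{x\<in>{a..<b}. ennreal lam \<le> sq a b \<psi> x} = {a..<b}" using \<psi>(3) by auto
  then have "lev a b \<psi> lam = b - a" using assms(1) unfolding lev_def by simp
  ultimately show ?thesis using \<psi>(1,2) mean_\<eta> by (auto simp: f_def F_def)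
qed

section \<open>Affine copies and gluing\<close>

lemma indicator_affine:
  "0 < (c::real) \<Longrightarrow> indicator {s + c * u..<s + c * v} (s + c * y) = (indicator {u..<v} y :: real)"
  by (auto simp: indicator_def)

lemma intg_affine_iff:
  assumes "0 < c"
  shows "intg (s + c * u) (s + c * v) \<phi> \<longleftrightarrow> intg u v (\<lambda>y. \<phi> (s + c * y))"
  using lebesgue_integrable_real_affine_iff[of c "\<lambda>x. indicator {s + c * u..<s + c * v} x *\<^sub>R \<phi> x" s] assms
  by (simp add: set_integrable_def indicator_affine)

lemma iint_affine:
  assumes "0 < c"
  shows "iint (s + c * u) (s + c * v) \<phi> = c * iint u v (\<lambda>y. \<phi> (s + c * y))"
  using lebesgue_integral_real_affine[of c "\<lambda>x. indicator {s + c * u..<s + c * v} x *\<^sub>R \<phi> x" s] assms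
  by (simp add: iint_def set_lebesgue_integral_def indicator_affine)

lemma mean_affine:
  assumes "0 < c"
  shows "mean (s + c * u) (s + c * v) \<phi> = mean u v (\<lambda>y. \<phi> (s + c * y))"
  using assms by (simp add: mean_def iint_affine flip: right_diff_distrib)

lemma mid_affine: "(s + c * u + (s + c * v)) / 2 = s + c * ((u + v) / (2::real))"
  by (simp add: field_simps)

lemma osc_affine_arg:
  assumes "0 < c"
  shows "osc (s + c * u) (s + c * v) \<phi> = osc u v (\<lambda>y. \<phi> (s + c * y))"
  unfolding osc_def mid_affine by (simp only: mean_affine[OF assms])

lemma tsq_affine_arg:
  assumes "0 < c"
  shows "tsq N (s + c * u) (s + c * v) \<phi> (s + c * y) = tsq N u v (\<lambda>y. \<phi> (s + c * y)) y"
  using assms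
  by (induction N arbitrary: u v) (simp_all only: tsq.simps mid_affine osc_affine_arg add_less_cancel_left mult_less_cancel_left_pos)

lemma sq_affine_arg:
  assumes "0 < c"
  shows "sq (s + c * u) (s + c * v) \<phi> (s + c * y) = sq u v (\<lambda>y. \<phi> (s + c * y)) y"
  unfolding sq_def tsq_affine_arg[OF assms] ..

lemma intg_indicator_sq: "intg c d (\<lambda>x. indicator {x. ennreal lam \<le> sq a b \<phi> x} x)"
proof -
  have "indicator {c..<d} x *\<^sub>R indicator {x. ennreal lam \<le> sq a b \<phi> x} x =
    (indicator {x\<in>{c..<d}. ennreal lam \<le> sq a b \<phi> x} x :: real)" for x
    by (auto simp: indicator_def)
  moreover have "integrable lebesgue (indicator {x\<in>{c..<d}. ennreal lam \<le> sq a b \<phi> x} :: real \<Rightarrow> real)"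
    using lmeasurable_sq_ge[of c d "ennreal lam" a b \<phi>]
    by (intro integrable_real_indicator) (auto simp: fmeasurable_def)
  ultimately show ?thesis by (simp add: set_integrable_def)
qed

lemma lev_eq_iint: "lev a b \<phi> lam = iint a b (\<lambda>x. indicator {x. ennreal lam \<le> sq a b \<phi> x} x)"
proof -
  have "indicator {a..<b} x *\<^sub>R indicator {x. ennreal lam \<le> sq a b \<phi> x} x =
    (indicator {x\<in>{a..<b}. ennreal lam \<le> sq a b \<phi> x} x :: real)" for x
    by (auto simp: indicator_def)
  then show ?thesis
    using lmeasurable_sq_ge[of a b "ennreal lam" a b \<phi>]
    by (simp add: iint_def set_lebesgue_integral_def lev_def fmeasurableD)
qed

lemma lev_affine:
  assumes "0 < c"
  shows "lev (s + c * u) (s + c * v) \<phi> lam = c * lev u v (\<lambda>y. \<phi> (s + c * y)) lam"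
proof -
  have "indicator {x. ennreal lam \<le> sq (s + c * u) (s + c * v) \<phi> x} (s + c * y) =
    (indicator {y. ennreal lam \<le> sq u v (\<lambda>y. \<phi> (s + c * y)) y} y :: real)" for y
    by (simp add: indicator_def sq_affine_arg[OF assms])
  then show ?thesis
    unfolding lev_eq_iint iint_affine[OF assms] by simp
qed

text \<open>The blocks \<open>{lo n..<lo (Suc n)}\<close> are the left halves in the chain of dyadic
  tails \<open>{lo n..<1}\<close> and partition \<open>{0..<1}\<close>. By binary expansion a
  selection of blocks can have any total length in [0, 1], so weights are realised exactly.\<close>

definition lo :: "nat \<Rightarrow> real" where
  "lo n = 1 - (1/2) ^ n"

definition idx :: "real \<Rightarrow> nat" where
  "idx x = (LEAST n. x < lo (Suc n))"

definition glue :: "nat set \<Rightarrow> (real \<Rightarrow> real) \<Rightarrow> real \<Rightarrow> real" where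
  "glue N \<psi> x = (if idx x \<in> N then \<psi> ((x - lo (idx x)) * 2 ^ Suc (idx x)) else 0)"

lemma lo_0 [simp]: "lo 0 = 0"
  by (simp add: lo_def)

lemma lo_less_1 [simp]: "lo n < 1"
  by (simp add: lo_def)

lemma lo_mono: "m \<le> n \<Longrightarrow> lo m \<le> lo n"
  by (simp add: lo_def power_decreasing)

lemma lo_nonneg [simp]: "0 \<le> lo n"
  using lo_mono[of 0 n] by simp

lemma lo_Suc: "lo (Suc n) = lo n + (1/2) ^ Suc n"
  by (simp add: lo_def)

lemma lo_mid: "(lo n + 1) / 2 = lo (Suc n)"
  by (simp add: lo_def field_simps)

lemma lo_less_Suc [simp]: "lo n < lo (Suc n)"
  by (simp add: lo_Suc)

lemma idx_eq:
  assumes "lo n \<le> x" "x < lo (Suc n)"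
  shows "idx x = n"
  unfolding idx_def
proof (rule Least_equality)
  show "x < lo (Suc n)" by fact
  fix k assume "x < lo (Suc k)"
  then have "lo n < lo (Suc k)" using assms(1) by simp
  then show "n \<le> k" using lo_mono[of "Suc k" n] by (meson not_less not_less_eq_eq)
qed

lemma idx_bounds:
  assumes "0 \<le> x" "x < 1"
  shows "lo (idx x) \<le> x" "x < lo (Suc (idx x))"
proof -
  obtain k where "(1/2) ^ k < 1 - x"
    using real_arch_pow_inv[of "1 - x" "1/2"] assms by auto
  then have "x < lo k" by (simp add: lo_def)
  then have ex: "x < lo (Suc k)" using lo_mono[of k "Suc k"] by simp
  then show "x < lo (Suc (idx x))" unfolding idx_def by (rule LeastI)
  show "lo (idx x) \<le> x"
  proof (cases "idx x")
    case (Suc j)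
    then have "\<not> x < lo (Suc j)"
      using not_less_Least[of j "\<lambda>n. x < lo (Suc n)"] by (simp add: idx_def)
    then show ?thesis using Suc by simp
  qed (use assms in simp)
qed

lemma idx_affine:
  assumes "0 \<le> y" "y < 1"
  shows "idx (lo n + (1/2) ^ Suc n * y) = n"
  using assms by (intro idx_eq) (auto simp: lo_Suc)

lemma glue_affine:
  assumes "0 \<le> y" "y < 1"
  shows "glue N \<psi> (lo n + (1/2) ^ Suc n * y) = (if n \<in> N then \<psi> y else 0)"
proof -
  have "(lo n + (1/2) ^ Suc n * y - lo n) * 2 ^ Suc n = y" by (simp add: power_one_over)
  then show ?thesis unfolding glue_def idx_affine[OF assms] by (simp only:)
qed

lemma iint_lo:
  "iint (lo n) (lo (Suc n)) g = (1/2) ^ Suc n * iint 0 1 (\<lambda>y. g (lo n + (1/2) ^ Suc n * y))"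
  using iint_affine[of "(1/2) ^ Suc n" "lo n" 0 1 g] by (simp add: lo_Suc)

lemma intg_lo_iff:
  "intg (lo n) (lo (Suc n)) g \<longleftrightarrow> intg 0 1 (\<lambda>y. g (lo n + (1/2) ^ Suc n * y))"
  using intg_affine_iff[of "(1/2) ^ Suc n" "lo n" 0 1 g] by (simp add: lo_Suc)

lemma glue_integral:
  assumes \<psi>: "intg 0 1 \<psi>" and t: "(\<lambda>n. if n \<in> N then (1/2) ^ Suc n else 0) sums t"
  shows "intg 0 1 (glue N \<psi>)" "iint 0 1 (glue N \<psi>) = t * iint 0 1 \<psi>"
proof -
  let ?w = "\<lambda>n. if n \<in> N then (1/2) ^ Suc n else (0::real)"
  let ?g = "glue N \<psi>"
  let ?f = "\<lambda>n x. indicator {lo n..<lo (Suc n)} x *\<^sub>R ?g x"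
  have cong: "iint 0 1 (\<lambda>y. h (?g (lo n + (1/2) ^ Suc n * y))) = iint 0 1 (\<lambda>y. h (if n \<in> N then \<psi> y else 0))" for n h
    by (rule iint_cong) (simp only: glue_affine)
  have "intg 0 1 (\<lambda>y. ?g (lo n + (1/2) ^ Suc n * y)) \<longleftrightarrow> intg 0 1 (\<lambda>y. if n \<in> N then \<psi> y else 0)" for n
    by (rule intg_cong) (simp only: glue_affine)
  then have int: "intg (lo n) (lo (Suc n)) ?g" for n
    unfolding intg_lo_iff using \<psi> by (cases "n \<in> N") auto
  then have int_f: "integrable lebesgue (?f n)" for n
    by (simp add: set_integrable_def)
  have val: "(\<integral>x. ?f n x \<partial>lebesgue) = ?w n * iint 0 1 \<psi>" for n
    using iint_lo[of n ?g] cong[of "\<lambda>x. x" n] by (cases "n \<in> N") (simp_all add: iint_def set_lebesgue_integral_def)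
  have "norm (?f n x) = indicator {lo n..<lo (Suc n)} x *\<^sub>R \<bar>?g x\<bar>" for n x
    by (simp add: abs_mult)
  then have nrm: "(\<integral>x. norm (?f n x) \<partial>lebesgue) = ?w n * iint 0 1 (\<lambda>x. \<bar>\<psi> x\<bar>)" for n
    using iint_lo[of n "\<lambda>x. \<bar>?g x\<bar>"] cong[of abs n]
    by (cases "n \<in> N") (simp_all add: iint_def set_lebesgue_integral_def)
  have pt: "(\<lambda>n. ?f n x) sums (indicator {0..<1} x *\<^sub>R ?g x)" for x
  proof (cases "0 \<le> x \<and> x < 1")
    case True
    have "?f n x = (if n = idx x then ?g x else 0)" for n
    proof (cases "n = idx x")
      case True
      then show ?thesis using idx_bounds[of x] \<open>0 \<le> x \<and> x < 1\<close> by simp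
    next
      case False
      then have "x \<notin> {lo n..<lo (Suc n)}" using idx_eq[of n x] by auto
      then show ?thesis using False by simp
    qed
    then show ?thesis using sums_single[of "idx x" "\<lambda>_. ?g x"] True by simp
  next
    case False
    have "x \<notin> {lo n..<lo (Suc n)}" for n
      using False lo_nonneg[of n] lo_less_1[of "Suc n"] by (auto simp del: lo_nonneg lo_less_1)
    then have "(\<lambda>n. ?f n x) = (\<lambda>n. 0)" by simp
    moreover have "indicator {0..<1} x *\<^sub>R ?g x = 0" using False by simp
    ultimately show ?thesis by (simp only: sums_zero)
  qed
  have sum_pt: "summable (\<lambda>n. norm (?f n x))" for x
    using pt[of x] pt summable_finite[of "{idx x}" "\<lambda>n. norm (?f n x)"] idx_eq[of _ x]
    by (metis (no_types, lifting) finite.emptyI finite_insert indicator_simps(2) insertI1 norm_zero scaleR_zero_left atLeastLessThan_iff)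
  have sum_int: "summable (\<lambda>n. \<integral>x. norm (?f n x) \<partial>lebesgue)"
    unfolding nrm using t by (intro summable_mult2 sums_summable)
  have eq: "(\<Sum>n. ?f n x) = indicator {0..<1} x *\<^sub>R ?g x" for x
    using pt[of x] by (rule sums_unique[symmetric])
  show "intg 0 1 ?g"
    using integrable_suminf[OF int_f AE_I2[OF sum_pt] sum_int] unfolding eq set_integrable_def .
  have "iint 0 1 ?g = (\<Sum>n. ?w n * iint 0 1 \<psi>)"
    using integral_suminf[OF int_f AE_I2[OF sum_pt] sum_int] unfolding eq val
    by (simp add: iint_def set_lebesgue_integral_def)
  also have "\<dots> = t * iint 0 1 \<psi>"
    using sums_mult2[OF t] by (rule sums_unique[symmetric])
  finally show "iint 0 1 ?g = t * iint 0 1 \<psi>" .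
qed

text \<open>A point of block \<open>n\<close> passes through the tails \<open>{lo j..<1}\<close>
  with \<open>k \<le> j \<le> n\<close> before it enters its block; each tail contributes one
  jump.\<close>

lemma sq_tail:
  assumes "k \<le> n" "lo n \<le> x" "x < lo (Suc n)"
  shows "sq (lo k) 1 g x = (\<Sum>j=k..n. ennreal ((osc (lo j) 1 g)\<^sup>2)) + sq (lo n) (lo (Suc n)) g x"
  using assms(1)
proof (induction k rule: inc_induct)
  case base
  show ?case using assms by (subst sq_rec) (simp add: lo_mid)
next
  case (step k)
  have "\<not> x < lo (Suc k)" using lo_mono[of "Suc k" n] step assms by simp
  moreover have "(\<Sum>j=k..n. ennreal ((osc (lo j) 1 g)\<^sup>2)) =
    ennreal ((osc (lo k) 1 g)\<^sup>2) + (\<Sum>j=Suc k..n. ennreal ((osc (lo j) 1 g)\<^sup>2))"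
    using step by (intro sum.atLeast_Suc_atMost) simp
  ultimately show ?case using step by (subst sq_rec) (simp add: lo_mid add.assoc)
qed

lemma sq_lo:
  "sq (lo n) (lo (Suc n)) g (lo n + (1/2) ^ Suc n * y) = sq 0 1 (\<lambda>y. g (lo n + (1/2) ^ Suc n * y)) y"
  using sq_affine_arg[of "(1/2) ^ Suc n" "lo n" 0 1 g y] by (simp add: lo_Suc)

lemma glue_expand:
  assumes "0 \<le> x" "x < 1"
  obtains n y where "0 \<le> y" "y < 1" "x = lo n + (1/2) ^ Suc n * y"
proof
  let ?n = "idx x"
  show "x = lo ?n + (1/2) ^ Suc ?n * ((x - lo ?n) * 2 ^ Suc ?n)"
    by (simp add: power_one_over)
  show "0 \<le> (x - lo ?n) * 2 ^ Suc ?n" using idx_bounds[OF assms] by simp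
  have "(x - lo ?n) < (1/2) ^ Suc ?n" using idx_bounds[OF assms] by (simp add: lo_Suc)
  then show "(x - lo ?n) * 2 ^ Suc ?n < 1" by (simp add: power_one_over field_simps)
qed

lemma affine_lo_mem:
  assumes "0 \<le> y" "y < 1"
  shows "lo n \<le> lo n + (1/2) ^ Suc n * y" "lo n + (1/2) ^ Suc n * y < lo (Suc n)"
  using assms by (auto simp: lo_Suc)

lemma binary_expansion:
  fixes t :: real
  assumes "0 \<le> t" "t \<le> 1"
  obtains N where "(\<lambda>n. if n \<in> N then (1/2) ^ Suc n else 0) sums t"
proof (cases "t = 1")
  \<comment> \<open>The floor digits of 1 are all 0, because its integer part is 1; the expansion
    with all digits 1 is used instead.\<close>
  case True
  then show ?thesis using that[of UNIV] power_half_series by simp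
next
  case False
  \<comment> \<open>\<open>d n\<close> is the binary digit of \<open>t\<close> in place
    \<open>Suc n\<close> after the point.\<close>
  define d where "d n = \<lfloor>2 ^ Suc n * t\<rfloor> - 2 * \<lfloor>2 ^ n * t\<rfloor>" for n
  have d: "d n = 0 \<or> d n = 1" for n
  proof -
    have "real_of_int \<lfloor>2 ^ n * t\<rfloor> \<le> 2 ^ n * t" "2 ^ n * t < real_of_int \<lfloor>2 ^ n * t\<rfloor> + 1"
      by linarith+
    moreover have "2 ^ Suc n * t = 2 * (2 ^ n * t)" by simp
    ultimately show ?thesis unfolding d_def by linarith
  qed
  have part: "(\<Sum>i<n. of_int (d i) * (1/2) ^ Suc i) = \<lfloor>2 ^ n * t\<rfloor> * (1/2) ^ n" for n
  proof (induction n)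
    case 0
    have "\<lfloor>t\<rfloor> = 0" using assms False by (simp add: floor_eq_iff)
    then show ?case by simp
  next
    case (Suc n)
    then show ?case by (simp add: d_def algebra_simps)
  qed
  have "(\<lambda>n. \<lfloor>2 ^ n * t\<rfloor> * (1/2) ^ n) \<longlonglongrightarrow> t"
  proof (rule real_tendsto_sandwich)
    have "t - (1/2) ^ n \<le> \<lfloor>2 ^ n * t\<rfloor> * (1/2) ^ n" for n
    proof -
      have "2 ^ n * t - 1 \<le> \<lfloor>2 ^ n * t\<rfloor>" by linarith
      from mult_right_mono[OF this, of "(1/2) ^ n"] show ?thesis by (simp add: power_one_over field_simps)
    qed
    then show "\<forall>\<^sub>F n in sequentially. t - (1/2) ^ n \<le> \<lfloor>2 ^ n * t\<rfloor> * (1/2) ^ n" by simp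
    have "\<lfloor>2 ^ n * t\<rfloor> * (1/2) ^ n \<le> t" for n
    proof -
      have "\<lfloor>2 ^ n * t\<rfloor> \<le> 2 ^ n * t" by linarith
      from mult_right_mono[OF this, of "(1/2) ^ n"] show ?thesis by (simp add: power_one_over field_simps)
    qed
    then show "\<forall>\<^sub>F n in sequentially. \<lfloor>2 ^ n * t\<rfloor> * (1/2) ^ n \<le> t" by simp
    show "(\<lambda>n. t - (1/2) ^ n) \<longlonglongrightarrow> t"
      using tendsto_diff[OF tendsto_const LIMSEQ_power_zero[of "1/2 :: real"], of t] by simp
  qed auto
  then have "(\<lambda>n. of_int (d n) * (1/2) ^ Suc n) sums t"
    by (simp only: sums_def part)
  moreover have "of_int (d n) * (1/2) ^ Suc n = (if n \<in> {n. d n = 1} then (1/2) ^ Suc n else (0::real))" for n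
    using d[of n] by auto
  then have "(\<lambda>n. of_int (d n) * (1/2) ^ Suc n) = (\<lambda>n. if n \<in> {n. d n = 1} then (1/2) ^ Suc n else (0::real))" by (rule ext)
  ultimately show ?thesis using that[of "{n. d n = 1}"] by (simp only:)
qed

text \<open>Dilution with zeros. The levels satisfy only an inequality, since the tails have jumps
  of their own; these can only enlarge the square function on a copied block.\<close>

lemma glue_scaled:
  assumes "intg 0 1 \<psi>" "\<And>x. 0 \<le> \<psi> x" "0 \<le> t" "t \<le> 1"
  shows "\<exists>g. intg 0 1 g \<and> iint 0 1 g = t * iint 0 1 \<psi> \<and> (\<forall>x. 0 \<le> g x) \<and> t * lev 0 1 \<psi> lam \<le> lev 0 1 g lam"
proof -
  obtain N where N: "(\<lambda>n. if n \<in> N then (1/2) ^ Suc n else 0) sums t"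
    using binary_expansion assms(3,4) .
  let ?g = "glue N \<psi>"
  let ?L = "\<lambda>x. indicator {x. ennreal lam \<le> sq 0 1 \<psi> x} x"
  note L = glue_integral[OF intg_indicator_sq[of 0 1 lam 0 1 \<psi>] N]
  have "t * lev 0 1 \<psi> lam = iint 0 1 (glue N ?L)"
    by (simp only: L lev_eq_iint)
  also have "\<dots> \<le> lev 0 1 ?g lam"
    unfolding lev_eq_iint
  proof (rule iint_mono[OF L(1) intg_indicator_sq])
    fix x :: real assume "0 \<le> x" "x < 1"
    then obtain n y where y: "0 \<le> y" "y < 1" and x: "x = lo n + (1/2) ^ Suc n * y"
      by (rule glue_expand)
    have "glue N ?L x \<le> (if n \<in> N then ?L y else 0)"
      unfolding x glue_affine[OF y] ..
    also have "\<dots> \<le> indicator {x. ennreal lam \<le> sq 0 1 ?g x} x"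
    proof (cases "n \<in> N")
      case True
      have "sq 0 1 \<psi> y = sq 0 1 (\<lambda>y. ?g (lo n + (1/2) ^ Suc n * y)) y"
        by (rule sq_cong) (simp_all only: glue_affine True if_True zero_less_one)
      also have "\<dots> = sq (lo n) (lo (Suc n)) ?g x"
        unfolding x sq_lo ..
      also have "\<dots> \<le> sq 0 1 ?g x"
        using sq_tail[of 0 n x ?g] affine_lo_mem[OF y, of n] x by (simp add: add_increasing)
      finally show ?thesis using True by (auto simp: indicator_def)
    qed simp
    finally show "glue N ?L x \<le> indicator {x. ennreal lam \<le> sq 0 1 ?g x} x" .
  qed
  finally show ?thesis
    using glue_integral[OF assms(1) N] assms(2) by (intro exI[of _ ?g]) (auto simp: glue_def)
qed

text \<open>As both functions have mean \<open>f\<close>, every block and every tail has mean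
  \<open>f\<close> too. Hence the tails have no jump, and on each block the square function is
  exactly that of the copy, which gives equality for the levels.\<close>

lemma mix:
  assumes "intg 0 1 \<psi>1" "intg 0 1 \<psi>2" "iint 0 1 \<psi>1 = f" "iint 0 1 \<psi>2 = f" "0 \<le> t" "t \<le> 1"
  shows "\<exists>g. intg 0 1 g \<and> iint 0 1 g = f \<and>
    iint 0 1 (\<lambda>x. \<bar>g x\<bar>) = t * iint 0 1 (\<lambda>x. \<bar>\<psi>1 x\<bar>) + (1 - t) * iint 0 1 (\<lambda>x. \<bar>\<psi>2 x\<bar>) \<and>
    lev 0 1 g lam = t * lev 0 1 \<psi>1 lam + (1 - t) * lev 0 1 \<psi>2 lam"
proof -
  obtain N where N: "(\<lambda>n. if n \<in> N then (1/2) ^ Suc n else 0) sums t"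
    using binary_expansion assms(5,6) .
  have N': "(\<lambda>n. if n \<in> - N then (1/2) ^ Suc n else 0) sums (1 - t)"
    using sums_diff[OF power_half_series N] by (rule sums_cong[THEN iffD1, rotated]) auto
  define mx where "mx \<phi>1 \<phi>2 x = glue N \<phi>1 x + glue (- N) \<phi>2 x" for \<phi>1 \<phi>2 x
  have mx_integral: "intg 0 1 (mx \<phi>1 \<phi>2)" "iint 0 1 (mx \<phi>1 \<phi>2) = t * iint 0 1 \<phi>1 + (1 - t) * iint 0 1 \<phi>2"
    if "intg 0 1 \<phi>1" "intg 0 1 \<phi>2" for \<phi>1 \<phi>2
    unfolding mx_def using glue_integral[OF that(1) N] glue_integral[OF that(2) N']
    by (auto simp: iint_add intro: set_integral_add)
  have mx_affine: "mx \<phi>1 \<phi>2 (lo n + (1/2) ^ Suc n * y) = (if n \<in> N then \<phi>1 y else \<phi>2 y)"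
    if "0 \<le> y" "y < 1" for \<phi>1 \<phi>2 n y
    unfolding mx_def glue_affine[OF that] by simp
  let ?g = "mx \<psi>1 \<psi>2"
  let ?L = "\<lambda>\<psi> x. indicator {x. ennreal lam \<le> sq 0 1 \<psi> x} x"
  note g = mx_integral[OF assms(1,2)]
  have iint_g: "iint 0 1 ?g = f" using g assms by (simp add: algebra_simps)
  have piece: "iint (lo n) (lo (Suc n)) ?g = (1/2) ^ Suc n * f" for n
  proof -
    have "iint 0 1 (\<lambda>y. ?g (lo n + (1/2) ^ Suc n * y)) = iint 0 1 (if n \<in> N then \<psi>1 else \<psi>2)"
      by (rule iint_cong) (simp only: mx_affine if_distribR)
    also have "\<dots> = f" using assms by simp
    finally show ?thesis unfolding iint_lo by simp
  qed
  have tail: "iint (lo k) 1 ?g = (1/2) ^ k * f" for k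
  proof (induction k)
    case (Suc k)
    have "intg (lo k) 1 ?g" using g(1) by (rule intg_sub) auto
    from iint_split[OF this, of "lo (Suc k)"] show ?case
      using Suc piece[of k] by (simp add: less_imp_le)
  qed (simp add: iint_g)
  have osc_0: "osc (lo k) 1 ?g = 0" for k
    unfolding osc_def lo_mid mean_def tail piece by (simp add: lo_def)
  have sq_g: "sq 0 1 ?g (lo n + (1/2) ^ Suc n * y) = sq 0 1 (if n \<in> N then \<psi>1 else \<psi>2) y"
    if y: "0 \<le> y" "y < 1" for n y
  proof -
    have "sq 0 1 ?g (lo n + (1/2) ^ Suc n * y) = sq (lo n) (lo (Suc n)) ?g (lo n + (1/2) ^ Suc n * y)"
      using sq_tail[of 0 n "lo n + (1/2) ^ Suc n * y" ?g] affine_lo_mem[OF y, of n] by (simp add: osc_0)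
    also have "\<dots> = sq 0 1 (\<lambda>y. ?g (lo n + (1/2) ^ Suc n * y)) y"
      by (rule sq_lo)
    also have "\<dots> = sq 0 1 (if n \<in> N then \<psi>1 else \<psi>2) y"
      by (rule sq_cong) (simp_all only: mx_affine if_distribR zero_less_one)
    finally show ?thesis .
  qed
  have "iint 0 1 (\<lambda>x. \<bar>?g x\<bar>) = iint 0 1 (mx (\<lambda>x. \<bar>\<psi>1 x\<bar>) (\<lambda>x. \<bar>\<psi>2 x\<bar>))"
  proof (rule iint_cong)
    fix x :: real assume "0 \<le> x" "x < 1"
    then obtain n y where y: "0 \<le> y" "y < 1" and x: "x = lo n + (1/2) ^ Suc n * y"
      by (rule glue_expand)
    show "\<bar>?g x\<bar> = mx (\<lambda>x. \<bar>\<psi>1 x\<bar>) (\<lambda>x. \<bar>\<psi>2 x\<bar>) x"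
      unfolding x mx_affine[OF y] by simp
  qed
  also have "\<dots> = t * iint 0 1 (\<lambda>x. \<bar>\<psi>1 x\<bar>) + (1 - t) * iint 0 1 (\<lambda>x. \<bar>\<psi>2 x\<bar>)"
    using assms by (intro mx_integral intg_abs)
  finally have abs_g: "iint 0 1 (\<lambda>x. \<bar>?g x\<bar>) = \<dots>" .
  have "lev 0 1 ?g lam = iint 0 1 (mx (?L \<psi>1) (?L \<psi>2))"
    unfolding lev_eq_iint
  proof (rule iint_cong)
    fix x :: real assume "0 \<le> x" "x < 1"
    then obtain n y where y: "0 \<le> y" "y < 1" and x: "x = lo n + (1/2) ^ Suc n * y"
      by (rule glue_expand)
    show "?L ?g x = mx (?L \<psi>1) (?L \<psi>2) x"
      unfolding x mx_affine[OF y] by (simp add: indicator_def sq_g[OF y] del: power_Suc)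
  qed
  also have "\<dots> = t * lev 0 1 \<psi>1 lam + (1 - t) * lev 0 1 \<psi>2 lam"
    unfolding lev_eq_iint by (intro mx_integral intg_indicator_sq)
  finally show ?thesis using g(1) iint_g abs_g by blast
qed

section \<open>Dyadic intervals\<close>

definition dl :: "int \<Rightarrow> int \<Rightarrow> real" where
  "dl k n = of_int k * 2 powi n"

definition dint :: "int \<Rightarrow> int \<Rightarrow> real set" where
  "dint k n = {dl k n..<dl (k + 1) n}"

lemma dyadic_iff: "I \<in> dyadic \<longleftrightarrow> (\<exists>k n. I = dint k n)"
  by (simp only: dyadic_def dl_def dint_def of_int_add of_int_1 mem_Collect_eq simp_thms)

lemma dl_less_iff [simp]: "dl j n < dl k n \<longleftrightarrow> j < k"
  by (simp add: dl_def)

lemma dl_le_iff [simp]: "dl j n \<le> dl k n \<longleftrightarrow> j \<le> k"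
  by (simp add: dl_def)

lemma dl_refine: "dl k n = dl (k * 2 ^ d) (n - int d)"
proof -
  have "(2::real) powi n = 2 powi (int d + (n - int d))" by simp
  also have "\<dots> = 2 ^ d * 2 powi (n - int d)"
    by (subst power_int_add) (auto simp: power_int_of_nat)
  finally show ?thesis unfolding dl_def by (simp only: of_int_mult of_int_power of_int_numeral mult.assoc)
qed

lemma dl_double: "dl (2 * k) (n - 1) = dl k n"
  by (subst dl_refine[of k n 1]) (simp add: mult.commute)

lemma dl_mid: "(dl k n + dl (k + 1) n) / 2 = dl (2 * k + 1) (n - 1)"
proof -
  have "dl k n = 2 * of_int k * 2 powi (n - 1)" "dl (k + 1) n = (2 * of_int k + 2) * 2 powi (n - 1)"
    using dl_double[of k n] dl_double[of "k + 1" n] by (simp_all only: dl_def) simp_all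
  then show ?thesis by (simp only: dl_def) (simp add: distrib_right)
qed

lemma dl_double_Suc: "dl (2 * k + 1 + 1) (n - 1) = dl (k + 1) n"
  using dl_double[of "k + 1" n] by (simp add: algebra_simps)

lemma left_half_dint: "left_half (dint k n) = dint (2 * k) (n - 1)"
  by (simp add: left_half_def dint_def dl_mid dl_double)

lemma right_half_dint: "right_half (dint k n) = dint (2 * k + 1) (n - 1)"
  unfolding dint_def dl_double_Suc by (simp add: right_half_def dl_mid)

lemma dint_subset_iff: "dint j m \<subseteq> dint k n \<longleftrightarrow> dl k n \<le> dl j m \<and> dl (j + 1) m \<le> dl (k + 1) n"
  by (simp add: dint_def atLeastLessThan_subset_iff)

lemma dint_nonempty: "dint k n \<noteq> {}"
  by (simp add: dint_def)

text \<open>The midpoint of the larger interval is an integer multiple \<open>q\<close> of the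
  length of a strictly smaller dyadic interval, hence not in its interior.\<close>

lemma dint_subset_cases:
  assumes "dint j m \<subseteq> dint k n"
  shows "m < n \<and> (dint j m \<subseteq> dint (2 * k) (n - 1) \<or> dint j m \<subseteq> dint (2 * k + 1) (n - 1)) \<or> j = k \<and> m = n"
proof -
  have le: "dl k n \<le> dl j m" "dl (j + 1) m \<le> dl (k + 1) n"
    using assms by (simp_all add: dint_subset_iff)
  then have "(2::real) powi m \<le> 2 powi n" by (simp add: dl_def algebra_simps)
  then have "m \<le> n"
    using power_int_strict_increasing[of n m "2::real"] by (meson not_less one_less_numeral_iff semiring_norm(76))
  show ?thesis
  proof (cases "m = n")
    case True
    then show ?thesis using le by auto
  next
    case False
    define q where "q = (2 * k + 1) * 2 ^ nat (n - 1 - m)"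
    have q: "dl (2 * k + 1) (n - 1) = dl q m"
      using dl_refine[of "2 * k + 1" "n - 1" "nat (n - 1 - m)"] False \<open>m \<le> n\<close> by (simp add: q_def)
    have "j + 1 \<le> q \<or> q \<le> j" by linarith
    then have "dint j m \<subseteq> dint (2 * k) (n - 1) \<or> dint j m \<subseteq> dint (2 * k + 1) (n - 1)"
      unfolding dint_subset_iff dl_double dl_double_Suc q using le by simp
    then show ?thesis using False \<open>m \<le> n\<close> by simp
  qed
qed

lemma dint_halves: "dint k n = dint (2 * k) (n - 1) \<union> dint (2 * k + 1) (n - 1)"
  "dint (2 * k) (n - 1) \<inter> dint (2 * k + 1) (n - 1) = {}"
proof -
  have "dl (2 * k) (n - 1) \<le> dl (2 * k + 1) (n - 1)" "dl (2 * k + 1) (n - 1) \<le> dl (2 * k + 1 + 1) (n - 1)"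
    by simp_all
  then show "dint k n = dint (2 * k) (n - 1) \<union> dint (2 * k + 1) (n - 1)"
    unfolding dint_def dl_double dl_double_Suc by auto
qed (auto simp: dint_def)

text \<open>The \<open>N\<close> generations \<open>n\<close>, \<open>n - 1\<close>, ...,
  \<open>n - N + 1\<close>. The strict bound on \<open>m\<close> makes \<open>dsub 0\<close> empty,
  in agreement with \<open>tsq 0\<close>.\<close>

definition dsub :: "nat \<Rightarrow> int \<Rightarrow> int \<Rightarrow> real set set" where
  "dsub N k n = {dint j m | j m. dint j m \<subseteq> dint k n \<and> n - int N < m}"

lemma dsubI: "dint j m \<subseteq> dint k n \<Longrightarrow> n - int N < m \<Longrightarrow> dint j m \<in> dsub N k n"
  unfolding dsub_def by blast

lemma dsubE:
  assumes "I \<in> dsub N k n"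
  obtains j m where "I = dint j m" "dint j m \<subseteq> dint k n" "n - int N < m"
  using assms unfolding dsub_def by blast

lemma dsub_0: "dsub 0 k n = {}"
proof (rule equals0I)
  fix I assume "I \<in> dsub 0 k n"
  then obtain j m where "dint j m \<subseteq> dint k n" "n - int 0 < m" by (rule dsubE)
  then show False using dint_subset_cases[of j m k n] by linarith
qed

lemma dsub_Suc: "dsub (Suc N) k n = insert (dint k n) (dsub N (2 * k) (n - 1) \<union> dsub N (2 * k + 1) (n - 1))"
proof (intro equalityI subsetI)
  fix I assume "I \<in> dsub (Suc N) k n"
  then obtain j m where I: "I = dint j m" "dint j m \<subseteq> dint k n" "n - int (Suc N) < m"
    by (rule dsubE)
  then have "n - 1 - int N < m" by simp
  then show "I \<in> insert (dint k n) (dsub N (2 * k) (n - 1) \<union> dsub N (2 * k + 1) (n - 1))"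
    using dint_subset_cases[OF I(2)] I(1) dsubI by blast
next
  fix I assume "I \<in> insert (dint k n) (dsub N (2 * k) (n - 1) \<union> dsub N (2 * k + 1) (n - 1))"
  then consider "I = dint k n" | "I \<in> dsub N (2 * k) (n - 1) \<union> dsub N (2 * k + 1) (n - 1)" by blast
  then show "I \<in> dsub (Suc N) k n"
  proof cases
    case 1
    then show ?thesis by (auto intro: dsubI)
  next
    case 2
    then obtain j m where I: "I = dint j m" "dint j m \<subseteq> dint (2 * k) (n - 1) \<union> dint (2 * k + 1) (n - 1)" "n - 1 - int N < m"
      by (blast elim: dsubE)
    show ?thesis unfolding I(1) by (rule dsubI) (use I dint_halves(1)[of k n] in auto)
  qed
qed

lemma dsub_subset: "I \<in> dsub N k n \<Longrightarrow> I \<subseteq> dint k n \<and> I \<noteq> {}"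
  by (elim dsubE) (simp add: dint_nonempty)

lemma finite_dsub: "finite (dsub N k n)"
  by (induction N arbitrary: k n) (simp_all add: dsub_0 dsub_Suc)

lemma avg_ico: "a < b \<Longrightarrow> avg {a..<b} \<phi> = mean a b \<phi>"
  by (simp add: avg_def mean_def iint_def)

definition dterm :: "(real \<Rightarrow> real) \<Rightarrow> real \<Rightarrow> real set \<Rightarrow> real" where
  "dterm \<phi> x I = \<bar>Delta I \<phi> x\<bar>\<^sup>2 * indicator I x"

lemma dterm_dint:
  "dterm \<phi> x (dint k n) = (if x \<in> dint k n then (osc (dl k n) (dl (k + 1) n) \<phi>)\<^sup>2 else 0)"
proof (cases "x \<in> dint k n")
  case True
  have "indicator (dint (2 * k + 1) (n - 1)) x - indicator (dint (2 * k) (n - 1)) x \<in> {1, -1 :: real}"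
    using True dint_halves[of k n] by (auto simp: indicator_def)
  then have sgn: "\<bar>indicator (dint (2 * k + 1) (n - 1)) x - indicator (dint (2 * k) (n - 1)) x\<bar> = (1 :: real)"
    by auto
  have "osc (dl k n) (dl (k + 1) n) \<phi> = 1/2 * (avg (dint (2 * k + 1) (n - 1)) \<phi> - avg (dint (2 * k) (n - 1)) \<phi>)"
  proof -
    have "dl (2 * k) (n - 1) < dl (2 * k + 1) (n - 1)" "dl (2 * k + 1) (n - 1) < dl (2 * k + 1 + 1) (n - 1)"
      by simp_all
    from this[THEN avg_ico, of \<phi>] show ?thesis
      unfolding osc_def dl_mid dint_def dl_double dl_double_Suc by simp
  qed
  then have "Delta (dint k n) \<phi> x = osc (dl k n) (dl (k + 1) n) \<phi> *
    (indicator (dint (2 * k + 1) (n - 1)) x - indicator (dint (2 * k) (n - 1)) x)"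
    by (simp only: Delta_def left_half_dint right_half_dint)
  then show ?thesis
    using True by (simp add: dterm_def abs_mult sgn)
qed (simp add: dterm_def)

lemma sum_dsub:
  "sum (dterm \<phi> x) (dsub N k n) = (if x \<in> dint k n then tsq N (dl k n) (dl (k + 1) n) \<phi> x else 0)"
proof (induction N arbitrary: k n)
  case 0
  then show ?case by (simp add: dsub_0)
next
  case (Suc N)
  let ?A = "dsub N (2 * k) (n - 1)" and ?B = "dsub N (2 * k + 1) (n - 1)"
  have "?A \<inter> ?B = {}"
    using dsub_subset dint_halves(2)[of k n] by blast
  moreover have "dint k n \<notin> ?A \<union> ?B"
  proof
    assume "dint k n \<in> ?A \<union> ?B"
    then have "dint k n \<subseteq> dint (2 * k) (n - 1) \<or> dint k n \<subseteq> dint (2 * k + 1) (n - 1)"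
      using dsub_subset by blast
    moreover have "dl (2 * k) (n - 1) \<in> dint (2 * k) (n - 1)" "dl (2 * k + 1) (n - 1) \<in> dint (2 * k + 1) (n - 1)"
      by (simp_all add: dint_def)
    ultimately show False using dint_halves[of k n] by blast
  qed
  ultimately have "sum (dterm \<phi> x) (dsub (Suc N) k n) = dterm \<phi> x (dint k n) + (sum (dterm \<phi> x) ?A + sum (dterm \<phi> x) ?B)"
    by (simp add: dsub_Suc sum.union_disjoint finite_dsub)
  also have "\<dots> = (if x \<in> dint k n then tsq (Suc N) (dl k n) (dl (k + 1) n) \<phi> x else 0)"
  proof (cases "x \<in> dint k n")
    case True
    have "x \<in> dint (2 * k) (n - 1) \<longleftrightarrow> x < dl (2 * k + 1) (n - 1)" "x \<in> dint (2 * k + 1) (n - 1) \<longleftrightarrow> \<not> x < dl (2 * k + 1) (n - 1)"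
      using True unfolding dint_def dl_double dl_double_Suc by auto
    then show ?thesis using True
      by (simp only: Suc.IH dterm_dint tsq.simps dl_mid if_True dl_double dl_double_Suc) simp
  next
    case False
    then have "x \<notin> dint (2 * k) (n - 1)" "x \<notin> dint (2 * k + 1) (n - 1)"
      using dint_halves(1)[of k n] by blast+
    then show ?thesis using False by (simp only: Suc.IH dterm_dint if_False)
  qed
  finally show ?case .
qed

text \<open>A sum of nonnegative terms is the supremum over finite index sets, and the sets
  \<open>dsub N k n\<close> are cofinal among these.\<close>

lemma sq_fun2_dint:
  assumes "x \<in> dint k n"
  shows "sq_fun2 (dint k n) \<phi> x = sq (dl k n) (dl (k + 1) n) \<phi> x"
proof -
  let ?A = "{I \<in> dyadic. I \<subseteq> dint k n}"
  have sum_dsub': "(\<Sum>I\<in>dsub N k n. ennreal (dterm \<phi> x I)) = ennreal (tsq N (dl k n) (dl (k + 1) n) \<phi> x)" for N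
  proof -
    have "0 \<le> dterm \<phi> x I" for I by (simp add: dterm_def)
    then show ?thesis using assms by (simp add: sum_ennreal sum_dsub)
  qed
  have mono: "dsub M k n \<subseteq> dsub N k n" if "M \<le> N" for M N
  proof
    fix I assume "I \<in> dsub M k n"
    then obtain j m where "I = dint j m" "dint j m \<subseteq> dint k n" "n - int M < m" by (rule dsubE)
    then show "I \<in> dsub N k n" using that by (simp add: dsubI)
  qed
  have cover: "\<exists>N. I \<in> dsub N k n" if "I \<in> ?A" for I
  proof -
    obtain j m where "I = dint j m" "dint j m \<subseteq> dint k n" using \<open>I \<in> ?A\<close> by (auto simp: dyadic_iff)
    then have "I \<in> dsub (nat (n - m + 1)) k n" by (simp add: dsubI)
    then show ?thesis ..
  qed
  have "sq_fun2 (dint k n) \<phi> x = (\<Sum>\<^sub>\<infinity>I\<in>?A. ennreal (dterm \<phi> x I))"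
    by (simp add: sq_fun2_def dterm_def)
  also have "\<dots> = (SUP F\<in>{F. finite F \<and> F \<subseteq> ?A}. \<Sum>I\<in>F. ennreal (dterm \<phi> x I))"
    by (rule nonneg_infsum_complete) simp
  also have "\<dots> = (SUP N. \<Sum>I\<in>dsub N k n. ennreal (dterm \<phi> x I))"
  proof (rule antisym)
    show "(SUP N. \<Sum>I\<in>dsub N k n. ennreal (dterm \<phi> x I)) \<le> (SUP F\<in>{F. finite F \<and> F \<subseteq> ?A}. \<Sum>I\<in>F. ennreal (dterm \<phi> x I))"
    proof (rule SUP_mono)
      fix N
      have "dsub N k n \<in> {F. finite F \<and> F \<subseteq> ?A}"
        using finite_dsub dyadic_iff by (blast elim: dsubE)
      then show "\<exists>F\<in>{F. finite F \<and> F \<subseteq> ?A}. (\<Sum>I\<in>dsub N k n. ennreal (dterm \<phi> x I)) \<le> (\<Sum>I\<in>F. ennreal (dterm \<phi> x I))"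
        by blast
    qed
    show "(SUP F\<in>{F. finite F \<and> F \<subseteq> ?A}. \<Sum>I\<in>F. ennreal (dterm \<phi> x I)) \<le> (SUP N. \<Sum>I\<in>dsub N k n. ennreal (dterm \<phi> x I))"
    proof (rule SUP_mono)
      fix F assume "F \<in> {F. finite F \<and> F \<subseteq> ?A}"
      then have F: "finite F" "F \<subseteq> ?A" by auto
      have "\<exists>N. F \<subseteq> dsub N k n"
        using F
      proof (induction F rule: finite_induct)
        case (insert I F)
        then obtain N M where "F \<subseteq> dsub N k n" "I \<in> dsub M k n" using cover[of I] by auto
        then have "insert I F \<subseteq> dsub (max M N) k n"
          using mono[of N "max M N"] mono[of M "max M N"] by auto
        then show ?case ..
      qed simp
      then obtain N where "F \<subseteq> dsub N k n" ..
      then have "(\<Sum>I\<in>F. ennreal (dterm \<phi> x I)) \<le> (\<Sum>I\<in>dsub N k n. ennreal (dterm \<phi> x I))"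
        by (intro sum_mono2 finite_dsub) auto
      then show "\<exists>N\<in>UNIV. (\<Sum>I\<in>F. ennreal (dterm \<phi> x I)) \<le> (\<Sum>I\<in>dsub N k n. ennreal (dterm \<phi> x I))"
        by blast
    qed
  qed
  also have "\<dots> = sq (dl k n) (dl (k + 1) n) \<phi> x"
    by (simp add: sum_dsub' sq_def)
  finally show ?thesis .
qed

lemma level_frac_dint:
  "level_frac (dint k n) \<phi> lam = lev (dl k n) (dl (k + 1) n) \<phi> lam / (dl (k + 1) n - dl k n)"
proof -
  have set: "{x \<in> dint k n. ennreal lam \<le> sq_fun2 (dint k n) \<phi> x} = {x \<in> dint k n. ennreal lam \<le> sq (dl k n) (dl (k + 1) n) \<phi> x}"
  proof -
    have "ennreal lam \<le> sq_fun2 (dint k n) \<phi> x \<longleftrightarrow> ennreal lam \<le> sq (dl k n) (dl (k + 1) n) \<phi> x"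
      if "x \<in> dint k n" for x using sq_fun2_dint[OF that] by (rule arg_cong)
    then show ?thesis by blast
  qed
  have "measure lebesgue (dint k n) = dl (k + 1) n - dl k n"
    by (simp add: dint_def)
  then show ?thesis by (simp only: level_frac_def set lev_def) (simp only: dint_def)
qed

section \<open>The set of attainable pairs\<close>

definition att :: "real \<Rightarrow> real \<Rightarrow> (real \<times> real) set" where
  "att f lam = {(lev 0 1 \<phi> lam, iint 0 1 (\<lambda>x. \<bar>\<phi> x\<bar>)) | \<phi>. intg 0 1 \<phi> \<and> iint 0 1 \<phi> = f}"

lemma mean_01 [simp]: "mean 0 1 \<phi> = iint 0 1 \<phi>"
  by (simp add: mean_def)

lemma attI: "intg 0 1 \<phi> \<Longrightarrow> iint 0 1 \<phi> = f \<Longrightarrow> (lev 0 1 \<phi> lam, iint 0 1 (\<lambda>x. \<bar>\<phi> x\<bar>)) \<in> att f lam"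
  unfolding att_def by blast

lemma attE:
  assumes "(p, F) \<in> att f lam"
  obtains \<phi> where "intg 0 1 \<phi>" "iint 0 1 \<phi> = f" "lev 0 1 \<phi> lam = p" "iint 0 1 (\<lambda>x. \<bar>\<phi> x\<bar>) = F"
  using assms unfolding att_def by blast

lemma set_integrable_iff_supported:
  "(\<And>x. x \<notin> {a..<b} \<Longrightarrow> \<phi> x = 0) \<Longrightarrow> intg a b \<phi> \<longleftrightarrow> integrable lebesgue \<phi>" for \<phi> :: "real \<Rightarrow> real"
  unfolding set_integrable_def by (intro arg_cong[where f = "integrable lebesgue"] ext) (auto simp: indicator_def)

text \<open>Affine change of variables between \<open>J\<close> and \<open>{0..<1}\<close>. As the
  left side does not mention \<open>J\<close>, the two extremal quantities may be taken on different
  intervals.\<close>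

lemma att_dyadic:
  assumes "J \<in> dyadic"
  shows "att f lam = {(level_frac J \<phi> lam, avg J (\<lambda>x. \<bar>\<phi> x\<bar>)) | \<phi>. admissible J \<phi> \<and> avg J \<phi> = f}"
proof -
  obtain k n where J: "J = dint k n" using assms by (auto simp: dyadic_iff)
  define a where "a = dl k n"
  define c where "c = dl (k + 1) n - dl k n"
  have c: "0 < c" by (simp add: c_def)
  have Jac: "J = {a + c * 0..<a + c * 1}" by (simp add: J dint_def a_def c_def)
  have avg: "avg J \<phi> = iint 0 1 (\<lambda>y. \<phi> (a + c * y))" for \<phi>
    unfolding Jac by (subst avg_ico) (use c mean_affine[OF c, of a 0 1] in auto)
  have level: "level_frac J \<phi> lam = lev 0 1 (\<lambda>y. \<phi> (a + c * y)) lam" for \<phi>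
  proof -
    have "level_frac J \<phi> lam = lev (a + c * 0) (a + c * 1) \<phi> lam / c"
      by (simp add: J level_frac_dint a_def c_def)
    then show ?thesis using c by (simp only: lev_affine) simp
  qed
  show ?thesis
  proof (intro equalityI subsetI)
    fix z assume "z \<in> att f lam"
    then obtain \<psi> where \<psi>: "intg 0 1 \<psi>" "iint 0 1 \<psi> = f" "z = (lev 0 1 \<psi> lam, iint 0 1 (\<lambda>x. \<bar>\<psi> x\<bar>))"
      by (auto simp: att_def)
    define \<phi> where "\<phi> x = (if x \<in> J then \<psi> ((x - a) / c) else 0)" for x
    have \<phi>: "\<phi> (a + c * y) = \<psi> y" if "0 \<le> y" "y < 1" for y
      using that c by (simp add: \<phi>_def Jac)
    have "intg 0 1 (\<lambda>y. \<phi> (a + c * y))"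
      using intg_cong[of 0 1 "\<lambda>y. \<phi> (a + c * y)" \<psi>] \<phi> \<psi>(1) by blast
    then have "intg (a + c * 0) (a + c * 1) \<phi>" by (simp only: intg_affine_iff[OF c])
    moreover have "\<phi> x = 0" if "x \<notin> {a + c * 0..<a + c * 1}" for x
      using that by (simp only: \<phi>_def Jac if_False)
    ultimately have "integrable lebesgue \<phi>"
      using set_integrable_iff_supported[of "a + c * 0" "a + c * 1" \<phi>] by blast
    then have "admissible J \<phi>" by (simp add: admissible_def \<phi>_def)
    moreover have "avg J \<phi> = f"
      using iint_cong[of 0 1 "\<lambda>y. \<phi> (a + c * y)" \<psi>] \<phi> \<psi>(2) by (simp add: avg)
    moreover have "avg J (\<lambda>x. \<bar>\<phi> x\<bar>) = iint 0 1 (\<lambda>x. \<bar>\<psi> x\<bar>)"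
      using iint_cong[of 0 1 "\<lambda>y. \<bar>\<phi> (a + c * y)\<bar>" "\<lambda>x. \<bar>\<psi> x\<bar>"] \<phi> by (simp add: avg)
    moreover have "level_frac J \<phi> lam = lev 0 1 \<psi> lam"
      using sq_cong[of 0 1 "\<lambda>y. \<phi> (a + c * y)" \<psi>] \<phi> by (simp add: level lev_def)
    ultimately show "z \<in> {(level_frac J \<phi> lam, avg J (\<lambda>x. \<bar>\<phi> x\<bar>)) | \<phi>. admissible J \<phi> \<and> avg J \<phi> = f}"
      unfolding \<psi>(3) by (intro CollectI exI[of _ \<phi>]) simp
  next
    fix z assume "z \<in> {(level_frac J \<phi> lam, avg J (\<lambda>x. \<bar>\<phi> x\<bar>)) | \<phi>. admissible J \<phi> \<and> avg J \<phi> = f}"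
    then obtain \<phi> where \<phi>: "admissible J \<phi>" "avg J \<phi> = f" "z = (level_frac J \<phi> lam, avg J (\<lambda>x. \<bar>\<phi> x\<bar>))"
      by auto
    have "intg (a + c * 0) (a + c * 1) \<phi>"
      using \<phi>(1) set_integrable_iff_supported[of "a + c * 0" "a + c * 1" \<phi>] unfolding admissible_def Jac by blast
    then have "intg 0 1 (\<lambda>y. \<phi> (a + c * y))" by (simp only: intg_affine_iff[OF c])
    then show "z \<in> att f lam"
      unfolding \<phi>(3) avg level using \<phi>(2) by (intro attI) (simp_all only: avg)
  qed
qed

lemma Bell_M_att:
  assumes "J \<in> dyadic"
  shows "Bell_M J f F lam = Sup {p. (p, F) \<in> att f lam}"
  unfolding Bell_M_def att_dyadic[OF assms] by (rule arg_cong[where f = Sup]) auto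

lemma Bell_L_att:
  assumes "J \<in> dyadic"
  shows "Bell_L J f p lam = Inf {F. (p, F) \<in> att f lam}"
  unfolding Bell_L_def att_dyadic[OF assms] by (rule arg_cong[where f = Inf]) auto

lemma att_bounds:
  assumes "(p, F) \<in> att f lam"
  shows "0 \<le> p" "p \<le> 1" "\<bar>f\<bar> \<le> F"
  using assms lev_le[of 0 1] iint_abs_ge[of 0 1] by (auto elim!: attE)

lemma att_convex:
  assumes "(p, F) \<in> att f lam" "(q, G) \<in> att f lam" "0 \<le> t" "t \<le> 1"
  shows "(t * p + (1 - t) * q, t * F + (1 - t) * G) \<in> att f lam"
proof -
  obtain \<phi> where \<phi>: "intg 0 1 \<phi>" "iint 0 1 \<phi> = f" "lev 0 1 \<phi> lam = p" "iint 0 1 (\<lambda>x. \<bar>\<phi> x\<bar>) = F"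
    using assms(1) by (rule attE)
  obtain \<psi> where \<psi>: "intg 0 1 \<psi>" "iint 0 1 \<psi> = f" "lev 0 1 \<psi> lam = q" "iint 0 1 (\<lambda>x. \<bar>\<psi> x\<bar>) = G"
    using assms(2) by (rule attE)
  obtain g where "intg 0 1 g" "iint 0 1 g = f"
    "iint 0 1 (\<lambda>x. \<bar>g x\<bar>) = t * F + (1 - t) * G" "lev 0 1 g lam = t * p + (1 - t) * q"
    using mix[OF \<phi>(1) \<psi>(1) \<phi>(2) \<psi>(2) assms(3,4), of lam] unfolding \<phi>(3,4) \<psi>(3,4) by blast
  then show ?thesis using attI[of g f lam] by simp
qed

text \<open>This corner and the points of \<open>att_two_valued\<close> are the fixed ends of most
  segments drawn below.\<close>

lemma att_const:
  assumes "0 < lam"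
  shows "(0, \<bar>f\<bar>) \<in> att f lam"
proof -
  have "tsq N a b (\<lambda>x. f) x = 0" if "a < b" for N a b x
    using tsq_affine[OF that, of "\<lambda>_. 0" N f 0 x] by simp
  then have "sq 0 1 (\<lambda>x. f) x = 0" for x by (simp add: sq_def)
  then have "lev 0 1 (\<lambda>x. f) lam = 0" using assms by (simp add: lev_def)
  then show ?thesis using attI[of "\<lambda>x. f" f lam] by simp
qed

text \<open>For \<open>\<bar>f\<bar> \<le> H\<close> one has
  \<open>f - H \<le> 0 \<le> f + H\<close>, so the mean modulus is exactly \<open>H\<close>, while
  the first jump already has size \<open>H \<ge> sqrt lam\<close>.\<close>

lemma att_two_valued:
  assumes "0 < lam" "\<bar>f\<bar> \<le> H" "sqrt lam \<le> H"
  shows "(1, H) \<in> att f lam"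
proof -
  define \<phi> where "\<phi> x = (if x < 1/2 then f - H else f + H)" for x :: real
  have l: "intg 0 (1/2) \<phi>" "iint 0 (1/2) \<phi> = (f - H) / 2" "iint 0 (1/2) (\<lambda>x. \<bar>\<phi> x\<bar>) = \<bar>f - H\<bar> / 2"
    using intg_cong[of 0 "1/2" \<phi> "\<lambda>_. f - H"] iint_cong[of 0 "1/2" \<phi> "\<lambda>_. f - H"]
      iint_cong[of 0 "1/2" "\<lambda>x. \<bar>\<phi> x\<bar>" "\<lambda>_. \<bar>f - H\<bar>"] by (simp_all add: \<phi>_def)
  have r: "intg (1/2) 1 \<phi>" "iint (1/2) 1 \<phi> = (f + H) / 2" "iint (1/2) 1 (\<lambda>x. \<bar>\<phi> x\<bar>) = \<bar>f + H\<bar> / 2"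
    using intg_cong[of "1/2" 1 \<phi> "\<lambda>_. f + H"] iint_cong[of "1/2" 1 \<phi> "\<lambda>_. f + H"]
      iint_cong[of "1/2" 1 "\<lambda>x. \<bar>\<phi> x\<bar>" "\<lambda>_. \<bar>f + H\<bar>"] by (simp_all add: \<phi>_def)
  have \<phi>: "intg 0 1 \<phi>" using l(1) r(1) by (rule intg_join) auto
  have "osc 0 1 \<phi> = H" using l(2) r(2) by (simp add: osc_def mean_def)
  have "lam \<le> H\<^sup>2" using assms by (simp add: sqrt_le_D)
  have "ennreal lam \<le> sq 0 1 \<phi> x" for x
  proof -
    have "ennreal lam \<le> ennreal ((osc 0 1 \<phi>)\<^sup>2)"
      using \<open>osc 0 1 \<phi> = H\<close> \<open>lam \<le> H\<^sup>2\<close> by (intro ennreal_leI) simp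
    also have "\<dots> \<le> sq 0 1 \<phi> x" unfolding sq_rec[of 0 1] by simp
    finally show ?thesis .
  qed
  then have "{x\<in>{0..<1}. ennreal lam \<le> sq 0 1 \<phi> x} = {0..<1}" by auto
  then have "lev 0 1 \<phi> lam = 1" by (simp add: lev_def)
  moreover have "iint 0 1 \<phi> = f"
    using iint_split[OF \<phi>, of "1/2"] l(2) r(2) by (simp add: field_simps)
  moreover have "iint 0 1 (\<lambda>x. \<bar>\<phi> x\<bar>) = H"
    using iint_split[OF intg_abs[OF \<phi>], of "1/2"] l(3) r(3) assms(2) by (simp add: field_simps)
  ultimately show ?thesis using attI[OF \<phi>, of f lam] by simp
qed

lemma att_fill:
  assumes "(p, F) \<in> att f lam" "0 < lam" "0 < \<epsilon>"
  shows "\<exists>G. (1, G) \<in> att f lam \<and> G \<le> F + sqrt lam * (1 - p) + \<epsilon>"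
proof -
  obtain \<phi> where \<phi>: "intg 0 1 \<phi>" "iint 0 1 \<phi> = f" "lev 0 1 \<phi> lam = p" "iint 0 1 (\<lambda>x. \<bar>\<phi> x\<bar>) = F"
    using assms(1) by (rule attE)
  obtain \<psi> where "intg 0 1 \<psi>" "iint 0 1 \<psi> = f" "lev 0 1 \<psi> lam = 1"
    "iint 0 1 (\<lambda>x. \<bar>\<psi> x\<bar>) \<le> F + sqrt lam * (1 - p) + \<epsilon>"
    using fill[OF _ \<phi>(1) assms(2,3)] \<phi>(2-4) by auto
  then show ?thesis using attI[of \<psi> f lam] by auto
qed

lemma att_full:
  assumes "(1, F) \<in> att f lam" "0 < lam" "\<bar>f\<bar> \<le> sqrt lam"
  shows "sqrt lam * Psi (\<bar>f\<bar> / sqrt lam) / Psi 1 \<le> F"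
proof -
  obtain \<phi> where \<phi>: "intg 0 1 \<phi>" "iint 0 1 \<phi> = f" "lev 0 1 \<phi> lam = 1" "iint 0 1 (\<lambda>x. \<bar>\<phi> x\<bar>) = F"
    using assms(1) by (rule attE)
  have "heat (sqrt lam) f \<le> Psi 1 * F"
    using lev_full_bound[OF _ \<phi>(1) assms(2)] \<phi> assms(3) by simp
  then show ?thesis
    using heat_eq_Psi[of "sqrt lam" "\<bar>f\<bar>"] assms(2) Psi_1_pos by (simp add: field_simps)
qed

lemma att_minus: "(p, F) \<in> att f lam \<Longrightarrow> (p, F) \<in> att (- f) lam"
proof (elim attE)
  fix \<phi> assume \<phi>: "intg 0 1 \<phi>" "iint 0 1 \<phi> = f" "lev 0 1 \<phi> lam = p" "iint 0 1 (\<lambda>x. \<bar>\<phi> x\<bar>) = F"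
  have "sq 0 1 (\<lambda>x. - 1 * \<phi> x) x = sq 0 1 \<phi> x" for x
    using tsq_affine[OF _ \<phi>(1), of _ 0 "- 1" x] by (simp add: sq_def)
  then have "lev 0 1 (\<lambda>x. - 1 * \<phi> x) lam = p" using \<phi>(3) by (simp add: lev_def)
  moreover have "iint 0 1 (\<lambda>x. - 1 * \<phi> x) = - f" unfolding iint_cmult using \<phi>(2) by simp
  ultimately show ?thesis
    using attI[of "\<lambda>x. - 1 * \<phi> x" "- f" lam] \<phi> set_integrable_mult_right[of "- 1 :: real" lebesgue "{0..<1}" \<phi>]
    by (simp add: abs_mult)
qed

lemma att_abs: "att \<bar>f\<bar> lam = att f lam"
  using att_minus[of _ _ f lam] att_minus[of _ _ "- f" lam] by (cases "0 \<le> f") auto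

lemma att_nonneg:
  assumes "(p, \<bar>f\<bar>) \<in> att f lam" "0 < lam" "\<bar>f\<bar> \<le> sqrt lam"
  shows "p \<le> Phi (\<bar>f\<bar> / sqrt lam) / Phi 1"
proof -
  obtain \<phi> where \<phi>: "intg 0 1 \<phi>" "iint 0 1 \<phi> = \<bar>f\<bar>" "lev 0 1 \<phi> lam = p" "iint 0 1 (\<lambda>x. \<bar>\<phi> x\<bar>) = \<bar>f\<bar>"
    using assms(1) unfolding att_abs[of f, symmetric] by (rule attE)
  have "p \<le> gauss_int (\<bar>f\<bar> / sqrt lam) / gauss_int 1"
    using lev_nonneg_bound[OF _ \<phi>(1) _ assms(2)] \<phi> assms(3) by simp
  then show ?thesis using assms(2) by (simp add: Phi_eq_gauss_int)
qed

text \<open>Comparison of \<open>\<phi>\<close> with its positive part: \<open>S \<phi> \<ge> sqrt lam\<close> forces \<open>S \<phi>\<^sup>+ \<ge> r sqrt lam\<close> or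
  \<open>S \<phi>\<^sup>- \<ge> (1 - r) sqrt lam\<close>; the first event is controlled by diluting \<open>\<phi>\<^sup>+ / r\<close> with zeros so that its
  mean drops to \<open>f\<close>, the second by the weak-type inequality.\<close>
lemma att_near_abs:
  assumes "(p, F) \<in> att f lam" "0 < f" "0 < lam" "0 < r" "r < 1"
    and m: "\<And>q. (q, f) \<in> att f lam \<Longrightarrow> q \<le> m"
  shows "p \<le> (F + f) / (2 * r * f) * m + Psi 1 * (F - f) / (2 * (1 - r) * sqrt lam)"
proof -
  obtain \<phi> where \<phi>: "intg 0 1 \<phi>" "iint 0 1 \<phi> = f" "lev 0 1 \<phi> lam = p" "iint 0 1 (\<lambda>x. \<bar>\<phi> x\<bar>) = F"
    using assms(1) by (rule attE)
  define P where "P x = 1 / (2 * r) * (\<bar>\<phi> x\<bar> + \<phi> x)" for x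
  define Q where "Q x = 1 / 2 * (\<bar>\<phi> x\<bar> + - 1 * \<phi> x)" for x
  have i: "intg 0 1 (\<lambda>x. \<bar>\<phi> x\<bar>)" "intg 0 1 (\<lambda>x. - 1 * \<phi> x)"
    by (intro intg_abs set_integrable_mult_right \<phi>(1))+
  have P: "intg 0 1 P" "iint 0 1 P = (F + f) / (2 * r)" "\<And>x. 0 \<le> P x"
  proof -
    show "intg 0 1 P" unfolding P_def by (intro set_integrable_mult_right set_integral_add i \<phi>(1))
    show "iint 0 1 P = (F + f) / (2 * r)"
      unfolding P_def iint_cmult iint_add[OF i(1) \<phi>(1)] \<phi>(2,4) by simp
    show "0 \<le> P x" for x unfolding P_def using assms(4) by (intro mult_nonneg_nonneg) auto
  qed
  have Q: "intg 0 1 Q" "iint 0 1 Q = (F - f) / 2" "\<And>x. 0 \<le> Q x"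
  proof -
    show "intg 0 1 Q" unfolding Q_def by (intro set_integrable_mult_right set_integral_add i)
    show "iint 0 1 Q = (F - f) / 2"
      unfolding Q_def iint_cmult iint_add[OF i] \<phi>(2,4) by simp
    show "0 \<le> Q x" for x unfolding Q_def by (intro mult_nonneg_nonneg) auto
  qed
  have \<phi>_eq: "\<phi> = (\<lambda>x. (0 + r * P x) - Q x)"
    using assms(4) by (auto simp: P_def Q_def field_simps)
  have rP: "intg 0 1 (\<lambda>x. 0 + r * P x)" using P(1) by (simp add: set_integrable_mult_right)
  have tsq_le: "tsq N 0 1 \<phi> x \<le> r * tsq N 0 1 P x + tsq N 0 1 Q x / (1 - r)" for N x
    using tsq_diff_le[OF _ rP Q(1) assms(4,5), of N x] assms(4)
    unfolding \<phi>_eq[symmetric] tsq_affine[OF zero_less_one P(1)] by (simp add: power2_eq_square)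
  \<comment> \<open>\<open>P\<close> already carries the factor \<open>1 / r\<close>, so its
    threshold is \<open>lam\<close> itself; in \<open>tsq_le\<close> the two thresholds add up to
    \<open>r * lam + (1 - r) * lam\<close>.\<close>
  let ?lq = "(1 - r)\<^sup>2 * lam"
  have lq: "0 < ?lq" using assms by simp
  have split: "ennreal lam \<le> sq 0 1 P x \<or> ennreal ?lq \<le> sq 0 1 Q x" if "ennreal lam \<le> sq 0 1 \<phi> x" for x
  proof (rule ccontr)
    assume "\<not> ?thesis"
    then have "sq 0 1 P x < ennreal lam" "sq 0 1 Q x < ennreal ?lq" by auto
    then obtain \<alpha> \<beta> where \<alpha>: "0 \<le> \<alpha>" "sq 0 1 P x = ennreal \<alpha>" "\<alpha> < lam" and \<beta>: "0 \<le> \<beta>" "sq 0 1 Q x = ennreal \<beta>" "\<beta> < ?lq"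
      by (cases "sq 0 1 P x"; cases "sq 0 1 Q x") (auto simp: ennreal_less_iff)
    have "tsq N 0 1 P x \<le> \<alpha>" "tsq N 0 1 Q x \<le> \<beta>" for N
    proof -
      have "ennreal (tsq N 0 1 P x) \<le> ennreal \<alpha>" "ennreal (tsq N 0 1 Q x) \<le> ennreal \<beta>"
        unfolding \<alpha>(2)[symmetric] \<beta>(2)[symmetric] sq_def by (auto intro: SUP_upper)
      then show "tsq N 0 1 P x \<le> \<alpha>" "tsq N 0 1 Q x \<le> \<beta>" using \<alpha>(1) \<beta>(1) by auto
    qed
    then have "tsq N 0 1 \<phi> x \<le> r * \<alpha> + \<beta> / (1 - r)" for N
      using assms(4,5) by (intro order_trans[OF tsq_le] add_mono mult_left_mono divide_right_mono) auto
    then have "sq 0 1 \<phi> x \<le> ennreal (r * \<alpha> + \<beta> / (1 - r))"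
      unfolding sq_def by (intro SUP_least ennreal_leI)
    also have "r * \<alpha> + \<beta> / (1 - r) < lam"
    proof -
      have "r * \<alpha> < r * lam" using \<alpha>(3) assms(4) by simp
      moreover have "\<beta> / (1 - r) < (1 - r) * lam"
        using \<beta>(3) assms(5) by (simp add: divide_less_eq power2_eq_square mult_ac)
      ultimately show ?thesis by (simp add: algebra_simps)
    qed
    then have "ennreal (r * \<alpha> + \<beta> / (1 - r)) < ennreal lam" using assms(3) by (rule ennreal_lessI[rotated])
    finally show False using that by simp
  qed
  have "p \<le> lev 0 1 P lam + lev 0 1 Q ?lq"
    unfolding \<phi>(3)[symmetric] lev_eq_iint iint_add[OF intg_indicator_sq intg_indicator_sq, symmetric]
    using split by (intro iint_mono intg_indicator_sq set_integral_add) (auto simp: indicator_def)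
  moreover have "lev 0 1 Q ?lq \<le> Psi 1 * (F - f) / (2 * (1 - r) * sqrt lam)"
  proof -
    have "iint 0 1 (\<lambda>x. \<bar>Q x\<bar>) = (F - f) / 2" using Q(2,3) by simp
    then have "sqrt ?lq * lev 0 1 Q ?lq \<le> Psi 1 * ((F - f) / 2)"
      using weak_type[OF zero_less_one Q(1) lq] by (simp only:)
    moreover have "sqrt ?lq = (1 - r) * sqrt lam" using assms(5) by (simp add: real_sqrt_mult)
    ultimately have "((1 - r) * sqrt lam) * lev 0 1 Q ?lq \<le> Psi 1 * ((F - f) / 2)" by (simp only:)
    then show ?thesis using assms(3,5) by (simp add: field_simps)
  qed
  moreover have "lev 0 1 P lam \<le> (F + f) / (2 * r * f) * m"
  proof -
    \<comment> \<open>\<open>t\<close> dilutes the mean \<open>(F + f) / (2 * r)\<close> of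
      \<open>P\<close> to \<open>f\<close>. The result is nonnegative, so its modulus has mean
      \<open>f\<close> as well and the bound \<open>m\<close> applies.\<close>
    define t where "t = 2 * r * f / (F + f)"
    have F: "f \<le> F" using att_bounds(3)[OF assms(1)] by simp
    have "r * f \<le> f" using assms by simp
    then have "2 * r * f \<le> F + f" using F by linarith
    then have t: "0 \<le> t" "t \<le> 1" using F assms(2,4) by (auto simp: t_def)
    obtain g where g: "intg 0 1 g" "iint 0 1 g = t * iint 0 1 P" "\<And>x. 0 \<le> g x" "t * lev 0 1 P lam \<le> lev 0 1 g lam"
      using glue_scaled[OF P(1,3) t, of lam] by blast
    have "iint 0 1 g = f" using g(2) P(2) F assms by (simp add: t_def)
    moreover have "iint 0 1 (\<lambda>x. \<bar>g x\<bar>) = iint 0 1 g" using g(3) by simp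
    ultimately have "(lev 0 1 g lam, f) \<in> att f lam" using attI[OF g(1), of f lam] by simp
    then have "t * lev 0 1 P lam \<le> m" using m g(4) by force
    then show ?thesis using F assms by (simp add: t_def field_simps)
  qed
  ultimately show ?thesis by linarith
qed

text \<open>Right-continuity at \<open>\<bar>f\<bar>\<close>. For \<open>f = 0\<close> the weak-type
  inequality forces \<open>p \<le> 0\<close>. Otherwise, in \<open>att_near_abs\<close>,
  \<open>F\<close> tends to \<open>\<bar>f\<bar>\<close> before \<open>r\<close> tends to 1, as the
  second term has the factor \<open>1 / (1 - r)\<close>.\<close>

lemma att_limit:
  assumes lam: "0 < lam" and near: "\<And>\<epsilon>. 0 < \<epsilon> \<Longrightarrow> \<exists>F. (p, F) \<in> att f lam \<and> F < \<bar>f\<bar> + \<epsilon>"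
    and m: "\<And>q. (q, \<bar>f\<bar>) \<in> att f lam \<Longrightarrow> q \<le> m"
  shows "p \<le> m"
proof (cases "f = 0")
  case True
  have "sqrt lam * p \<le> 0"
  proof (rule field_le_epsilon)
    fix e :: real assume "0 < e"
    then obtain F where F: "(p, F) \<in> att f lam" "F < e / Psi 1"
      using near[of "e / Psi 1"] Psi_1_pos True by auto
    obtain \<phi> where \<phi>: "intg 0 1 \<phi>" "lev 0 1 \<phi> lam = p" "iint 0 1 (\<lambda>x. \<bar>\<phi> x\<bar>) = F"
      using F(1) by (rule attE)
    have "sqrt lam * p \<le> Psi 1 * F" using weak_type[OF _ \<phi>(1) lam] \<phi>(2,3) by simp
    also have "\<dots> \<le> e" using F(2) Psi_1_pos by (simp add: field_simps)
    finally show "sqrt lam * p \<le> 0 + e" by simp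
  qed
  then have "p \<le> 0" using lam by (simp add: mult_le_0_iff)
  then show ?thesis using m[OF att_const[OF lam]] by simp
next
  case False
  define g where "g = \<bar>f\<bar>"
  have g: "0 < g" using False by (simp add: g_def)
  have m0: "0 \<le> m" using m[OF att_const[OF lam]] .
  have bound: "p \<le> m / r" if r: "0 < r" "r < 1" for r
  proof (rule field_le_epsilon)
    fix e :: real assume e: "0 < e"
    \<comment> \<open>\<open>K\<close> is the slope in \<open>F\<close> of the bound of
      \<open>att_near_abs\<close>, whose value at \<open>F = g\<close> is
      \<open>m / r\<close>.\<close>
    define K where "K = m / (2 * r * g) + Psi 1 / (2 * (1 - r) * sqrt lam)"
    have K: "0 \<le> K" using m0 r g lam Psi_1_pos by (simp add: K_def)
    obtain F where F: "(p, F) \<in> att f lam" "F < g + e / (K + 1)"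
      using near[of "e / (K + 1)"] e K by (auto simp: g_def)
    have "p \<le> (F + g) / (2 * r * g) * m + Psi 1 * (F - g) / (2 * (1 - r) * sqrt lam)"
      using F(1) m g lam r unfolding att_abs[of f, symmetric] g_def[symmetric] by (intro att_near_abs) auto
    also have "\<dots> = m / r + (F - g) * K"
      using r g lam by (simp add: K_def field_simps)
    also have "\<dots> \<le> m / r + e / (K + 1) * K"
      using F(2) K by (intro add_left_mono mult_right_mono) auto
    also have "e / (K + 1) * K \<le> e" using K e by (simp add: field_simps)
    finally show "p \<le> m / r + e" by simp
  qed
  have le: "r * p \<le> m" if r: "0 < r" "r < 1" for r
    using bound[OF r] r(1) by (simp add: pos_le_divide_eq mult.commute)
  have "1 * p \<le> m"
    by (rule at_left_le[where g = "\<lambda>r. r * p" and c = 0]) (use le in \<open>auto intro: continuous_intros\<close>)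
  then show ?thesis by simp
qed

section \<open>The two inversion identities\<close>

definition att_sup :: "real \<Rightarrow> real \<Rightarrow> real \<Rightarrow> real" where
  "att_sup f lam F = Sup {p. (p, F) \<in> att f lam}"

definition att_inf :: "real \<Rightarrow> real \<Rightarrow> real \<Rightarrow> real" where
  "att_inf f lam p = Inf {F. (p, F) \<in> att f lam}"

context
  fixes f lam :: real
  assumes lam: "0 < lam"
begin

lemma le_att_sup: "(p, F) \<in> att f lam \<Longrightarrow> p \<le> att_sup f lam F"
  unfolding att_sup_def by (intro cSup_upper bdd_aboveI[of _ 1]) (auto dest: att_bounds)

lemma att_inf_le: "(p, F) \<in> att f lam \<Longrightarrow> att_inf f lam p \<le> F"
  unfolding att_inf_def by (intro cInf_lower bdd_belowI[of _ "\<bar>f\<bar>"]) (auto dest: att_bounds)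

lemma att_segment_ex:
  assumes "\<bar>f\<bar> \<le> F"
  shows "\<exists>p. (p, F) \<in> att f lam"
proof -
  define H where "H = \<bar>F\<bar> + sqrt lam"
  have H: "\<bar>f\<bar> < H" "F < H" using assms lam by (auto simp: H_def intro: le_less_trans[OF order_trans[OF assms abs_ge_self]])
  then have top: "(1, H) \<in> att f lam" using lam by (intro att_two_valued) (auto simp: H_def)
  define t where "t = (F - \<bar>f\<bar>) / (H - \<bar>f\<bar>)"
  have t: "0 \<le> t" "t \<le> 1" using H assms by (auto simp: t_def)
  have "t * (H - \<bar>f\<bar>) = F - \<bar>f\<bar>" using H by (simp add: t_def)
  then have "t * H + (1 - t) * \<bar>f\<bar> = F" by (simp add: algebra_simps)
  then show ?thesis using att_convex[OF top att_const[OF lam] t] by auto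
qed

lemma att_level_ex:
  assumes "0 \<le> p" "p \<le> 1"
  shows "\<exists>F. (p, F) \<in> att f lam"
proof -
  have "(1, \<bar>f\<bar> + sqrt lam) \<in> att f lam" using lam by (intro att_two_valued) auto
  from att_convex[OF this att_const[OF lam] assms] show ?thesis by auto
qed

lemma less_att_supE:
  assumes "\<bar>f\<bar> \<le> F" "x < att_sup f lam F"
  obtains p where "(p, F) \<in> att f lam" "x < p"
  using assms att_segment_ex[OF assms(1)] less_cSupD[of "{p. (p, F) \<in> att f lam}" x] unfolding att_sup_def by auto

lemma att_inf_lessE:
  assumes "0 \<le> p" "p \<le> 1" "att_inf f lam p < x"
  obtains F where "(p, F) \<in> att f lam" "F < x"
  using assms att_level_ex[OF assms(1,2)] cInf_lessD[of "{F. (p, F) \<in> att f lam}" x] unfolding att_inf_def by auto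

lemma att_sup_bounds:
  assumes "\<bar>f\<bar> \<le> F"
  shows "0 \<le> att_sup f lam F" "att_sup f lam F \<le> 1"
proof -
  obtain p where p: "(p, F) \<in> att f lam" using att_segment_ex[OF assms] ..
  then show "0 \<le> att_sup f lam F" using le_att_sup[OF p] att_bounds(1)[OF p] by simp
  show "att_sup f lam F \<le> 1" unfolding att_sup_def using p by (intro cSup_least) (auto dest: att_bounds)
qed

lemma att_inf_ge:
  assumes "0 \<le> p" "p \<le> 1"
  shows "\<bar>f\<bar> \<le> att_inf f lam p"
  unfolding att_inf_def using att_level_ex[OF assms] by (intro cInf_greatest) (auto dest: att_bounds)

text \<open>A level above \<open>p\<close> at the same \<open>F\<close> could be lowered to
  \<open>p\<close> along the segment to \<open>(0, \<bar>f\<bar>)\<close>, with mean below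
  \<open>F\<close> unless \<open>F = \<bar>f\<bar>\<close>; there \<open>att_nonneg\<close> and the
  lower bound on \<open>p\<close> exclude it.\<close>

lemma att_sup_att_inf:
  assumes f: "\<bar>f\<bar> \<le> sqrt lam" and p: "0 \<le> p" "p \<le> 1" "Phi (\<bar>f\<bar> / sqrt lam) / Phi 1 \<le> p"
  shows "att_sup f lam (att_inf f lam p) = p"
proof (rule antisym)
  define F where "F = att_inf f lam p"
  have F: "\<bar>f\<bar> \<le> F" unfolding F_def using p by (intro att_inf_ge) auto
  show "att_sup f lam (att_inf f lam p) \<le> p"
  proof (rule ccontr)
    assume "\<not> ?thesis"
    then have "p < att_sup f lam F" by (simp add: F_def)
    then obtain q where q: "(q, F) \<in> att f lam" "p < q" using less_att_supE[OF F] by blast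
    define t where "t = p / q"
    have t: "0 \<le> t" "t < 1" "t * q = p" using p q by (auto simp: t_def)
    have "(p, t * F + (1 - t) * \<bar>f\<bar>) \<in> att f lam"
      using att_convex[OF q(1) att_const[OF lam], of t] t by simp
    then have "F \<le> t * F + (1 - t) * \<bar>f\<bar>" unfolding F_def by (rule att_inf_le)
    then have "(1 - t) * F \<le> (1 - t) * \<bar>f\<bar>" by (simp add: algebra_simps)
    then have "F \<le> \<bar>f\<bar>" using t by simp
    then have "F = \<bar>f\<bar>" using F by simp
    then have "q \<le> Phi (\<bar>f\<bar> / sqrt lam) / Phi 1" using att_nonneg[of q f lam] q(1) lam f by simp
    then show False using q p by simp
  qed
  show "p \<le> att_sup f lam (att_inf f lam p)"
  \<comment> \<open>At \<open>F = \<bar>f\<bar>\<close> the mean cannot be lowered towards the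
    corner, so the limit argument takes over.\<close>
  proof (cases "F = \<bar>f\<bar>")
    case True
    show ?thesis
    proof (rule att_limit[OF lam])
      fix \<epsilon> :: real assume "0 < \<epsilon>"
      then have "att_inf f lam p < \<bar>f\<bar> + \<epsilon>" using True by (simp add: F_def)
      then show "\<exists>F. (p, F) \<in> att f lam \<and> F < \<bar>f\<bar> + \<epsilon>" using att_inf_lessE[OF p(1,2)] by metis
    next
      fix q assume "(q, \<bar>f\<bar>) \<in> att f lam"
      then show "q \<le> att_sup f lam (att_inf f lam p)" using le_att_sup True by (simp add: F_def)
    qed
  next
    case False
    then have Ff: "0 < F - \<bar>f\<bar>" using F by simp
    have "p - att_sup f lam F \<le> 0"
    proof (rule field_le_epsilon)
      fix e :: real assume e: "0 < e"
      obtain G where G: "(p, G) \<in> att f lam" "G < F + e * (F - \<bar>f\<bar>)"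
        using att_inf_lessE[OF p(1,2), of "F + e * (F - \<bar>f\<bar>)"] e Ff by (auto simp: F_def)
      have FG: "F \<le> G" unfolding F_def using G(1) by (rule att_inf_le)
      \<comment> \<open>\<open>t\<close> brings the mean from \<open>G\<close> down to exactly
        \<open>F\<close>. The level drops to \<open>t * p\<close>, and the choice of
        \<open>G\<close> gives \<open>1 - t \<le> e\<close>.\<close>
      define t where "t = (F - \<bar>f\<bar>) / (G - \<bar>f\<bar>)"
      have t: "0 \<le> t" "t \<le> 1" using FG Ff by (auto simp: t_def)
      have "t * (G - \<bar>f\<bar>) = F - \<bar>f\<bar>" using FG Ff by (simp add: t_def)
      then have "t * G + (1 - t) * \<bar>f\<bar> = F" by (simp add: algebra_simps)
      then have "(t * p, F) \<in> att f lam" using att_convex[OF G(1) att_const[OF lam] t] by simp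
      then have "t * p \<le> att_sup f lam F" by (rule le_att_sup)
      moreover have "(1 - t) * p \<le> 1 - t" using t p by (simp add: mult_left_le)
      moreover have "1 - t \<le> e"
      proof -
        have "1 - t = (G - F) / (G - \<bar>f\<bar>)" using FG Ff by (simp add: t_def field_simps)
        also have "\<dots> \<le> (G - F) / (F - \<bar>f\<bar>)" using FG Ff by (intro divide_left_mono) auto
        also have "\<dots> \<le> e" using G(2) Ff by (simp add: divide_le_eq)
        finally show ?thesis .
      qed
      ultimately show "p - att_sup f lam F \<le> 0 + e" by (simp add: algebra_simps)
    qed
    then show ?thesis by (simp add: F_def)
  qed
qed

text \<open>For \<open>\<le>\<close>, a near-optimal pair is raised to level \<open>q\<close>
  towards a filled function, at a price of about \<open>sqrt lam\<close> per unit of level. For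
  \<open>\<ge>\<close>, a pair \<open>(q, G)\<close> with \<open>G < F\<close> and
  \<open>q < 1\<close>, mixed with a two-valued function, would exceed level \<open>q\<close> at
  mean \<open>F\<close>; for \<open>q = 1\<close>, \<open>att_full\<close> contradicts the upper
  bound on \<open>F\<close>.\<close>

lemma att_inf_att_sup:
  assumes f: "\<bar>f\<bar> \<le> sqrt lam" and F: "\<bar>f\<bar> \<le> F" "F \<le> sqrt lam * Psi (\<bar>f\<bar> / sqrt lam) / Psi 1"
  shows "att_inf f lam (att_sup f lam F) = F"
proof (rule antisym)
  define q where "q = att_sup f lam F"
  have q: "0 \<le> q" "q \<le> 1" using att_sup_bounds[OF F(1)] by (auto simp: q_def)
  show "att_inf f lam (att_sup f lam F) \<le> F"
  proof (rule field_le_epsilon)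
    fix e :: real assume e: "0 < e"
    \<comment> \<open>Half of \<open>e\<close> pays for the missing level
      \<open>q - p < \<delta>\<close> at price \<open>sqrt lam\<close>, the other half for the error
      in \<open>att_fill\<close>.\<close>
    define \<delta> where "\<delta> = e / (2 * sqrt lam)"
    have \<delta>: "0 < \<delta>" "sqrt lam * \<delta> = e / 2" using e lam by (auto simp: \<delta>_def)
    obtain p where p: "(p, F) \<in> att f lam" "q - \<delta> < p" using less_att_supE[OF F(1), of "q - \<delta>"] \<delta> by (auto simp: q_def)
    have pq: "p \<le> q" unfolding q_def using p(1) by (rule le_att_sup)
    obtain G where G: "(1, G) \<in> att f lam" "G \<le> F + sqrt lam * (1 - p) + e / 2"
      using att_fill[OF p(1) lam, of "e / 2"] e by auto
    show "att_inf f lam (att_sup f lam F) \<le> F + e"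
    proof (cases "p = 1")
      case True
      then have "q = p" using q pq by simp
      then show ?thesis using att_inf_le[OF p(1)] e by (simp add: q_def)
    next
      case False
      then have p1: "p < 1" using att_bounds(2)[OF p(1)] by simp
      define t where "t = (q - p) / (1 - p)"
      have t: "0 \<le> t" "t \<le> 1" "t * (1 - p) = q - p" using p1 pq q by (auto simp: t_def)
      then have "t * 1 + (1 - t) * p = q" by (simp add: algebra_simps)
      then have "(q, t * G + (1 - t) * F) \<in> att f lam" using att_convex[OF G(1) p(1) t(1,2)] by simp
      then have "att_inf f lam q \<le> t * G + (1 - t) * F" by (rule att_inf_le)
      also have "\<dots> = F + t * (G - F)" by (simp add: algebra_simps)
      also have "t * (G - F) \<le> t * (sqrt lam * (1 - p) + e / 2)" using G(2) t by (intro mult_left_mono) auto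
      also have "\<dots> = sqrt lam * (q - p) + t * (e / 2)" using t(3) by (simp add: distrib_left mult.left_commute)
      also have "\<dots> \<le> sqrt lam * \<delta> + 1 * (e / 2)"
        using t p(2) lam e by (intro add_mono mult_left_mono mult_right_mono) auto
      also have "\<dots> = e" using \<delta>(2) by simp
      finally show ?thesis by (simp add: q_def)
    qed
  qed
  show "F \<le> att_inf f lam (att_sup f lam F)"
  proof (rule ccontr)
    assume "\<not> ?thesis"
    then have "att_inf f lam q < F" by (simp add: q_def)
    then obtain G where G: "(q, G) \<in> att f lam" "G < F" using att_inf_lessE[OF q] by blast
    show False
    proof (cases "q = 1")
      case True
      then show False using att_full[of G f lam] G F lam f by simp
    next
      case False
      define H where "H = \<bar>F\<bar> + sqrt lam"
      have H: "F < H" "\<bar>f\<bar> \<le> H" "sqrt lam \<le> H"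
        using f real_sqrt_gt_zero[OF lam] unfolding H_def by linarith+
      have top: "(1, H) \<in> att f lam" using lam H by (intro att_two_valued) auto
      define t where "t = (F - G) / (H - G)"
      have t: "0 < t" "t \<le> 1" "t * (H - G) = F - G" using G H by (auto simp: t_def)
      have "t * H + (1 - t) * G = F" using t(3) by (simp add: algebra_simps)
      then have "(t * 1 + (1 - t) * q, F) \<in> att f lam" using att_convex[OF top G(1), of t] t by simp
      then have "t * 1 + (1 - t) * q \<le> q" unfolding q_def by (rule le_att_sup)
      then have "t * (1 - q) \<le> 0" by (simp add: algebra_simps)
      then show False using t False q by (simp add: mult_le_0_iff)
    qed
  qed
qed

end

theorem proposition3p4:
  fixes J K :: "real set"
  assumes "J \<in> dyadic" and "K \<in> dyadic"
  shows "(\<forall>(lam::real) (f::real) (p::real).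
            0 < lam \<longrightarrow> 0 \<le> p \<longrightarrow> p \<le> 1 \<longrightarrow> \<bar>f\<bar> \<le> sqrt lam \<longrightarrow>
            Phi (\<bar>f\<bar> / sqrt lam) / Phi 1 \<le> p \<longrightarrow>
            Bell_M J f (Bell_L K f p lam) lam = p) \<and>
         (\<forall>(lam::real) (f::real) (F::real).
            0 < lam \<longrightarrow> \<bar>f\<bar> \<le> sqrt lam \<longrightarrow> \<bar>f\<bar> \<le> F \<longrightarrow>
            F \<le> sqrt lam * Psi (\<bar>f\<bar> / sqrt lam) / Psi 1 \<longrightarrow>
            Bell_L K f (Bell_M J f F lam) lam = F)"
  unfolding Bell_M_att[OF assms(1)] Bell_L_att[OF assms(2)]
  by (intro conjI allI impI att_sup_att_inf[unfolded att_sup_def att_inf_def] att_inf_att_sup[unfolded att_sup_def att_inf_def])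

end
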